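(* Let $X$ be a non-trivial complex Banach space and let $T\in\mathcal{D}'_{L^1}(X)$. Then the following assertions are equivalent: (i) $T\in B'_{AAP}(X)$. (ii) $T*\varphi\in AAP(\mathbb{R}:X)$ for all $\varphi\in\mathcal{D}_0$. (iii) There exist an integer $k\in\mathbb{N}$ and asymptotically almost periodic functions $f_j:\mathbb{R}\to X$ ($0\le j\le k$) such that $T=\sum_{j=0}^kf_j^{(j)}$ on $[0,\infty)$. (iv) There exist an integer $k\in\mathbb{N}$ and bounded asymptotically almost periodic functions $f_j:\mathbb{R}\to X$ ($0\le j\le k$) such that $T=\sum_{j=0}^kf_j^{(j)}$ on $[0,\infty)$. (v) There exist $S\in\mathcal{D}'_{L^1}(X)$, $k\in\mathbb{N}$ and bounded asymptotically almost periodic functions $f_j:\mathbb{R}\to X$ ($0\le j\le k$) such that $S=\sum_{j=0}^kf_j^{(j)}$ on $\mathbb{R}$, and $\langle S,\varphi\rangle=\langle T,\varphi\rangle$ for all $\varphi\in\mathcal{D}_0$. (vi) There exists $S\in\mathcal{D}'_{L^1}(X)$ such that $\langle S,\varphi\rangle=\langle T,\varphi\rangle$ for all $\varphi\in\mathcal{D}_0$ and $S*\varphi\in AAP(\mathbb{R}:X)$ for all $\varphi\in\mathcal{D}$. (vii) There exists a sequence $(T_n)$ in $\mathcal{E}(X)\cap AAP(\mathbb{R}:X)$ such that $\lim_{n\to\infty}T_n=T$ in $\mathcal{D}'_{L^1}(X)$. (viii) $T*\varphi\in AAP(\mathbb{R}:X)$ for all $\varphi\in\mathcal{D}$.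
   Context: $\mathcal{D}$ is the Schwartz space of complex-valued compactly supported smooth functions on $\mathbb{R}$; $\mathcal{D}_0:=\{\varphi\in\mathcal{D}:\operatorname{supp}\varphi\subseteq[0,\infty)\}$; $\mathcal{E}(X)$ is the space of all infinitely differentiable functions $\mathbb{R}\to X$. $\mathcal{D}_{L^1}$ is the Fréchet space of $f\in C^\infty(\mathbb{R})$ with $f^{(j)}\in L^1(\mathbb{R})$ for all $j\in\mathbb{N}_0$, with seminorms $\|f\|_k=\sum_{j=0}^k\|f^{(j)}\|_{L^1}$. $\mathcal{D}'_{L^1}(X)$ (bounded $X$-valued distributions) is the space of continuous linear maps $\mathcal{D}_{L^1}\to X$, with the strong topology (uniform convergence on bounded sets). Functions are identified with regular distributions; derivatives $f_j^{(j)}$ are distributional. An equality of distributions "on $[0,\infty)$" means equality when tested against all $\varphi\in\mathcal{D}_0$. Convolution: $(T*\varphi)(x)=\langle T,\varphi(x-\cdot)\rangle$; translation: $\langle T_h,\varphi\rangle:=\langle T,\varphi(\cdot-h)\rangle$. A continuous $f:\mathbb{R}\to X$ is almost periodic ($f\in AP(\mathbb{R}:X)$) if for each $\epsilon>0$ the set of $\epsilon$-periods $\tau$ (those with $\|f(t+\tau)-f(t)\|\le\epsilon$ for all $t\in\mathbb{R}$) is relatively dense. $C_0([0,\infty):X)$ is the space of bounded continuous functions $[0,\infty)\to X$ vanishing at $+\infty$. A continuous $f:\mathbb{R}\to X$ is asymptotically almost periodic ($f\in AAP(\mathbb{R}:X)$) if there are $g\in AP(\mathbb{R}:X)$ and $q\in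 C_0([0,\infty):X)$ with $f(t)=g(t)+q(t)$ for $t\ge0$ (no boundedness is required for $t<0$). $B'_{+,0}(X):=\{T\in\mathcal{D}'_{L^1}(X):\lim_{h\to+\infty}\langle T_h,\varphi\rangle=0\ \forall\varphi\in\mathcal{D}\}$. $B'_{AP}(X)$ is the space of almost periodic distributions: $T\in\mathcal{D}'_{L^1}(X)$ with $T*\varphi\in AP(\mathbb{R}:X)$ for all $\varphi\in\mathcal{D}$. $B'_{AAP}(X)$ is the space of asymptotically almost periodic distributions: $T\in\mathcal{D}'_{L^1}(X)$ for which there exist $T_{ap}\in B'_{AP}(X)$ and $Q\in B'_{+,0}(X)$ with $\langle T,\varphi\rangle=\langle T_{ap},\varphi\rangle+\langle Q,\varphi\rangle$ for all $\varphi\in\mathcal{D}_0$. *)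

theory Defs
  imports "HOL-Analysis.Analysis"
begin

section \<open>Complex Banach spaces\<close>

class complex_banach = banach +
  fixes scaleC :: "complex \<Rightarrow> 'a \<Rightarrow> 'a"  (infixr \<open>*\<^sub>C\<close> 75)
  assumes scaleC_add_right: "c *\<^sub>C (x + y) = c *\<^sub>C x + c *\<^sub>C y"
    and scaleC_add_left: "(c + d) *\<^sub>C x = c *\<^sub>C x + d *\<^sub>C x"
    and scaleC_scaleC: "c *\<^sub>C (d *\<^sub>C x) = (c * d) *\<^sub>C x"
    and scaleC_of_real: "complex_of_real r *\<^sub>C x = r *\<^sub>R x"
    and norm_scaleC: "norm (c *\<^sub>C x) = cmod c * norm x"

instantiation complex :: complex_banach
begin

definition scaleC_complex :: "complex \<Rightarrow> complex \<Rightarrow> complex" where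
  "scaleC_complex c x = c * x"

instance
  by standard
    (simp_all add: scaleC_complex_def algebra_simps norm_mult scaleR_conv_of_real)

end


section \<open>Smooth functions and test functions\<close>

definition nderiv :: "nat \<Rightarrow> (real \<Rightarrow> 'a::real_normed_vector) \<Rightarrow> real \<Rightarrow> 'a" where
  "nderiv j = (\<lambda>f x. vector_derivative f (at x)) ^^ j"

definition smooth_functions :: "(real \<Rightarrow> 'a::real_normed_vector) set" where
  "smooth_functions = {f. \<forall>j x. nderiv j f differentiable (at x)}"

definition supp :: "(real \<Rightarrow> complex) \<Rightarrow> real set" where
  "supp \<phi> = closure {x. \<phi> x \<noteq> 0}"

definition test_functions :: "(real \<Rightarrow> complex) set"  (\<open>\<D>\<close>) where
  "\<D> = {\<phi> \<in> smooth_functions. compact (supp \<phi>)}"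

definition test_functions_0 :: "(real \<Rightarrow> complex) set"  (\<open>\<D>\<^sub>0\<close>) where
  "\<D>\<^sub>0 = {\<phi> \<in> \<D>. supp \<phi> \<subseteq> {0..}}"


section \<open>The Frechet space of smooth functions with integrable derivatives\<close>

definition DL1 :: "(real \<Rightarrow> complex) set" where
  "DL1 = {f \<in> smooth_functions. \<forall>j. integrable lborel (nderiv j f)}"

definition DL1_norm :: "nat \<Rightarrow> (real \<Rightarrow> complex) \<Rightarrow> real" where
  "DL1_norm k f = (\<Sum>j\<le>k. LINT x|lborel. norm (nderiv j f x))"

definition DL1_topology :: "(real \<Rightarrow> complex) topology" where
  "DL1_topology = topology_generated_by
     {{g \<in> DL1. DL1_norm k (\<lambda>x. g x - f x) < e} | f k e. f \<in> DL1 \<and> e > 0}"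

definition DL1_bounded :: "(real \<Rightarrow> complex) set \<Rightarrow> bool" where
  "DL1_bounded B \<longleftrightarrow> B \<subseteq> DL1 \<and> (\<forall>k. bdd_above (DL1_norm k ` B))"


section \<open>Vector-valued distributions\<close>

text \<open>
  A distribution is represented by a function on all of \<^typ>\<open>real \<Rightarrow> complex\<close>; its values
  outside the relevant space of test functions are irrelevant.
\<close>

type_synonym 'x dist = "(real \<Rightarrow> complex) \<Rightarrow> 'x"

definition bounded_dists :: "'x::complex_banach dist set" where
  "bounded_dists = {T.
     (\<forall>\<phi>\<in>DL1. \<forall>\<psi>\<in>DL1. T (\<lambda>x. \<phi> x + \<psi> x) = T \<phi> + T \<psi>) \<and>
     (\<forall>c. \<forall>\<phi>\<in>DL1. T (\<lambda>x. c * \<phi> x) = c *\<^sub>C T \<phi>) \<and>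
     continuous_map DL1_topology euclidean T}"

definition strong_limit :: "(nat \<Rightarrow> 'x::complex_banach dist) \<Rightarrow> 'x dist \<Rightarrow> bool" where
  "strong_limit T S \<longleftrightarrow> (\<forall>B. DL1_bounded B \<longrightarrow> uniform_limit B T S sequentially)"

definition dist_eq_on :: "(real \<Rightarrow> complex) set \<Rightarrow> 'x dist \<Rightarrow> 'x dist \<Rightarrow> bool" where
  "dist_eq_on \<Phi> S T \<longleftrightarrow> (\<forall>\<phi>\<in>\<Phi>. S \<phi> = T \<phi>)"

text \<open>
  The Henstock-Kurzweil integral is used for regular distributions because the library's Bochner
  integral requires a separable target space. The functions \<open>f\<close> occurring here are continuous and
  \<open>\<phi>\<close> has compact support, so this is just a Riemann integral over a compact interval.
\<close>

definition regular_dist :: "(real \<Rightarrow> 'x::complex_banach) \<Rightarrow> 'x dist" where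
  "regular_dist f \<phi> = integral UNIV (\<lambda>t. \<phi> t *\<^sub>C f t)"

definition dist_deriv :: "nat \<Rightarrow> 'x::complex_banach dist \<Rightarrow> 'x dist" where
  "dist_deriv j T \<phi> = (- 1) ^ j *\<^sub>R T (nderiv j \<phi>)"

definition dist_conv :: "'x dist \<Rightarrow> (real \<Rightarrow> complex) \<Rightarrow> real \<Rightarrow> 'x" where
  "dist_conv T \<phi> x = T (\<lambda>t. \<phi> (x - t))"

definition dist_translate :: "real \<Rightarrow> 'x dist \<Rightarrow> 'x dist" where
  "dist_translate h T \<phi> = T (\<lambda>t. \<phi> (t - h))"


section \<open>Almost periodic and asymptotically almost periodic functions\<close>

definition relatively_dense :: "real set \<Rightarrow> bool" where
  "relatively_dense P \<longleftrightarrow> (\<exists>l>0. \<forall>a. \<exists>\<tau>\<in>P. a \<le> \<tau> \<and> \<tau> \<le> a + l)"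

definition eps_periods :: "real \<Rightarrow> (real \<Rightarrow> 'x::real_normed_vector) \<Rightarrow> real set" where
  "eps_periods e f = {\<tau>. \<forall>t. norm (f (t + \<tau>) - f t) \<le> e}"

definition AP :: "(real \<Rightarrow> 'x::real_normed_vector) set" where
  "AP = {f. continuous_on UNIV f \<and> (\<forall>e>0. relatively_dense (eps_periods e f))}"

text \<open>Values of members of \<open>C0_halfline\<close> at negative arguments are irrelevant.\<close>

definition C0_halfline :: "(real \<Rightarrow> 'x::real_normed_vector) set" where
  "C0_halfline = {q. continuous_on {0..} q \<and> bounded (q ` {0..}) \<and> (q \<longlongrightarrow> 0) at_top}"

definition AAP :: "(real \<Rightarrow> 'x::real_normed_vector) set" where
  "AAP = {f. continuous_on UNIV f \<and>
             (\<exists>g\<in>AP. \<exists>q\<in>C0_halfline. \<forall>t\<ge>0. f t = g t + q t)}"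


section \<open>Almost periodic and asymptotically almost periodic distributions\<close>

definition B_plus0 :: "'x::complex_banach dist set" where
  "B_plus0 = {T \<in> bounded_dists. \<forall>\<phi>\<in>\<D>. ((\<lambda>h. dist_translate h T \<phi>) \<longlongrightarrow> 0) at_top}"

definition B_AP :: "'x::complex_banach dist set" where
  "B_AP = {T \<in> bounded_dists. \<forall>\<phi>\<in>\<D>. dist_conv T \<phi> \<in> AP}"

definition B_AAP :: "'x::complex_banach dist set" where
  "B_AAP = {T \<in> bounded_dists. \<exists>Tap\<in>B_AP. \<exists>Q\<in>B_plus0. dist_eq_on \<D>\<^sub>0 T (\<lambda>\<phi>. Tap \<phi> + Q \<phi>)}"

end

theory Submission
  imports Defs
begin

text \<open>
All conditions are compared with one of them: every regularisation \<open>T * \<phi>\<close>, \<open>\<phi> \<in> \<D>\<close>, is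
asymptotically almost periodic. Write (R) for this.

Conditions about \<open>[0, \<infinity>)\<close> imply (R) because for large \<open>x\<close> the value \<open>(T * \<phi>)(x)\<close> tests \<open>T\<close> only
against functions supported in \<open>[0, \<infinity>)\<close>, and membership in \<open>AAP\<close> depends, apart from continuity,
only on the behaviour at \<open>+\<infinity>\<close> (lemma \<open>AAP_transfer\<close>). So \<open>T\<close> may be replaced by the distribution that
agrees with it there, and for derivatives of functions in \<open>AAP\<close> the regularisation is a convolution
with a test function, which preserves \<open>AAP\<close>. In the same way a test function is a translate of one
supported in \<open>[0, \<infinity>)\<close>. If \<open>T\<close> is a strong limit of functions in \<open>AAP\<close>, then \<open>T * \<phi>\<close> is a uniform limit
of such functions, since the functions \<open>\<phi> (x - \<cdot>)\<close> form a bounded set; and \<open>AAP\<close> is closed under uniform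
limits (\<open>AAP_uniform_approx\<close>), because an almost periodic function is bounded by its values near
infinity.

Conversely, (R) yields everything from a structure theorem on the whole line (\<open>AAP_structure\<close>): \<open>T\<close> is
a finite sum of derivatives of bounded functions in \<open>AAP\<close>. Let \<open>H\<close> be the function on the half line
that jumps from 0 to 1 at the origin and then falls smoothly to 0 on \<open>[0, 1]\<close>. Its derivative is the
point mass at 0 minus a test function \<open>\<theta>\<close>, so \<open>T = T * \<theta> + (T * H)'\<close>. Here \<open>T * \<theta>\<close> is a bounded function
in \<open>AAP\<close>, while \<open>T * H\<close> again satisfies (R) and has order one less than \<open>T\<close>. When the order has dropped
to zero, \<open>T\<close> is continuous for the \<open>L\<^sup>1\<close> norm; then \<open>T * H\<close> is a function, the uniform limit of
\<open>T * H\<^sub>n\<close> for test functions \<open>H\<^sub>n\<close> that converge to \<open>H\<close> in \<open>L\<^sup>1\<close>. Replacing the functions in such a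
representation by their almost periodic parts gives an almost periodic distribution, and what remains
of \<open>T\<close> vanishes at infinity. Finally, rescaling \<open>\<theta>\<close> gives mollifiers, and the mollified distributions
are smooth functions that converge strongly to \<open>T\<close>.

Convolutions enter only through the averages of translates
\<open>t \<mapsto> \<integral> w(s) f(t + c s) ds\<close> over a compact interval (\<open>smear\<close>). They cover mollification, convolution with \<open>H\<close> and
finite differences. Minkowski's inequality bounds them in the norms of the test space, and the
fundamental theorem of calculus shows that a bounded distribution commutes with them (\<open>bd_smear\<close>).
\<close>

section \<open>Iterated derivatives\<close>

lemma nderiv_0 [simp]: "nderiv 0 f = f"
  by (simp add: nderiv_def)

lemma nderiv_Suc: "nderiv (Suc j) f = (\<lambda>x. vector_derivative (nderiv j f) (at x))"
  by (simp add: nderiv_def)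

lemma nderiv_nderiv: "nderiv i (nderiv j f) = nderiv (i + j) f"
  by (simp add: nderiv_def funpow_add)

text \<open>
  This principle spares an induction over the order of differentiation in each closure property of
  smooth functions: it suffices to guess the formula for the derivative of every order.
\<close>

lemma nderiv_chain:
  assumes "\<And>j x. (F j has_vector_derivative F (Suc j) x) (at x)"
  shows nderiv_chain_smooth: "F 0 \<in> smooth_functions"
    and "nderiv j (F 0) = F j"
proof -
  show eq: "nderiv j (F 0) = F j" for j
    by (induction j) (auto simp: nderiv_Suc vector_derivative_at[OF assms])
  show "F 0 \<in> smooth_functions"
    unfolding smooth_functions_def mem_Collect_eq eq using differentiableI_vector[OF assms] by blast
qed

lemma smooth_has_vector_derivative:
  assumes "f \<in> smooth_functions"
  shows "(nderiv j f has_vector_derivative nderiv (Suc j) f x) (at x within S)"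
proof -
  have "nderiv j f differentiable (at x)" using assms by (simp add: smooth_functions_def)
  then show ?thesis
    unfolding nderiv_Suc using vector_derivative_works has_vector_derivative_at_within by blast
qed

lemma smooth_has_vector_derivative1:
  "f \<in> smooth_functions \<Longrightarrow> (f has_vector_derivative nderiv 1 f x) (at x within S)"
  using smooth_has_vector_derivative[of f 0] by simp

lemma smooth_nderiv: "f \<in> smooth_functions \<Longrightarrow> nderiv i f \<in> smooth_functions"
  by (simp add: smooth_functions_def nderiv_nderiv)

lemma smooth_continuous_on: "f \<in> smooth_functions \<Longrightarrow> continuous_on S (nderiv j f)"
  using has_vector_derivative_continuous[OF smooth_has_vector_derivative]
  by (intro continuous_at_imp_continuous_on) blast

lemma smooth_continuous_on0: "f \<in> smooth_functions \<Longrightarrow> continuous_on S f"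
  using smooth_continuous_on[of f S 0] by simp

lemma nderiv_add:
  assumes "f \<in> smooth_functions" "g \<in> smooth_functions"
  shows "nderiv j (\<lambda>t. f t + g t) = (\<lambda>t. nderiv j f t + nderiv j g t)"
  using nderiv_chain(2)[of "\<lambda>j t. nderiv j f t + nderiv j g t",
      OF has_vector_derivative_add[OF smooth_has_vector_derivative smooth_has_vector_derivative, OF assms]]
  by simp

lemma
  assumes "f \<in> smooth_functions" "bounded_linear L"
  shows smooth_linear: "(\<lambda>t. L (f t)) \<in> smooth_functions"
    and nderiv_linear: "nderiv j (\<lambda>t. L (f t)) = (\<lambda>t. L (nderiv j f t))"
  using nderiv_chain[of "\<lambda>j t. L (nderiv j f t)",
      OF bounded_linear.has_vector_derivative[OF assms(2) smooth_has_vector_derivative[OF assms(1)]]]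
  by simp_all

lemma
  fixes f :: "real \<Rightarrow> complex"
  assumes "f \<in> smooth_functions"
  shows smooth_cmult: "(\<lambda>t. c * f t) \<in> smooth_functions"
    and nderiv_cmult: "nderiv j (\<lambda>t. c * f t) = (\<lambda>t. c * nderiv j f t)"
  using smooth_linear[OF assms bounded_linear_mult_right[of c]]
    nderiv_linear[OF assms bounded_linear_mult_right[of c]] by auto

lemma
  assumes "f \<in> smooth_functions" "g \<in> smooth_functions"
  shows smooth_diff: "(\<lambda>t. f t - g t) \<in> smooth_functions"
    and nderiv_diff: "nderiv j (\<lambda>t. f t - g t) = (\<lambda>t. nderiv j f t - nderiv j g t)"
  using nderiv_chain[of "\<lambda>j t. nderiv j f t - nderiv j g t",
      OF has_vector_derivative_diff[OF smooth_has_vector_derivative smooth_has_vector_derivative, OF assms]]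
  by simp_all

lemma
  assumes "f \<in> smooth_functions"
  shows smooth_affine: "(\<lambda>t. f (a + c * t)) \<in> smooth_functions"
    and nderiv_affine: "nderiv j (\<lambda>t. f (a + c * t)) = (\<lambda>t. c ^ j *\<^sub>R nderiv j f (a + c * t))"
proof -
  let ?F = "\<lambda>j t. c ^ j *\<^sub>R nderiv j f (a + c * t)"
  have "(?F j has_vector_derivative ?F (Suc j) x) (at x)" for j x
  proof -
    have 1: "((\<lambda>t. a + c * t) has_vector_derivative c) (at x)"
      unfolding has_real_derivative_iff_has_vector_derivative[symmetric]
      by (auto intro!: derivative_eq_intros)
    have "((nderiv j f \<circ> (\<lambda>t. a + c * t)) has_vector_derivative c *\<^sub>R nderiv (Suc j) f (a + c * x)) (at x)"
      by (intro vector_diff_chain_at 1 smooth_has_vector_derivative assms)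
    from bounded_linear.has_vector_derivative[OF bounded_linear_scaleR_right this, of "c ^ j"]
    show ?thesis by (simp add: o_def mult.commute)
  qed
  from nderiv_chain[of ?F, OF this] show
    "(\<lambda>t. f (a + c * t)) \<in> smooth_functions" "nderiv j (\<lambda>t. f (a + c * t)) = ?F j" by auto
qed

section \<open>Test functions\<close>

lemma nderiv_eq_0:
  assumes "\<And>x. x \<in> U \<Longrightarrow> f x = 0" "open U" "x \<in> U"
  shows "nderiv j f x = 0"
  using assms(3)
proof (induction j arbitrary: x)
  case (Suc j)
  have "(nderiv j f has_vector_derivative 0) (at x)"
    by (rule has_vector_derivative_transform_within_open[of "\<lambda>_. 0" _ _ U])
      (use assms(2) Suc in \<open>simp_all add: has_vector_derivative_const\<close>)
  then show ?case by (simp add: nderiv_Suc vector_derivative_at)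
qed (simp add: assms(1))

lemma testI:
  assumes "f \<in> smooth_functions" "\<And>x. \<bar>x\<bar> > R \<Longrightarrow> f x = 0"
  shows "f \<in> \<D>"
proof -
  have sub: "{x. f x \<noteq> 0} \<subseteq> {-R..R}"
  proof
    fix x assume "x \<in> {x. f x \<noteq> 0}"
    then have "\<not> \<bar>x\<bar> > R" using assms(2) by blast
    then show "x \<in> {-R..R}" by auto
  qed
  have "compact (closure {x. f x \<noteq> 0})"
    using bounded_subset[OF bounded_closed_interval sub] by (simp add: compact_closure)
  then show ?thesis
    using assms(1) by (simp add: test_functions_def supp_def)
qed

lemma test_smooth: "f \<in> \<D> \<Longrightarrow> f \<in> smooth_functions"
  by (simp add: test_functions_def)

lemma test_support:
  assumes "f \<in> \<D>"
  shows "\<exists>R>0. \<forall>j x. \<bar>x\<bar> \<ge> R \<longrightarrow> nderiv j f x = 0"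
proof -
  have "bounded (supp f)" using assms by (auto simp: test_functions_def compact_imp_bounded)
  then obtain R where R: "\<And>x. x \<in> supp f \<Longrightarrow> \<bar>x\<bar> \<le> R" unfolding bounded_iff by auto
  have f0: "f x = 0" if "x \<in> - supp f" for x
    using that closure_subset[of "{x. f x \<noteq> 0}"] by (auto simp: supp_def)
  have "open (- supp f)" by (simp add: supp_def open_Compl)
  have "nderiv j f x = 0" if "\<bar>x\<bar> \<ge> \<bar>R\<bar> + 1" for x j
    using nderiv_eq_0[OF f0 \<open>open (- supp f)\<close>, where x=x and j=j] R[of x] that by (cases "x \<in> supp f") auto
  then show ?thesis by (intro exI[of _ "\<bar>R\<bar> + 1"]) simp
qed

lemma test0_iff: "f \<in> \<D>\<^sub>0 \<longleftrightarrow> f \<in> \<D> \<and> (\<forall>x<0. f x = 0)"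
proof -
  have "supp f \<subseteq> {0..} \<longleftrightarrow> {x. f x \<noteq> 0} \<subseteq> {0..}"
  proof
    show "supp f \<subseteq> {0..} \<Longrightarrow> {x. f x \<noteq> 0} \<subseteq> {0..}"
      unfolding supp_def by (rule order_trans[OF closure_subset])
    show "{x. f x \<noteq> 0} \<subseteq> {0..} \<Longrightarrow> supp f \<subseteq> {0..}"
      unfolding supp_def by (rule closure_minimal) simp_all
  qed
  also have "\<dots> \<longleftrightarrow> (\<forall>x<0. f x = 0)"
  proof -
    have "f x \<noteq> 0 \<longrightarrow> 0 \<le> x" if "x < 0 \<longrightarrow> f x = 0" for x
      using that by (cases "x < 0") simp_all
    moreover have "x < 0 \<longrightarrow> f x = 0" if "f x \<noteq> 0 \<longrightarrow> 0 \<le> x" for x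
      using that by (cases "f x = 0") simp_all
    ultimately show ?thesis unfolding subset_iff mem_Collect_eq atLeast_iff by metis
  qed
  finally show ?thesis by (simp add: test_functions_0_def)
qed

lemma test0_subset: "\<phi> \<in> \<D>\<^sub>0 \<Longrightarrow> \<phi> \<in> \<D>"
  by (simp add: test0_iff)

lemma test_nderiv: assumes "f \<in> \<D>" shows "nderiv j f \<in> \<D>"
proof -
  obtain R where "R > 0" "\<forall>j x. \<bar>x\<bar> \<ge> R \<longrightarrow> nderiv j f x = 0" using test_support[OF assms] by metis
  with smooth_nderiv[OF test_smooth[OF assms]] show ?thesis by (intro testI[of _ R]) auto
qed

lemma test_affine: assumes "f \<in> \<D>" "c \<noteq> 0" shows "(\<lambda>t. f (a + c * t)) \<in> \<D>"
proof -
  obtain R where R: "R > 0" "\<forall>j x. \<bar>x\<bar> \<ge> R \<longrightarrow> nderiv j f x = 0" using test_support[OF assms(1)] by metis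
  show ?thesis
  proof (rule testI[of _ "(R + \<bar>a\<bar>) / \<bar>c\<bar>"], rule smooth_affine[OF test_smooth[OF assms(1)]])
    fix x assume "(R + \<bar>a\<bar>) / \<bar>c\<bar> < \<bar>x\<bar>"
    then have "R + \<bar>a\<bar> < \<bar>c * x\<bar>" using assms(2) by (simp add: field_simps abs_mult)
    then have "\<bar>a + c * x\<bar> \<ge> R" by linarith
    then have "nderiv 0 f (a + c * x) = 0" using R(2) by blast
    then show "f (a + c * x) = 0" by simp
  qed
qed

lemma test_reflect_shift: "f \<in> \<D> \<Longrightarrow> (\<lambda>t. f (x - t)) \<in> \<D>"
  using test_affine[of f "-1" x] by simp

lemma nderiv_reflect_shift:
  "f \<in> smooth_functions \<Longrightarrow> nderiv j (\<lambda>t. f (x - t)) = (\<lambda>t. (-1) ^ j *\<^sub>R nderiv j f (x - t))"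
  using nderiv_affine[of f j x "-1"] by simp

lemma test_scale: assumes "f \<in> \<D>" shows "(\<lambda>t. c * f t) \<in> \<D>"
proof -
  obtain R where R: "R > 0" "\<forall>j x. \<bar>x\<bar> \<ge> R \<longrightarrow> nderiv j f x = 0" using test_support[OF assms] by metis
  have "f x = 0" if "\<bar>x\<bar> > R" for x
    using R(2)[rule_format, of x 0] that by simp
  with smooth_cmult[OF test_smooth[OF assms]] show ?thesis
    by (intro testI[of _ R]) auto
qed

section \<open>Functions with integrable derivatives\<close>

lemma DL1_smooth: "f \<in> DL1 \<Longrightarrow> f \<in> smooth_functions"
  by (simp add: DL1_def)

lemma DL1_integrable: "f \<in> DL1 \<Longrightarrow> integrable lborel (nderiv j f)"
  by (simp add: DL1_def)

lemma DL1_integrable0: "f \<in> DL1 \<Longrightarrow> integrable lborel f"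
  using DL1_integrable[of f 0] by simp

lemma DL1_nderiv: "f \<in> DL1 \<Longrightarrow> nderiv j f \<in> DL1"
  by (simp add: DL1_def smooth_nderiv nderiv_nderiv)

lemma integrable_compact_support:
  fixes f :: "real \<Rightarrow> complex"
  assumes "continuous_on UNIV f" "\<And>x. \<bar>x\<bar> > R \<Longrightarrow> f x = 0"
  shows "integrable lborel f"
proof -
  have "set_integrable lborel {-R..R} f"
    by (intro borel_integrable_atLeastAtMost' continuous_on_subset[OF assms(1)]) auto
  moreover have "(\<lambda>x. indicat_real {-R..R} x *\<^sub>R f x) = f"
    using assms(2) by (fastforce simp: indicator_def not_le[symmetric])
  ultimately show ?thesis by (simp add: set_integrable_def)
qed

lemma test_DL1: assumes "f \<in> \<D>" shows "f \<in> DL1"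
proof -
  obtain R where R: "R > 0" "\<forall>j x. \<bar>x\<bar> \<ge> R \<longrightarrow> nderiv j f x = 0" using test_support[OF assms] by metis
  have "integrable lborel (nderiv j f)" for j
  proof (rule integrable_compact_support[of _ R])
    show "continuous_on UNIV (nderiv j f)" by (rule smooth_continuous_on[OF test_smooth[OF assms]])
    show "nderiv j f x = 0" if "R < \<bar>x\<bar>" for x using R(2) that by simp
  qed
  then show ?thesis unfolding DL1_def using test_smooth[OF assms] by blast
qed

lemma DL1_diff: "f \<in> DL1 \<Longrightarrow> g \<in> DL1 \<Longrightarrow> (\<lambda>t. f t - g t) \<in> DL1"
  by (auto simp: DL1_def smooth_diff nderiv_diff)

lemma DL1_cmult: "f \<in> DL1 \<Longrightarrow> (\<lambda>t. c * f t) \<in> DL1"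
  by (auto simp: DL1_def smooth_cmult nderiv_cmult)

lemma integrable_affine:
  "integrable lborel f \<Longrightarrow> c \<noteq> 0 \<Longrightarrow> integrable lborel (\<lambda>t. (f::real\<Rightarrow>complex) (a + c * t))"
  using lborel_integrable_real_affine by blast

lemma DL1_affine: "f \<in> DL1 \<Longrightarrow> c \<noteq> 0 \<Longrightarrow> (\<lambda>t. f (a + c * t)) \<in> DL1"
  by (auto simp: DL1_def smooth_affine nderiv_affine intro!: integrable_affine)

lemma DL1_shift: "f \<in> DL1 \<Longrightarrow> (\<lambda>t. f (t + a)) \<in> DL1"
  using DL1_affine[of f 1 a] by (simp add: add.commute)

lemma DL1_norm_nonneg: "DL1_norm k f \<ge> 0"
  by (auto simp: DL1_norm_def intro: sum_nonneg)

lemma DL1_norm_mono: "k \<le> l \<Longrightarrow> DL1_norm k f \<le> DL1_norm l f"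
  unfolding DL1_norm_def by (rule sum_mono2) auto

lemma DL1_norm_0: "DL1_norm 0 f = (LINT x|lborel. norm (f x))"
  by (simp add: DL1_norm_def)

lemma DL1_norm_Suc: "DL1_norm (Suc k) f = DL1_norm 0 f + DL1_norm k (nderiv 1 f)"
  unfolding DL1_norm_def by (subst sum.atMost_Suc_shift) (simp add: nderiv_nderiv)

lemma DL1_norm_nderiv_le: "DL1_norm k (nderiv 1 f) \<le> DL1_norm (Suc k) f"
  unfolding DL1_norm_Suc using DL1_norm_nonneg[of 0 f] by simp

lemma DL1_norm_mono_integral:
  assumes "\<And>j. j \<le> k \<Longrightarrow> (LINT x|lborel. norm (nderiv j f x)) \<le> C * (LINT x|lborel. norm (nderiv j g x))"
  shows "DL1_norm k f \<le> C * DL1_norm k g"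
  unfolding DL1_norm_def sum_distrib_left using assms by (intro sum_mono) auto

lemma DL1_norm_triangle:
  assumes "f \<in> DL1" "g \<in> DL1"
  shows "DL1_norm k (\<lambda>t. f t + g t) \<le> DL1_norm k f + DL1_norm k g"
proof -
  have "(LINT x|lborel. norm (nderiv j f x + nderiv j g x))
     \<le> (LINT x|lborel. norm (nderiv j f x) + norm (nderiv j g x))" for j
    using assms by (intro integral_mono) (auto simp: DL1_def intro: norm_triangle_ineq)
  then have "(LINT x|lborel. norm (nderiv j f x + nderiv j g x))
     \<le> (LINT x|lborel. norm (nderiv j f x)) + (LINT x|lborel. norm (nderiv j g x))" for j
    using assms by (simp add: DL1_def)
  then show ?thesis
    using assms by (simp add: DL1_norm_def nderiv_add DL1_smooth sum.distrib[symmetric] sum_mono)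
qed

lemma DL1_norm_cmult: "f \<in> DL1 \<Longrightarrow> DL1_norm k (\<lambda>t. c * f t) = norm c * DL1_norm k f"
  by (simp add: DL1_norm_def nderiv_cmult DL1_smooth norm_mult sum_distrib_left)

lemma DL1_norm_diff_triangle:
  assumes "f \<in> DL1" "g \<in> DL1"
  shows "DL1_norm k (\<lambda>t. f t - g t) \<le> DL1_norm k f + DL1_norm k g"
  using DL1_norm_triangle[OF assms(1) DL1_cmult[OF assms(2), of "-1"], of k]
    DL1_norm_cmult[OF assms(2), of k "-1"] by simp

lemma DL1_norm_affine:
  assumes "f \<in> DL1" "\<bar>c\<bar> = 1"
  shows "DL1_norm k (\<lambda>t. f (a + c * t)) = DL1_norm k f"
proof -
  have "(LINT t|lborel. norm (nderiv j f (a + c * t))) = (LINT t|lborel. norm (nderiv j f t))" for j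
    using lborel_integral_real_affine[of c "\<lambda>t. norm (nderiv j f t)" a] assms(2) by auto
  then show ?thesis
    using assms by (simp add: DL1_norm_def nderiv_affine DL1_smooth power_abs)
qed

section \<open>Averages of translates\<close>

text \<open>
  With \<open>c = 1\<close> this is convolution with a reflected kernel, with small \<open>c\<close> it is mollification at scale
  \<open>c\<close>, and with \<open>c = -1\<close> and \<open>w\<close> a test function it is the convolution \<open>w * f\<close>. The interval is explicit
  because \<open>w\<close> may have jumps at its ends.
\<close>

definition smear :: "real \<Rightarrow> real \<Rightarrow> (real \<Rightarrow> complex) \<Rightarrow> real \<Rightarrow> (real \<Rightarrow> complex) \<Rightarrow> real \<Rightarrow> complex"
  where "smear a b w c f t = integral {a..b} (\<lambda>s. w s * f (t + c * s))"

lemma smear_integrable: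
  fixes f w :: "real \<Rightarrow> complex"
  assumes "continuous_on {a..b} w" "f \<in> smooth_functions"
  shows "(\<lambda>s. w s * f (t + c * s)) integrable_on {a..b}"
  by (intro integrable_continuous_interval continuous_on_mult assms
      continuous_on_compose2[OF smooth_continuous_on0[OF assms(2)]] continuous_intros) auto

lemma
  assumes w: "continuous_on {a..b} w" and f: "f \<in> smooth_functions"
  shows smear_smooth: "smear a b w c f \<in> smooth_functions"
    and nderiv_smear: "nderiv j (smear a b w c f) = smear a b w c (nderiv j f)"
proof -
  have "(smear a b w c (nderiv j f) has_vector_derivative smear a b w c (nderiv (Suc j) f) x) (at x)" for j x
  proof -
    have "((\<lambda>t. w s * nderiv j f (t + c * s)) has_vector_derivative w s * nderiv (Suc j) f (t + c * s)) (at t)" for t s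
    proof -
      have g: "nderiv j (\<lambda>t. f (c * s + 1 * t)) = (\<lambda>t. nderiv j f (t + c * s))" for j
        using nderiv_affine[OF f, of j "c * s" 1] by (simp add: add.commute)
      have "(nderiv j (\<lambda>t. f (c * s + 1 * t)) has_vector_derivative nderiv (Suc j) (\<lambda>t. f (c * s + 1 * t)) t) (at t)"
        by (intro smooth_has_vector_derivative smooth_affine f)
      then have "((\<lambda>t. nderiv j f (t + c * s)) has_vector_derivative nderiv (Suc j) f (t + c * s)) (at t)"
        unfolding g .
      from has_vector_derivative_mult_right[OF this, of "w s"] show ?thesis by simp
    qed
    moreover have "continuous_on (UNIV \<times> {a..b}) (\<lambda>(x, s). w s * nderiv (Suc j) f (x + c * s))"
      unfolding case_prod_beta
      by (intro continuous_on_mult continuous_on_compose2[OF w] continuous_on_compose2[OF smooth_continuous_on[OF f]]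
          continuous_intros) auto
    ultimately have "((\<lambda>x. integral (cbox a b) (\<lambda>s. w s * nderiv j f (x + c * s))) has_vector_derivative
        integral (cbox a b) (\<lambda>s. w s * nderiv (Suc j) f (x + c * s))) (at x within UNIV)"
      by (intro leibniz_rule_vector_derivative)
        (auto intro: smear_integrable[OF w smooth_nderiv[OF f]])
    then show ?thesis by (simp add: smear_def[abs_def])
  qed
  from nderiv_chain[of "\<lambda>j. smear a b w c (nderiv j f)", OF this]
  show "smear a b w c f \<in> smooth_functions" "nderiv j (smear a b w c f) = smear a b w c (nderiv j f)"
    by auto
qed

text \<open>
  Minkowski's integral inequality: Tonelli's theorem reduces it to the translation invariance of the
  \<open>L\<^sup>1\<close> norm. Estimating the weight by its supremum is enough below, as short intervals will make up
  for it.
\<close>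

lemma
  assumes f: "f \<in> smooth_functions" "integrable lborel f"
    and w: "continuous_on {a..b} w" "\<And>s. s \<in> {a..b} \<Longrightarrow> norm (w s) \<le> W" and ab: "a \<le> b"
  shows smear_integrable_lborel: "integrable lborel (smear a b w c f)"
    and smear_L1_bound: "(LINT t|lborel. norm (smear a b w c f t)) \<le> W * (b - a) * (LINT t|lborel. norm (f t))"
proof -
  have W: "W \<ge> 0" using order_trans[OF norm_ge_zero w(2)[of a]] ab by simp
  have fm [measurable]: "f \<in> borel_measurable borel"
    using smooth_continuous_on0[OF f(1)] by (rule borel_measurable_continuous_onI)
  have sm [measurable]: "smear a b w c f \<in> borel_measurable borel"
    using smooth_continuous_on0[OF smear_smooth[OF w(1) f(1)]] by (rule borel_measurable_continuous_onI)
  have pt: "ennreal (norm (smear a b w c f t)) \<le> (\<integral>\<^sup>+ s. indicator {a..b} s * ennreal (W * norm (f (t + c * s))) \<partial>lborel)" for t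
  proof -
    have si: "set_integrable lborel {a..b} (\<lambda>s. w s * f (t + c * s))"
      by (intro borel_integrable_atLeastAtMost' continuous_on_mult w(1)
          continuous_on_compose2[OF smooth_continuous_on0[OF f(1)]] continuous_intros) auto
    have "smear a b w c f t = (LINT s|lborel. indicat_real {a..b} s *\<^sub>R (w s * f (t + c * s)))"
      unfolding smear_def set_borel_integral_eq_integral(2)[OF si, symmetric] set_lebesgue_integral_def ..
    also have "ennreal (norm \<dots>) \<le> (\<integral>\<^sup>+ s. ennreal (norm (indicat_real {a..b} s *\<^sub>R (w s * f (t + c * s)))) \<partial>lborel)"
      using si unfolding set_integrable_def by (rule integral_norm_bound_ennreal)
    also have "\<dots> \<le> (\<integral>\<^sup>+ s. indicator {a..b} s * ennreal (W * norm (f (t + c * s))) \<partial>lborel)"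
      using w(2) by (intro nn_integral_mono)
        (auto simp: indicator_def norm_mult intro!: ennreal_leI mult_right_mono)
    finally show ?thesis .
  qed
  have "(\<integral>\<^sup>+ t. ennreal (norm (smear a b w c f t)) \<partial>lborel)
      \<le> (\<integral>\<^sup>+ t. (\<integral>\<^sup>+ s. indicator {a..b} s * ennreal (W * norm (f (t + c * s))) \<partial>lborel) \<partial>lborel)"
    by (intro nn_integral_mono pt)
  also have "\<dots> = (\<integral>\<^sup>+ s. (\<integral>\<^sup>+ t. indicator {a..b} s * ennreal (W * norm (f (t + c * s))) \<partial>lborel) \<partial>lborel)"
    by (intro lborel_pair.Fubini') simp
  also have "\<dots> = (\<integral>\<^sup>+ s. indicator {a..b} s * ennreal (W * (LINT t|lborel. norm (f t))) \<partial>lborel)"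
  proof (intro nn_integral_cong)
    fix s
    have "(\<integral>\<^sup>+ t. ennreal (norm (f (t + c * s))) \<partial>lborel) = (\<integral>\<^sup>+ t. ennreal (norm (f t)) \<partial>lborel)"
      using nn_integral_real_affine[of "\<lambda>t. ennreal (norm (f t))" 1 "c * s"] by (simp add: add.commute)
    also have "\<dots> = ennreal (LINT t|lborel. norm (f t))"
      using f(2) by (intro nn_integral_eq_integral) auto
    finally have "(\<integral>\<^sup>+ t. ennreal W * ennreal (norm (f (t + c * s))) \<partial>lborel) = ennreal W * ennreal (LINT t|lborel. norm (f t))"
      by (subst nn_integral_cmult) auto
    then show "(\<integral>\<^sup>+ t. indicator {a..b} s * ennreal (W * norm (f (t + c * s))) \<partial>lborel)
        = indicator {a..b} s * ennreal (W * (LINT t|lborel. norm (f t)))"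
      using W by (subst nn_integral_cmult) (auto simp: ennreal_mult)
  qed
  also have "\<dots> = ennreal (W * (b - a) * (LINT t|lborel. norm (f t)))"
    using ab W by (subst nn_integral_multc) (auto simp: ennreal_mult[symmetric] mult_ac)
  finally have le: "(\<integral>\<^sup>+ t. ennreal (norm (smear a b w c f t)) \<partial>lborel) \<le> ennreal (W * (b - a) * (LINT t|lborel. norm (f t)))" .
  then show i: "integrable lborel (smear a b w c f)"
    by (intro integrableI_bounded) (auto intro: le_less_trans)
  have "0 \<le> W * (b - a) * (LINT t|lborel. norm (f t))" using W ab by simp
  then show "(LINT t|lborel. norm (smear a b w c f t)) \<le> W * (b - a) * (LINT t|lborel. norm (f t))"
    using le by (subst (asm) nn_integral_eq_integral) (use i in auto)
qed

lemma smear_DL1_bound: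
  assumes "f \<in> DL1" "continuous_on {a..b} w" "\<And>s. s \<in> {a..b} \<Longrightarrow> norm (w s) \<le> W" "a \<le> b"
  shows "DL1_norm k (smear a b w c f) \<le> W * (b - a) * DL1_norm k f"
proof (rule DL1_norm_mono_integral)
  fix j
  show "(LINT t|lborel. norm (nderiv j (smear a b w c f) t)) \<le> W * (b - a) * (LINT t|lborel. norm (nderiv j f t))"
    unfolding nderiv_smear[OF assms(2) DL1_smooth[OF assms(1)]]
    by (rule smear_L1_bound[OF smooth_nderiv[OF DL1_smooth[OF assms(1)]] DL1_integrable[OF assms(1)] assms(2-4)])
qed

lemma continuous_bound:
  fixes w :: "real \<Rightarrow> 'a::real_normed_vector"
  assumes "continuous_on {a..b} w" shows "\<exists>W\<ge>0. \<forall>s\<in>{a..b}. norm (w s) \<le> W"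
  using compact_imp_bounded[OF compact_continuous_image[OF assms compact_Icc]]
  unfolding bounded_pos by (auto intro: less_imp_le)

lemma smear_DL1:
  assumes "f \<in> DL1" "continuous_on {a..b} w" "a \<le> b"
  shows "smear a b w c f \<in> DL1"
proof -
  obtain W where W: "\<And>s. s \<in> {a..b} \<Longrightarrow> norm (w s) \<le> W" using continuous_bound[OF assms(2)] by blast
  note sf = DL1_smooth[OF assms(1)]
  have "integrable lborel (smear a b w c (nderiv j f))" for j
    by (rule smear_integrable_lborel[OF smooth_nderiv[OF sf] DL1_integrable[OF assms(1)] assms(2) _ assms(3)])
      (fact W)
  then show ?thesis
    unfolding DL1_def mem_Collect_eq nderiv_smear[OF assms(2) sf] using smear_smooth[OF assms(2) sf] by blast
qed

lemma smear_test:
  assumes f: "f \<in> \<D>" and w: "continuous_on {a..b} w"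
  shows "smear a b w c f \<in> \<D>"
proof -
  obtain R where R: "R > 0" "\<forall>j x. \<bar>x\<bar> \<ge> R \<longrightarrow> nderiv j f x = 0" using test_support[OF f] by blast
  show ?thesis
  proof (rule testI[of _ "R + \<bar>c\<bar> * (\<bar>a\<bar> + \<bar>b\<bar>)"], rule smear_smooth[OF w test_smooth[OF f]])
    fix x assume x: "R + \<bar>c\<bar> * (\<bar>a\<bar> + \<bar>b\<bar>) < \<bar>x\<bar>"
    have "w s * f (x + c * s) = 0" if "s \<in> {a..b}" for s
    proof -
      have "\<bar>c * s\<bar> \<le> \<bar>c\<bar> * (\<bar>a\<bar> + \<bar>b\<bar>)" unfolding abs_mult using that by (intro mult_left_mono) auto
      then have "\<bar>x + c * s\<bar> \<ge> R" using x by linarith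
      then have "nderiv 0 f (x + c * s) = 0" using R(2) by blast
      then show ?thesis by simp
    qed
    then show "smear a b w c f x = 0" unfolding smear_def by (intro integral_unique has_integral_is_0)
  qed
qed

lemma smear_split:
  assumes "a \<le> u" "u \<le> v" "continuous_on {a..v} w" "f \<in> smooth_functions"
  shows "smear a v w c f t = smear a u w c f t + smear u v w c f t"
  unfolding smear_def using Henstock_Kurzweil_Integration.integral_combine[OF assms(1,2) smear_integrable[OF assms(3,4)], of t c]
  by simp

lemma smear_diff_weight:
  assumes "continuous_on {a..b} v" "continuous_on {a..b} w" "f \<in> smooth_functions"
  shows "smear a b (\<lambda>s. v s - w s) c f t = smear a b v c f t - smear a b w c f t"
  unfolding smear_def
  by (simp add: left_diff_distrib integral_diff[OF smear_integrable[OF assms(1,3)] smear_integrable[OF assms(2,3)]])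

lemma smear_add:
  assumes "continuous_on {a..b} w" "f \<in> smooth_functions" "g \<in> smooth_functions"
  shows "smear a b w c (\<lambda>t. f t + g t) = (\<lambda>t. smear a b w c f t + smear a b w c g t)"
  unfolding smear_def
  by (simp add: distrib_left integral_add[OF smear_integrable[OF assms(1,2)] smear_integrable[OF assms(1,3)]])

lemma smear_cmult: "smear a b w c (\<lambda>t. k * f t) = (\<lambda>t. k * smear a b w c f t)"
  unfolding smear_def by (simp add: mult.left_commute[of _ k])

lemma has_vector_derivative_compose_affine:
  assumes "f \<in> smooth_functions"
  shows "((\<lambda>s. f (t + c * s)) has_vector_derivative c *\<^sub>R nderiv 1 f (t + c * s)) (at s within S)"
  using smooth_has_vector_derivative1[OF smooth_affine[OF assms, of t c], of s S]
    nderiv_affine[OF assms, of 1 t c] by simp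

text \<open>
  Integration by parts in \<open>s\<close>. The primitive of the constant weight 1 is normalised to vanish at the
  endpoint other than \<open>y\<close>, so that only the boundary term at \<open>y\<close> survives. Both choices of \<open>y\<close> are
  needed for two-sided derivatives.
\<close>

lemma smear_by_parts:
  assumes f: "f \<in> smooth_functions" and uv: "u \<le> v" and y: "y = u \<or> y = v"
  shows "smear u v (\<lambda>_. 1) c f t - of_real (v - u) * f (t + c * y)
       = smear u v (\<lambda>s. of_real (c * (u + v - y - s))) c (nderiv 1 f) t"
proof -
  let ?h = "\<lambda>s. (s - (u + v - y)) *\<^sub>R f (t + c * s)"
  have "((\<lambda>s. (1::complex) * f (t + c * s) - of_real (c * (u + v - y - s)) * nderiv 1 f (t + c * s))
      has_integral (?h v - ?h u)) {u..v}"
  proof (rule fundamental_theorem_of_calculus[OF uv])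
    fix s
    have "((\<lambda>s. s - (u + v - y)) has_vector_derivative 1) (at s within {u..v})"
      by (auto intro!: derivative_eq_intros)
    from has_vector_derivative_scaleR[OF this[unfolded has_real_derivative_iff_has_vector_derivative[symmetric]]
        has_vector_derivative_compose_affine[OF f, of t c]]
    show "(?h has_vector_derivative 1 * f (t + c * s) - of_real (c * (u + v - y - s)) * nderiv 1 f (t + c * s))
        (at s within {u..v})"
      by (simp add: algebra_simps scaleR_conv_of_real)
  qed
  moreover have "((\<lambda>s. (1::complex) * f (t + c * s) - of_real (c * (u + v - y - s)) * nderiv 1 f (t + c * s))
      has_integral (smear u v (\<lambda>_. 1) c f t - smear u v (\<lambda>s. of_real (c * (u + v - y - s))) c (nderiv 1 f) t)) {u..v}"
    unfolding smear_def
    by (intro has_integral_diff integrable_integral smear_integrable smooth_nderiv f continuous_intros)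
  ultimately have eq: "?h v - ?h u
      = smear u v (\<lambda>_. 1) c f t - smear u v (\<lambda>s. of_real (c * (u + v - y - s))) c (nderiv 1 f) t"
    by (rule has_integral_unique)
  have "?h v - ?h u = of_real (v - u) * f (t + c * y)"
    using y by (elim disjE) (simp_all add: scaleR_conv_of_real algebra_simps)
  then show ?thesis unfolding eq by (metis diff_eq_eq add.commute add_diff_cancel_left')
qed

lemma smear_increment:
  assumes f: "f \<in> smooth_functions" and uv: "u \<le> v"
  shows "smear u v (\<lambda>_. of_real c) c (nderiv 1 f) t = f (t + c * v) - f (t + c * u)"
proof -
  have "((\<lambda>s. of_real c * nderiv 1 f (t + c * s)) has_integral f (t + c * v) - f (t + c * u)) {u..v}"
    by (rule fundamental_theorem_of_calculus[OF uv])
      (use has_vector_derivative_compose_affine[OF f, of t c] in \<open>simp add: scaleR_conv_of_real\<close>)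
  then show ?thesis unfolding smear_def by (rule integral_unique)
qed

text \<open>
  The one-point quadrature rule on a short interval has an error of smaller order than the length of
  the interval. One part comes from the oscillation of the weight, the other from moving \<open>f\<close>, which
  costs one more derivative in the norm. This estimate is what makes \<open>v \<mapsto> smear a v w c f\<close> differentiable in the test space.
\<close>

lemma smear_local_bound:
  assumes f: "f \<in> DL1" and uv: "u \<le> v" and y: "y = u \<or> y = v"
    and w: "continuous_on {u..v} w" "\<And>s. s \<in> {u..v} \<Longrightarrow> norm (w s - w y) \<le> e"
  shows "DL1_norm k (\<lambda>t. smear u v w c f t - of_real (v - u) * w y * f (t + c * y))
     \<le> (v - u) * (e * DL1_norm k f + norm (w y) * (\<bar>c\<bar> * (v - u) * DL1_norm (Suc k) f))"
proof -
  let ?r = "\<lambda>s. of_real (c * (u + v - y - s)) :: complex"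
  note sf = DL1_smooth[OF f]
  have c1: "continuous_on {u..v} (\<lambda>s. w s - w y)" by (intro continuous_intros w)
  have c2: "continuous_on {u..v} ?r" by (intro continuous_intros)
  have eq: "(\<lambda>t. smear u v w c f t - of_real (v - u) * w y * f (t + c * y))
     = (\<lambda>t. smear u v (\<lambda>s. w s - w y) c f t + w y * smear u v ?r c (nderiv 1 f) t)"
  proof
    fix t
    have "smear u v (\<lambda>_. w y) c f t = w y * smear u v (\<lambda>_. 1) c f t"
      unfolding smear_def by simp
    then show "smear u v w c f t - of_real (v - u) * w y * f (t + c * y)
     = smear u v (\<lambda>s. w s - w y) c f t + w y * smear u v ?r c (nderiv 1 f) t"
      unfolding smear_diff_weight[OF w(1) continuous_on_const sf] smear_by_parts[OF sf uv y, symmetric]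
      by (simp add: algebra_simps)
  qed
  have "DL1_norm k (\<lambda>t. smear u v (\<lambda>s. w s - w y) c f t + w y * smear u v ?r c (nderiv 1 f) t)
    \<le> DL1_norm k (smear u v (\<lambda>s. w s - w y) c f) + norm (w y) * DL1_norm k (smear u v ?r c (nderiv 1 f))"
    unfolding DL1_norm_cmult[OF smear_DL1[OF DL1_nderiv[OF f] c2 uv], symmetric]
    by (rule DL1_norm_triangle[OF smear_DL1[OF f c1 uv] DL1_cmult[OF smear_DL1[OF DL1_nderiv[OF f] c2 uv]]])
  also have "\<dots> \<le> e * (v - u) * DL1_norm k f + norm (w y) * (\<bar>c\<bar> * (v - u) * (v - u) * DL1_norm (Suc k) f)"
  proof (intro add_mono mult_left_mono)
    show "DL1_norm k (smear u v (\<lambda>s. w s - w y) c f) \<le> e * (v - u) * DL1_norm k f"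
      by (intro smear_DL1_bound f c1 uv w(2))
    have "norm (?r s) \<le> \<bar>c\<bar> * (v - u)" if "s \<in> {u..v}" for s
      unfolding norm_of_real abs_mult using that y by (intro mult_left_mono) auto
    then have "DL1_norm k (smear u v ?r c (nderiv 1 f)) \<le> \<bar>c\<bar> * (v - u) * (v - u) * DL1_norm k (nderiv 1 f)"
      by (intro smear_DL1_bound DL1_nderiv f c2 uv)
    also have "\<dots> \<le> \<bar>c\<bar> * (v - u) * (v - u) * DL1_norm (Suc k) f"
      using uv by (intro mult_left_mono DL1_norm_nderiv_le) auto
    finally show "DL1_norm k (smear u v ?r c (nderiv 1 f)) \<le> \<bar>c\<bar> * (v - u) * (v - u) * DL1_norm (Suc k) f" .
  qed simp
  also have "\<dots> = (v - u) * (e * DL1_norm k f + norm (w y) * (\<bar>c\<bar> * (v - u) * DL1_norm (Suc k) f))"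
    by (simp add: algebra_simps)
  finally show ?thesis unfolding eq .
qed

lemma DL1_norm_translate_diff:
  assumes f: "f \<in> DL1" and uv: "u \<le> v"
  shows "DL1_norm k (\<lambda>t. f (t + v) - f (t + u)) \<le> (v - u) * DL1_norm (Suc k) f"
proof -
  have eq: "(\<lambda>t. f (t + v) - f (t + u)) = smear u v (\<lambda>_. 1) 1 (nderiv 1 f)"
    using smear_increment[OF DL1_smooth[OF f] uv, of 1] by (auto simp: fun_eq_iff)
  have "DL1_norm k (smear u v (\<lambda>_. 1) 1 (nderiv 1 f)) \<le> 1 * (v - u) * DL1_norm k (nderiv 1 f)"
    by (intro smear_DL1_bound DL1_nderiv f uv) auto
  also have "\<dots> \<le> (v - u) * DL1_norm (Suc k) f"
    using mult_left_mono[OF DL1_norm_nderiv_le, of "v - u"] uv by simp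
  finally show ?thesis unfolding eq .
qed

section \<open>Bounded distributions\<close>

lemma topspace_DL1: "topspace DL1_topology = DL1"
proof -
  let ?S = "{{g \<in> DL1. DL1_norm k (\<lambda>x. g x - f x) < e} | f k e. f \<in> DL1 \<and> e > 0}"
  have "f \<in> \<Union> ?S" if "f \<in> DL1" for f
  proof (rule UnionI)
    show "f \<in> {g \<in> DL1. DL1_norm 0 (\<lambda>x. g x - f x) < 1}" using that by (simp add: DL1_norm_0)
    show "{g \<in> DL1. DL1_norm 0 (\<lambda>x. g x - f x) < 1} \<in> ?S"
      using that by (intro CollectI exI[of _ f] exI[of _ "0::nat"] exI[of _ "1::real"]) simp
  qed
  moreover have "\<Union> ?S \<subseteq> DL1" by blast
  ultimately show ?thesis
    unfolding DL1_topology_def topology_generated_by_topspace by blast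
qed

lemma DL1_norm_ball_subset:
  assumes "f \<in> DL1" "g \<in> DL1" "h \<in> DL1"
  shows "DL1_norm k (\<lambda>x. h x - f x) \<le> DL1_norm k (\<lambda>x. h x - g x) + DL1_norm k (\<lambda>x. g x - f x)"
  using DL1_norm_triangle[OF DL1_diff[OF assms(3,2)] DL1_diff[OF assms(2,1)], of k] by simp

text \<open>
  The norms increase with their index, so finite intersections of balls contain a ball for a single
  norm.
\<close>

lemma openin_DL1_ball:
  assumes "openin DL1_topology U" "f \<in> U"
  shows "\<exists>k. \<exists>e>0. \<forall>g\<in>DL1. DL1_norm k (\<lambda>x. g x - f x) < e \<longrightarrow> g \<in> U"
proof -
  have "generate_topology_on {{g \<in> DL1. DL1_norm k (\<lambda>x. g x - f x) < e} | f k e. f \<in> DL1 \<and> e > 0} U"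
    using assms(1) by (simp add: DL1_topology_def openin_topology_generated_by_iff)
  then show ?thesis using assms(2)
  proof (induction arbitrary: f)
    case (Int A B)
    have f: "f \<in> A" "f \<in> B" using Int.prems by auto
    obtain k d where 1: "d > 0" "\<forall>g\<in>DL1. DL1_norm k (\<lambda>x. g x - f x) < d \<longrightarrow> g \<in> A"
      using Int.IH(1)[OF f(1)] by blast
    obtain l e where 2: "e > 0" "\<forall>g\<in>DL1. DL1_norm l (\<lambda>x. g x - f x) < e \<longrightarrow> g \<in> B"
      using Int.IH(2)[OF f(2)] by blast
    have "g \<in> A \<inter> B" if g: "g \<in> DL1" "DL1_norm (max k l) (\<lambda>x. g x - f x) < min d e" for g
    proof -
      have "DL1_norm k (\<lambda>x. g x - f x) < d" "DL1_norm l (\<lambda>x. g x - f x) < e"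
        using g(2) DL1_norm_mono[of k "max k l" "\<lambda>x. g x - f x"] DL1_norm_mono[of l "max k l" "\<lambda>x. g x - f x"]
        by linarith+
      then show ?thesis using 1(2) 2(2) g(1) by blast
    qed
    then show ?case using 1(1) 2(1) by (intro exI[of _ "max k l"] exI[of _ "min d e"]) simp
  next
    case (UN K)
    then obtain V where V: "V \<in> K" "f \<in> V" by blast
    then show ?case using UN.IH[OF V] by blast
  next
    case (Basis s)
    then obtain f0 k e where s: "s = {g \<in> DL1. DL1_norm k (\<lambda>x. g x - f0 x) < e}" "f0 \<in> DL1" "e > 0" by blast
    have f: "f \<in> DL1" "DL1_norm k (\<lambda>x. f x - f0 x) < e" using Basis(2) s(1) by auto
    have "g \<in> s" if "g \<in> DL1" "DL1_norm k (\<lambda>x. g x - f x) < e - DL1_norm k (\<lambda>x. f x - f0 x)" for g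
      using that DL1_norm_ball_subset[OF s(2) f(1) that(1), of k] by (simp add: s(1))
    then show ?case using f(2) by (intro exI[of _ k] exI[of _ "e - DL1_norm k (\<lambda>x. f x - f0 x)"]) simp
  qed simp
qed

lemma scaleC_minus1: "(- 1) *\<^sub>C (x::'x::complex_banach) = - x"
  using scaleC_of_real[of "-1" x] by simp

lemma scaleC_one: "1 *\<^sub>C (x::'x::complex_banach) = x"
  using scaleC_of_real[of 1 x] by simp

lemma bd_add: "T \<in> bounded_dists \<Longrightarrow> f \<in> DL1 \<Longrightarrow> g \<in> DL1 \<Longrightarrow> T (\<lambda>x. f x + g x) = T f + T g"
  by (simp add: bounded_dists_def)

lemma bd_cmult: "T \<in> bounded_dists \<Longrightarrow> f \<in> DL1 \<Longrightarrow> T (\<lambda>x. c * f x) = c *\<^sub>C T f"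
  by (simp add: bounded_dists_def)

lemma bd_diff:
  assumes "T \<in> bounded_dists" "f \<in> DL1" "g \<in> DL1" shows "T (\<lambda>x. f x - g x) = T f - T g"
  using bd_add[OF assms(1,2) DL1_cmult[OF assms(3), of "-1"]] bd_cmult[OF assms(1,3), of "-1"]
  by (simp add: scaleC_minus1)

lemma smooth_zero: "(\<lambda>_. 0) \<in> smooth_functions"
  and nderiv_zero: "nderiv j (\<lambda>_. 0) = (\<lambda>_. 0)"
  using nderiv_chain[of "\<lambda>_ _. 0", OF has_vector_derivative_const] by simp_all

lemma test_zero: "(\<lambda>_. 0) \<in> \<D>"
  by (rule testI[OF smooth_zero]) simp

lemma DL1_norm_zero: "DL1_norm k (\<lambda>_. 0) = 0"
  by (simp add: DL1_norm_def nderiv_zero)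

lemma bd_zero: "T \<in> bounded_dists \<Longrightarrow> T (\<lambda>_. 0) = 0"
  using bd_diff[OF _ test_DL1[OF test_zero] test_DL1[OF test_zero], of T] by simp

text \<open>
  Scaling: a ball on which \<open>T\<close> is bounded by 1 gives a global estimate. The positive number \<open>d\<close> in the
  proof avoids dividing by a norm that might vanish.
\<close>

lemma bd_bound:
  fixes T :: "'x::complex_banach dist"
  assumes T: "T \<in> bounded_dists"
  shows "\<exists>k C. C \<ge> 0 \<and> (\<forall>f\<in>DL1. norm (T f) \<le> C * DL1_norm k f)"
proof -
  have z: "(\<lambda>_. 0) \<in> DL1" by (rule test_DL1[OF test_zero])
  have "openin DL1_topology {f \<in> topspace DL1_topology. T f \<in> ball 0 1}"
    using T by (intro openin_continuous_map_preimage[of _ euclidean]) (auto simp: bounded_dists_def)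
  moreover have "(\<lambda>_. 0) \<in> {f \<in> topspace DL1_topology. T f \<in> ball 0 1}"
    using z bd_zero[OF T] by (simp add: topspace_DL1)
  ultimately obtain k e where e: "e > 0" "\<forall>g\<in>DL1. DL1_norm k (\<lambda>x. g x - 0) < e \<longrightarrow> g \<in> {f \<in> topspace DL1_topology. T f \<in> ball 0 1}"
    using openin_DL1_ball by meson
  have "norm (T f) \<le> 2 / e * DL1_norm k f" if f: "f \<in> DL1" for f
  proof (rule field_le_epsilon)
    fix d :: real assume d: "d > 0"
    \<comment> \<open>The summand is chosen so that \<open>2 / e * N\<close> exceeds the bound by exactly \<open>d\<close>.\<close>
    define N where "N = DL1_norm k f + d * e / 2"
    have N: "N > 0" using d e(1) DL1_norm_nonneg[of k f] by (simp add: N_def add_nonneg_pos)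
    define r where "r = e / (2 * N)"
    have r: "r > 0" "r * N < e" using N e(1) by (simp_all add: r_def)
    have "DL1_norm k (\<lambda>x. of_real r * f x) = r * DL1_norm k f"
      unfolding DL1_norm_cmult[OF f] norm_of_real using r by simp
    also have "\<dots> \<le> r * N" using r(1) e(1) d by (intro mult_left_mono) (auto simp: N_def)
    finally have "DL1_norm k (\<lambda>x. of_real r * f x) < e" using r(2) by simp
    then have "norm (T (\<lambda>x. of_real r * f x)) < 1"
      using bspec[OF e(2) DL1_cmult[OF f, of "of_real r"]] by simp
    then have "r * norm (T f) < 1"
      unfolding bd_cmult[OF T f] norm_scaleC norm_of_real using r by simp
    then have "norm (T f) < 2 / e * N" using N e(1) by (simp add: r_def field_simps)
    also have "\<dots> = 2 / e * DL1_norm k f + d" using e(1) by (simp add: N_def field_simps)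
    finally show "norm (T f) \<le> 2 / e * DL1_norm k f + d" by simp
  qed
  then show ?thesis using e(1) by (intro exI[of _ k] exI[of _ "2 / e"]) simp
qed

lemma bdI:
  fixes T :: "'x::complex_banach dist"
  assumes add: "\<And>f g. f \<in> DL1 \<Longrightarrow> g \<in> DL1 \<Longrightarrow> T (\<lambda>x. f x + g x) = T f + T g"
    and cmult: "\<And>c f. f \<in> DL1 \<Longrightarrow> T (\<lambda>x. c * f x) = c *\<^sub>C T f"
    and bound: "\<And>f. f \<in> DL1 \<Longrightarrow> norm (T f) \<le> C * DL1_norm k f"
  shows "T \<in> bounded_dists"
proof -
  have diff: "T (\<lambda>x. f x - g x) = T f - T g" if "f \<in> DL1" "g \<in> DL1" for f g
    using add[OF that(1) DL1_cmult[OF that(2), of "-1"]] cmult[OF that(2), of "-1"] by (simp add: scaleC_minus1)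
  have "continuous_map DL1_topology euclidean T"
    unfolding continuous_map_def topspace_DL1
  proof (intro conjI allI impI)
    fix V :: "'x set" assume "openin euclidean V"
    then have V: "open V" by simp
    show "openin DL1_topology {f \<in> DL1. T f \<in> V}"
    proof (subst openin_subopen, intro ballI)
      fix f assume "f \<in> {f \<in> DL1. T f \<in> V}"
      then have f: "f \<in> DL1" "T f \<in> V" by auto
      obtain e where e: "e > 0" "ball (T f) e \<subseteq> V" using V f(2) open_contains_ball by blast
      define d where "d = e / (\<bar>C\<bar> + 1)"
      let ?B = "{g \<in> DL1. DL1_norm k (\<lambda>x. g x - f x) < d}"
      have d: "d > 0" using e(1) by (simp add: d_def add_nonneg_pos)
      have "openin DL1_topology ?B"
        unfolding DL1_topology_def using f(1) d
        by (intro topology_generated_by_Basis) blast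
      moreover have "f \<in> ?B" using f(1) d by (simp add: DL1_norm_zero)
      moreover have "?B \<subseteq> {f \<in> DL1. T f \<in> V}"
      proof
        fix g assume "g \<in> ?B"
        then have g: "g \<in> DL1" "DL1_norm k (\<lambda>x. g x - f x) < d" by auto
        have "norm (T g - T f) \<le> C * DL1_norm k (\<lambda>x. g x - f x)"
          using bound[OF DL1_diff[OF g(1) f(1)]] diff[OF g(1) f(1)] by simp
        also have "\<dots> \<le> (\<bar>C\<bar> + 1) * DL1_norm k (\<lambda>x. g x - f x)"
          by (intro mult_right_mono DL1_norm_nonneg) simp
        also have "\<dots> < (\<bar>C\<bar> + 1) * d" using g(2) by (intro mult_strict_left_mono) auto
        also have "\<dots> = e" by (simp add: d_def)
        finally have "T g \<in> ball (T f) e" by (simp add: dist_norm norm_minus_commute)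
        then show "g \<in> {f \<in> DL1. T f \<in> V}" using e(2) g(1) by blast
      qed
      ultimately show "\<exists>S. openin DL1_topology S \<and> f \<in> S \<and> S \<subseteq> {f \<in> DL1. T f \<in> V}" by blast
    qed
  qed simp
  then show ?thesis using add cmult by (simp add: bounded_dists_def)
qed

section \<open>Distributions commute with averages of translates\<close>

lemma bounded_bilinear_scaleC: "bounded_bilinear (scaleC :: complex \<Rightarrow> 'x::complex_banach \<Rightarrow> 'x)"
proof
  show "(r *\<^sub>R a) *\<^sub>C b = r *\<^sub>R a *\<^sub>C b" for r a and b :: 'x
    by (simp add: scaleR_conv_of_real scaleC_scaleC[symmetric] scaleC_of_real)
  show "a *\<^sub>C r *\<^sub>R b = r *\<^sub>R a *\<^sub>C b" for r a and b :: 'x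
    by (simp add: scaleC_of_real[symmetric] scaleC_scaleC mult.commute)
  show "\<exists>K. \<forall>a (b::'x). norm (a *\<^sub>C b) \<le> norm a * norm b * K"
    by (intro exI[of _ 1]) (simp add: norm_scaleC)
qed (simp_all add: scaleC_add_left scaleC_add_right)

lemmas continuous_on_scaleC = bounded_bilinear.continuous_on[OF bounded_bilinear_scaleC]

text \<open>
  Both sides vanish for \<open>b = a\<close>, and by \<open>smear_local_bound\<close> they have the same derivative in \<open>b\<close>. This takes
  the place of an integral with values in the Frechet space of test functions.
\<close>

lemma bd_smear:
  fixes T :: "'x::complex_banach dist"
  assumes T: "T \<in> bounded_dists" and f: "f \<in> DL1" and w: "continuous_on {a..b} w" and ab: "a \<le> b"
  shows "T (smear a b w c f) = integral {a..b} (\<lambda>s. w s *\<^sub>C T (\<lambda>t. f (t + c * s)))"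
proof -
  note sf = DL1_smooth[OF f]
  let ?G = "\<lambda>v. T (smear a v w c f)" and ?g = "\<lambda>s. w s *\<^sub>C T (\<lambda>t. f (t + c * s))"
  obtain k C where C: "C \<ge> 0" "\<forall>f\<in>DL1. norm (T f) \<le> C * DL1_norm k f"
    using bd_bound[OF T] by blast
  have inc: "?G v - ?G u = T (smear u v w c f)" if "a \<le> u" "u \<le> v" "v \<le> b" for u v
  proof -
    have *: "continuous_on {a..v} w" "continuous_on {a..u} w" "continuous_on {u..v} w"
      using that by (auto intro: continuous_on_subset[OF w])
    have "smear a v w c f = (\<lambda>t. smear a u w c f t + smear u v w c f t)"
      using smear_split[OF that(1,2) *(1) sf] by blast
    then show ?thesis
      using bd_add[OF T smear_DL1[OF f *(2) that(1)] smear_DL1[OF f *(3) that(2)]] by simp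
  qed
  have loc: "norm (?G v - ?G u - (v - u) *\<^sub>R ?g y)
      \<le> C * ((v - u) * (e * DL1_norm k f + norm (w y) * (\<bar>c\<bar> * (v - u) * DL1_norm (Suc k) f)))"
    if uv: "a \<le> u" "u \<le> v" "v \<le> b" and y: "y = u \<or> y = v"
      and e: "\<And>s. s \<in> {u..v} \<Longrightarrow> norm (w s - w y) \<le> e" for u v y e
  proof -
    have wc: "continuous_on {u..v} w" using uv by (auto intro: continuous_on_subset[OF w])
    have fy: "(\<lambda>t. f (t + c * y)) \<in> DL1" by (rule DL1_shift[OF f])
    have "T (\<lambda>t. smear u v w c f t - of_real (v - u) * w y * f (t + c * y)) = ?G v - ?G u - (v - u) *\<^sub>R ?g y"
      unfolding bd_diff[OF T smear_DL1[OF f wc uv(2)] DL1_cmult[OF fy]] bd_cmult[OF T fy] inc[OF uv]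
      by (simp add: scaleC_of_real[symmetric] scaleC_scaleC)
    then have "norm (?G v - ?G u - (v - u) *\<^sub>R ?g y)
       \<le> C * DL1_norm k (\<lambda>t. smear u v w c f t - of_real (v - u) * w y * f (t + c * y))"
      using bspec[OF C(2) DL1_diff[OF smear_DL1[OF f wc uv(2), of c] DL1_cmult[OF fy, of "of_real (v - u) * w y"]]]
      by (simp only:)
    also have "\<dots> \<le> C * ((v - u) * (e * DL1_norm k f + norm (w y) * (\<bar>c\<bar> * (v - u) * DL1_norm (Suc k) f)))"
      by (intro mult_left_mono smear_local_bound f uv y wc e C(1))
    finally show ?thesis .
  qed
  have "(?G has_vector_derivative ?g y) (at y within {a..b})" if y: "y \<in> {a..b}" for y
    unfolding has_vector_derivative_def has_derivative_within_alt
  proof (intro conjI allI impI)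
    fix e :: real assume e: "e > 0"
    define M where "M = C * (DL1_norm k f + norm (w y) * (\<bar>c\<bar> * DL1_norm (Suc k) f))"
    have M: "M \<ge> 0" unfolding M_def using C(1) by (intro mult_nonneg_nonneg add_nonneg_nonneg DL1_norm_nonneg) auto
    \<comment> \<open>\<open>e'\<close> bounds both the oscillation of \<open>w\<close> and the length of the interval.\<close>
    define e' where "e' = e / (M + 1)"
    have e': "e' > 0" using e M by (simp add: e'_def)
    obtain d where d: "d > 0" "\<And>s. s \<in> {a..b} \<Longrightarrow> dist s y < d \<Longrightarrow> dist (w s) (w y) < e'"
      using w y e' unfolding continuous_on_iff by blast
    have bnd: "norm (?G v - ?G u - (v - u) *\<^sub>R ?g y) \<le> e * (v - u)"
      if uv: "a \<le> u" "u \<le> v" "v \<le> b" "v - u < min d e'" and y: "y = u \<or> y = v" for u v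
    proof -
      have "norm (w s - w y) \<le> e'" if "s \<in> {u..v}" for s
      proof -
        have "dist s y < d" using that uv(4) y by (auto simp: dist_real_def)
        moreover have "s \<in> {a..b}" using that uv by auto
        ultimately show ?thesis using d(2) by (fastforce simp: dist_norm)
      qed
      from loc[OF uv(1-3) y this]
      have "norm (?G v - ?G u - (v - u) *\<^sub>R ?g y)
        \<le> C * ((v - u) * (e' * DL1_norm k f + norm (w y) * (\<bar>c\<bar> * (v - u) * DL1_norm (Suc k) f)))" .
      also have "\<dots> \<le> C * ((v - u) * (e' * DL1_norm k f + norm (w y) * (\<bar>c\<bar> * e' * DL1_norm (Suc k) f)))"
        using uv C(1) by (intro mult_left_mono add_left_mono mult_right_mono DL1_norm_nonneg) auto
      also have "\<dots> = M * e' * (v - u)" by (simp add: M_def algebra_simps)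
      also have "\<dots> \<le> e * (v - u)"
        using uv(2) e M by (intro mult_right_mono) (auto simp: e'_def field_simps)
      finally show ?thesis .
    qed
    have "norm (?G z - ?G y - (z - y) *\<^sub>R ?g y) \<le> e * norm (z - y)"
      if z: "z \<in> {a..b}" "norm (z - y) < min d e'" for z
    proof (cases "y \<le> z")
      case True then show ?thesis using bnd[of y z] z y by simp
    next
      case False
      then have "norm (?G y - ?G z - (y - z) *\<^sub>R ?g y) \<le> e * (y - z)" using bnd[of z y] z y by simp
      moreover have "?G z - ?G y - (z - y) *\<^sub>R ?g y = - (?G y - ?G z - (y - z) *\<^sub>R ?g y)"
        by (simp add: algebra_simps)
      ultimately show ?thesis using False by (simp only: norm_minus_cancel) simp
    qed
    then show "\<exists>d>0. \<forall>z\<in>{a..b}. norm (z - y) < d \<longrightarrow> norm (?G z - ?G y - (z - y) *\<^sub>R ?g y) \<le> e * norm (z - y)"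
      using d(1) e' by (intro exI[of _ "min d e'"]) simp
  qed (rule bounded_linear_scaleR_left)
  from fundamental_theorem_of_calculus[OF ab this]
  have "(?g has_integral ?G b - ?G a) {a..b}" by blast
  moreover have "smear a a w c f = (\<lambda>_. 0)" by (simp add: smear_def fun_eq_iff)
  then have "?G a = 0" using bd_zero[OF T] by simp
  ultimately show ?thesis by (simp add: integral_unique)
qed

section \<open>Regularisation by convolution\<close>

lemma DL1_reflect_shift: "f \<in> DL1 \<Longrightarrow> (\<lambda>t. f (x - t)) \<in> DL1"
  using DL1_affine[of f "-1" x] by simp

lemma DL1_norm_reflect_shift: "f \<in> DL1 \<Longrightarrow> DL1_norm k (\<lambda>t. f (x - t)) = DL1_norm k f"
  using DL1_norm_affine[of f "-1" k x] by simp

lemma dist_conv_bound: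
  assumes "\<forall>f\<in>DL1. norm (T f) \<le> C * DL1_norm k f" "f \<in> DL1"
  shows "norm (dist_conv T f x) \<le> C * DL1_norm k f"
  using assms(1) DL1_reflect_shift[OF assms(2), of x] DL1_norm_reflect_shift[OF assms(2), of k x]
  unfolding dist_conv_def by metis

lemma dist_conv_bounded: "T \<in> bounded_dists \<Longrightarrow> f \<in> DL1 \<Longrightarrow> bounded (range (dist_conv T f))"
  using bd_bound[of T] dist_conv_bound[of T _ _ f] unfolding bounded_iff by blast

lemma dist_conv_diff:
  "T \<in> bounded_dists \<Longrightarrow> f \<in> DL1 \<Longrightarrow> g \<in> DL1 \<Longrightarrow>
    dist_conv T (\<lambda>t. f t - g t) x = dist_conv T f x - dist_conv T g x"
  unfolding dist_conv_def by (rule bd_diff) (auto intro: DL1_reflect_shift)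

lemma dist_conv_continuous:
  fixes T :: "'x::complex_banach dist"
  assumes T: "T \<in> bounded_dists" and f: "f \<in> DL1"
  shows "continuous_on S (dist_conv T f)"
proof -
  obtain k C where C: "C \<ge> 0" "\<forall>f\<in>DL1. norm (T f) \<le> C * DL1_norm k f"
    using bd_bound[OF T] by blast
  have lip: "norm (dist_conv T f y - dist_conv T f x) \<le> C * DL1_norm (Suc k) f * (y - x)" if "x \<le> y" for x y
  proof -
    let ?r = "\<lambda>t. f (- t)"
    have r: "?r \<in> DL1" using DL1_reflect_shift[OF f, of 0] by simp
    have "DL1_norm k (\<lambda>t. ?r (t + (-x)) - ?r (t + (-y))) \<le> (y - x) * DL1_norm (Suc k) f"
      using DL1_norm_translate_diff[OF r, of "-y" "-x" k] that DL1_norm_reflect_shift[OF f, of "Suc k" 0] by simp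
    moreover have "(\<lambda>t. f (x - t) - f (y - t)) \<in> DL1" by (intro DL1_diff DL1_reflect_shift f)
    ultimately have "norm (T (\<lambda>t. f (x - t) - f (y - t))) \<le> C * ((y - x) * DL1_norm (Suc k) f)"
      using C(2) mult_left_mono[OF _ C(1)] by (fastforce intro: order_trans)
    then show ?thesis
      unfolding dist_conv_def bd_diff[OF T DL1_reflect_shift[OF f] DL1_reflect_shift[OF f]]
      by (simp add: norm_minus_commute mult_ac)
  qed
  have "lipschitz_on (C * DL1_norm (Suc k) f) UNIV (dist_conv T f)"
  proof (rule lipschitz_onI)
    show "dist (dist_conv T f x) (dist_conv T f y) \<le> C * DL1_norm (Suc k) f * dist x y" for x y
      using lip[of x y] lip[of y x]
      by (cases "x \<le> y") (simp_all add: dist_norm norm_minus_commute dist_real_def)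
    show "0 \<le> C * DL1_norm (Suc k) f" using C(1) DL1_norm_nonneg by (rule mult_nonneg_nonneg)
  qed
  then show ?thesis using lipschitz_on_continuous_on continuous_on_subset by blast
qed

text \<open>
  The increment of \<open>f (\<cdot> - t)\<close> is an average of translates of the reflected derivative with constant
  weight, so that \<open>bd_smear\<close> applies.
\<close>

lemma dist_conv_increment:
  fixes T :: "'x::complex_banach dist"
  assumes T: "T \<in> bounded_dists" and f: "f \<in> DL1" and ax: "a \<le> x"
  shows "dist_conv T f x - dist_conv T f a = integral {a..x} (dist_conv T (nderiv 1 f))"
proof -
  let ?r = "\<lambda>t. nderiv 1 f (- t)"
  have r: "?r \<in> DL1" using DL1_reflect_shift[OF DL1_nderiv[OF f], of 1 0] by simp
  have "smear a x (\<lambda>_. 1) (-1) ?r t = f (x - t) - f (a - t)" for t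
    using smear_increment[OF DL1_smooth[OF f] ax, of 1 "-t"] by (simp add: smear_def add.commute)
  then have "T (\<lambda>t. f (x - t) - f (a - t)) = T (smear a x (\<lambda>_. 1) (-1) ?r)" by presburger
  also have "\<dots> = integral {a..x} (\<lambda>s. 1 *\<^sub>C T (\<lambda>t. ?r (t + (-1) * s)))"
    by (rule bd_smear[OF T r _ ax]) simp
  also have "\<dots> = integral {a..x} (dist_conv T (nderiv 1 f))"
    unfolding dist_conv_def by (simp add: scaleC_one)
  finally show ?thesis
    unfolding dist_conv_def bd_diff[OF T DL1_reflect_shift[OF f] DL1_reflect_shift[OF f]] .
qed

lemma dist_conv_derivative:
  fixes T :: "'x::complex_banach dist"
  assumes T: "T \<in> bounded_dists" and f: "f \<in> DL1"
  shows "(dist_conv T f has_vector_derivative dist_conv T (nderiv 1 f) x) (at x)"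
proof -
  let ?h = "dist_conv T (nderiv 1 f)"
  have "((\<lambda>y. integral {x - 1..y} ?h) has_vector_derivative ?h x) (at x within {x - 1..x + 1})"
    by (rule integral_has_vector_derivative[OF dist_conv_continuous[OF T DL1_nderiv[OF f]]]) simp
  then have "((\<lambda>y. dist_conv T f (x - 1) + integral {x - 1..y} ?h) has_vector_derivative 0 + ?h x) (at x within {x - 1..x + 1})"
    by (intro has_vector_derivative_add has_vector_derivative_const)
  then have "((\<lambda>y. dist_conv T f (x - 1) + integral {x - 1..y} ?h) has_vector_derivative ?h x) (at x)"
    using at_within_interior[of x "{x - 1..x + 1}"] by simp
  then show ?thesis
  proof (rule has_vector_derivative_transform_within_open)
    show "dist_conv T f (x - 1) + integral {x - 1..y} ?h = dist_conv T f y" if "y \<in> {x - 1<..<x + 1}" for y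
      using dist_conv_increment[OF T f, of "x - 1" y] that by (metis add_diff_cancel_left' diff_add_cancel add.commute greaterThanLessThan_iff less_imp_le)
  qed simp_all
qed

lemma dist_conv_smooth:
  fixes T :: "'x::complex_banach dist"
  assumes "T \<in> bounded_dists" "f \<in> DL1"
  shows "dist_conv T f \<in> smooth_functions"
proof -
  have "(dist_conv T (nderiv j f) has_vector_derivative dist_conv T (nderiv (Suc j) f) x) (at x)" for j x
    using dist_conv_derivative[OF assms(1) DL1_nderiv[OF assms(2)], of j x] by (simp add: nderiv_nderiv)
  from nderiv_chain_smooth[of "\<lambda>j. dist_conv T (nderiv j f)", OF this] show ?thesis by simp
qed

section \<open>Almost periodic functions\<close>

lemma relatively_dense_mono: "relatively_dense P \<Longrightarrow> P \<subseteq> Q \<Longrightarrow> relatively_dense Q"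
  unfolding relatively_dense_def by (meson subsetD)

lemma AP_continuous: "g \<in> AP \<Longrightarrow> continuous_on S g"
  by (rule continuous_on_subset[of UNIV]) (simp_all add: AP_def)

lemma AP_period:
  assumes "g \<in> AP" "e > 0"
  shows "\<exists>l>0. \<forall>a. \<exists>\<tau>. a \<le> \<tau> \<and> \<tau> \<le> a + l \<and> (\<forall>t. norm (g (t + \<tau>) - g t) \<le> e)"
proof -
  have "relatively_dense (eps_periods e g)" using assms by (simp add: AP_def)
  then obtain l where l: "l > 0" "\<forall>a. \<exists>\<tau>\<in>eps_periods e g. a \<le> \<tau> \<and> \<tau> \<le> a + l"
    unfolding relatively_dense_def by blast
  have "\<exists>\<tau>. a \<le> \<tau> \<and> \<tau> \<le> a + l \<and> (\<forall>t. norm (g (t + \<tau>) - g t) \<le> e)" for a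
  proof -
    obtain \<tau> where "\<tau> \<in> eps_periods e g" "a \<le> \<tau>" "\<tau> \<le> a + l" using l(2) by blast
    then show ?thesis by (intro exI[of _ \<tau>]) (simp add: eps_periods_def)
  qed
  then show ?thesis using l(1) by (intro exI[of _ l]) simp
qed

lemma AP_uniformly_continuous:
  fixes g :: "real \<Rightarrow> 'a::real_normed_vector"
  assumes g: "g \<in> AP" and e: "e > 0"
  shows "\<exists>d>0. \<forall>x y. \<bar>x - y\<bar> < d \<longrightarrow> norm (g x - g y) \<le> e"
proof -
  obtain l where l: "l > 0" "\<And>a. \<exists>\<tau>. a \<le> \<tau> \<and> \<tau> \<le> a + l \<and> (\<forall>t. norm (g (t + \<tau>) - g t) \<le> e / 3)"
    using AP_period[OF g divide_pos_pos[OF e zero_less_numeral]] by blast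
  \<comment> \<open>The interval exceeds \<open>[0, l]\<close> by 1 on both sides to contain the neighbours of its points.\<close>
  have "uniformly_continuous_on {-1..l + 1} g"
    by (intro compact_uniformly_continuous AP_continuous g) simp
  then have "\<exists>d>0. \<forall>x\<in>{-1..l + 1}. \<forall>y\<in>{-1..l + 1}. dist y x < d \<longrightarrow> dist (g y) (g x) < e / 3"
    unfolding uniformly_continuous_on_def using e by (elim allE[of _ "e / 3"]) simp
  then obtain d where d0: "d > 0"
    "\<forall>x\<in>{-1..l + 1}. \<forall>y\<in>{-1..l + 1}. dist y x < d \<longrightarrow> dist (g y) (g x) < e / 3"
    by (elim exE conjE)
  then have d: "d > 0" "\<And>x y. x \<in> {-1..l + 1} \<Longrightarrow> y \<in> {-1..l + 1} \<Longrightarrow> dist x y < d \<Longrightarrow> dist (g x) (g y) < e / 3"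
    by simp_all
  have "norm (g x - g y) \<le> e" if xy: "\<bar>x - y\<bar> < min d 1" for x y
  proof -
    obtain \<tau> where t: "-x \<le> \<tau>" "\<tau> \<le> -x + l" "\<And>t. norm (g (t + \<tau>) - g t) \<le> e / 3" using l(2)[of "-x"] by blast
    have "dist (g (x + \<tau>)) (g (y + \<tau>)) < e / 3"
      using xy t(1,2) by (intro d(2)) (auto simp: dist_real_def)
    then have "norm (g (x + \<tau>) - g (y + \<tau>)) \<le> e / 3" by (simp add: dist_norm)
    moreover have "norm (g x - g y) \<le> norm (g (x + \<tau>) - g (y + \<tau>)) + norm (g (x + \<tau>) - g x) + norm (g (y + \<tau>) - g y)"
      using norm_triangle_ineq4[of "(g (x + \<tau>) - g (y + \<tau>)) + (g (y + \<tau>) - g y)" "g (x + \<tau>) - g x"]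
        norm_triangle_ineq[of "g (x + \<tau>) - g (y + \<tau>)" "g (y + \<tau>) - g y"] by simp
    ultimately show ?thesis using t(3)[of x] t(3)[of y] by linarith
  qed
  then show ?thesis using d(1) by (intro exI[of _ "min d 1"]) simp
qed

text \<open>
  Bochner's criterion. In one direction, a translation can be moved by an almost period into a fixed
  compact interval, where uniform continuity provides a finite net; in the other, the differences
  between translations and their net points are almost periods. Unlike Bohr's definition, which would
  require common almost periods, the criterion passes easily to sums.
\<close>

lemma AP_iff_translates_totally_bounded:
  fixes g :: "real \<Rightarrow> 'a::real_normed_vector"
  shows "g \<in> AP \<longleftrightarrow> continuous_on UNIV g \<and>
    (\<forall>e>0. \<exists>H. finite H \<and> (\<forall>h. \<exists>h'\<in>H. \<forall>t. norm (g (t + h) - g (t + h')) \<le> e))" (is "_ \<longleftrightarrow> ?R")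
proof
  assume g: "g \<in> AP"
  have "\<exists>H. finite H \<and> (\<forall>h. \<exists>h'\<in>H. \<forall>t. norm (g (t + h) - g (t + h')) \<le> e)" if e: "e > 0" for e
  proof -
    obtain l where l: "l > 0" "\<And>a. \<exists>\<tau>. a \<le> \<tau> \<and> \<tau> \<le> a + l \<and> (\<forall>t. norm (g (t + \<tau>) - g t) \<le> e / 2)"
      using AP_period[OF g divide_pos_pos[OF e zero_less_numeral]] by blast
    obtain d where d: "d > 0" "\<And>x y. \<bar>x - y\<bar> < d \<Longrightarrow> norm (g x - g y) \<le> e / 2"
      using AP_uniformly_continuous[OF g divide_pos_pos[OF e zero_less_numeral]] by blast
    obtain H where H: "finite H" "{0..l} \<subseteq> (\<Union>x\<in>H. ball x d)"
      using compact_Icc[of 0 l] d(1) unfolding compact_eq_totally_bounded by blast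
    have "\<exists>h'\<in>H. \<forall>t. norm (g (t + h) - g (t + h')) \<le> e" for h
    proof -
      obtain \<tau> where t: "-h \<le> \<tau>" "\<tau> \<le> -h + l" "\<And>t. norm (g (t + \<tau>) - g t) \<le> e / 2" using l(2)[of "-h"] by blast
      then have "h + \<tau> \<in> {0..l}" by auto
      then obtain h' where h': "h' \<in> H" "\<bar>h + \<tau> - h'\<bar> < d" using H(2) by (auto simp: dist_real_def abs_minus_commute)
      have "norm (g (t + h) - g (t + h')) \<le> e" for t
      proof -
        have "norm (g (t + h + \<tau>) - g (t + h')) \<le> e / 2" using h'(2) by (intro d(2)) (simp add: add_ac)
        moreover have "norm (g (t + h) - g (t + h')) \<le> norm (g (t + h + \<tau>) - g (t + h)) + norm (g (t + h + \<tau>) - g (t + h'))"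
          using norm_triangle_ineq4[of "g (t + h + \<tau>) - g (t + h')" "g (t + h + \<tau>) - g (t + h)"] by simp
        ultimately show ?thesis using t(3)[of "t + h"] by linarith
      qed
      then show ?thesis using h'(1) by blast
    qed
    then show ?thesis using H(1) by blast
  qed
  then show ?R using AP_continuous[OF g] by blast
next
  assume R: ?R
  have "relatively_dense (eps_periods e g)" if e: "e > 0" for e
  proof -
    obtain H where H: "finite H" "\<And>h. \<exists>h'\<in>H. \<forall>t. norm (g (t + h) - g (t + h')) \<le> e" using R e by blast
    obtain L where L: "L > 0" "\<And>h. h \<in> H \<Longrightarrow> \<bar>h\<bar> \<le> L"
      using finite_imp_bounded[OF H(1)] unfolding bounded_pos by auto
    have "\<exists>\<tau>\<in>eps_periods e g. a \<le> \<tau> \<and> \<tau> \<le> a + 2 * L" for a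
    proof -
      obtain h' where h': "h' \<in> H" "\<And>t. norm (g (t + (a + L)) - g (t + h')) \<le> e" using H(2)[of "a + L"] by blast
      have "norm (g (t + (a + L - h')) - g t) \<le> e" for t
        using h'(2)[of "t - h'"] by (simp add: algebra_simps)
      moreover have "a \<le> a + L - h'" "a + L - h' \<le> a + 2 * L" using L(2)[OF h'(1)] by linarith+
      ultimately show ?thesis unfolding eps_periods_def by blast
    qed
    then show ?thesis using L(1) unfolding relatively_dense_def by (intro exI[of _ "2 * L"]) simp
  qed
  then show "g \<in> AP" using R by (simp add: AP_def)
qed

lemma AP_add:
  fixes f g :: "real \<Rightarrow> 'a::real_normed_vector"
  assumes f: "f \<in> AP" and g: "g \<in> AP"
  shows "(\<lambda>t. f t + g t) \<in> AP"
  unfolding AP_iff_translates_totally_bounded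
proof (intro conjI allI impI)
  show "continuous_on UNIV (\<lambda>t. f t + g t)" by (intro continuous_intros AP_continuous f g)
next
  fix e :: real assume "e > 0"
  then have e4: "e / 4 > 0" by simp
  obtain P where P: "finite P" "\<And>h. \<exists>p\<in>P. \<forall>t. norm (f (t + h) - f (t + p)) \<le> e / 4"
    using f e4 unfolding AP_iff_translates_totally_bounded by blast
  obtain Q where Q: "finite Q" "\<And>h. \<exists>q\<in>Q. \<forall>t. norm (g (t + h) - g (t + q)) \<le> e / 4"
    using g e4 unfolding AP_iff_translates_totally_bounded by blast
  \<comment> \<open>One representative for each cell of the product net that contains a common translation.\<close>
  define near where "near p q h \<longleftrightarrow> (\<forall>t. norm (f (t + h) - f (t + p)) \<le> e / 4) \<and> (\<forall>t. norm (g (t + h) - g (t + q)) \<le> e / 4)" for p q h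
  define H where "H = (\<lambda>(p, q). SOME h. near p q h) ` (P \<times> Q)"
  have "\<exists>h'\<in>H. \<forall>t. norm (f (t + h) + g (t + h) - (f (t + h') + g (t + h'))) \<le> e" for h
  proof -
    obtain p where p: "p \<in> P" "\<forall>t. norm (f (t + h) - f (t + p)) \<le> e / 4" using P(2) by blast
    obtain q where q: "q \<in> Q" "\<forall>t. norm (g (t + h) - g (t + q)) \<le> e / 4" using Q(2) by blast
    define h' where "h' = (SOME h. near p q h)"
    have "near p q h" using p q by (simp add: near_def)
    then have n: "near p q h'" unfolding h'_def by (rule someI)
    have "h' \<in> H" using p q by (auto simp: H_def h'_def)
    moreover have "norm (f (t + h) + g (t + h) - (f (t + h') + g (t + h'))) \<le> e" for t
    proof -
      have *: "norm (u - v) \<le> e / 2" if "norm (u - w) \<le> e / 4" "norm (v - w) \<le> e / 4" for u v w :: 'a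
        using norm_triangle_ineq4[of "u - w" "v - w"] that by simp
      have "norm (f (t + h) - f (t + h')) \<le> e / 2" "norm (g (t + h) - g (t + h')) \<le> e / 2"
        using n p(2) q(2) unfolding near_def by (blast intro: *)+
      then show ?thesis
        using norm_triangle_ineq[of "f (t + h) - f (t + h')" "g (t + h) - g (t + h')"] by (simp add: algebra_simps)
    qed
    ultimately show ?thesis by blast
  qed
  moreover have "finite H" using P(1) Q(1) by (simp add: H_def)
  ultimately show "\<exists>H. finite H \<and> (\<forall>h. \<exists>h'\<in>H. \<forall>t. norm (f (t + h) + g (t + h) - (f (t + h') + g (t + h'))) \<le> e)"
    by blast
qed

lemma AP_sum:
  fixes g :: "nat \<Rightarrow> real \<Rightarrow> 'a::real_normed_vector"
  assumes "\<And>j. j \<le> k \<Longrightarrow> g j \<in> AP"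
  shows "(\<lambda>t. \<Sum>j\<le>k. g j t) \<in> AP"
  using assms
proof (induction k)
  case (Suc k)
  have "(\<lambda>t. (\<Sum>j\<le>k. g j t) + g (Suc k) t) \<in> AP" by (intro AP_add Suc.IH Suc.prems) simp_all
  then show ?case by simp
qed simp

lemma AP_minus: "g \<in> AP \<Longrightarrow> (\<lambda>t. - g t) \<in> AP"
proof -
  assume g: "g \<in> AP"
  have "eps_periods e (\<lambda>t. - g t) = eps_periods e g" for e
  proof -
    have "norm (- g (t + \<tau>) - - g t) = norm (g (t + \<tau>) - g t)" for t \<tau>
      using norm_minus_commute[of "g t" "g (t + \<tau>)"] by simp
    then show ?thesis unfolding eps_periods_def by presburger
  qed
  then show ?thesis using g AP_continuous[OF g, of UNIV] by (simp add: AP_def continuous_on_minus)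
qed

lemma AP_diff:
  assumes "f \<in> AP" "g \<in> AP" shows "(\<lambda>t. f t - g t) \<in> AP"
  using AP_add[OF assms(1) AP_minus[OF assms(2)]] by simp

lemma AP_shift:
  assumes "g \<in> AP" shows "(\<lambda>t. g (t + a)) \<in> AP"
proof -
  have "eps_periods e g \<subseteq> eps_periods e (\<lambda>t. g (t + a))" for e
  proof
    fix \<tau> assume "\<tau> \<in> eps_periods e g"
    then have "norm (g (t + a + \<tau>) - g (t + a)) \<le> e" for t by (simp add: eps_periods_def)
    then show "\<tau> \<in> eps_periods e (\<lambda>t. g (t + a))" by (simp add: eps_periods_def add_ac)
  qed
  moreover have "continuous_on UNIV (\<lambda>t. g (t + a))"
    by (intro continuous_on_compose2[OF AP_continuous[OF assms, of UNIV]] continuous_intros) auto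
  ultimately show ?thesis
    using assms relatively_dense_mono[of "eps_periods e g" "eps_periods e (\<lambda>t. g (t + a))" for e]
    unfolding AP_def mem_Collect_eq by simp
qed

text \<open>
  A large almost period carries any point to the region where the bound is known. This makes the
  almost periodic part of a function in \<open>AAP\<close> depend continuously on the function.
\<close>

lemma AP_bound_from_infinity:
  assumes g: "g \<in> AP" and M: "eventually (\<lambda>t. norm (g t) \<le> M) at_top"
  shows "norm (g t) \<le> M"
proof (rule field_le_epsilon)
  fix e :: real assume e: "e > 0"
  obtain N where N: "\<And>s. s \<ge> N \<Longrightarrow> norm (g s) \<le> M" using M unfolding eventually_at_top_linorder by blast
  obtain \<tau> where \<tau>: "N - t \<le> \<tau>" "norm (g (t + \<tau>) - g t) \<le> e" using AP_period[OF g e] by meson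
  have "norm (g t) \<le> norm (g (t + \<tau>)) + norm (g (t + \<tau>) - g t)"
    using norm_triangle_ineq4[of "g (t + \<tau>)" "g (t + \<tau>) - g t"] by simp
  then show "norm (g t) \<le> M + e" using N[of "t + \<tau>"] \<tau> by simp
qed

lemma AP_bounded:
  assumes g: "g \<in> AP" shows "\<exists>M. \<forall>t. norm (g t) \<le> M"
proof -
  obtain l where l: "l > 0" "\<And>a. \<exists>\<tau>. a \<le> \<tau> \<and> \<tau> \<le> a + l \<and> (\<forall>t. norm (g (t + \<tau>) - g t) \<le> 1)"
    using AP_period[OF g zero_less_one] by blast
  obtain M where M: "\<And>s. s \<in> {0..l} \<Longrightarrow> norm (g s) \<le> M" using continuous_bound[OF AP_continuous[OF g, of "{0..l}"]] by blast
  have "norm (g t) \<le> M + 1" for t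
  proof -
    obtain \<tau> where \<tau>: "-t \<le> \<tau>" "\<tau> \<le> -t + l" "\<forall>s. norm (g (s + \<tau>) - g s) \<le> 1" using l(2)[of "-t"] by blast
    have "norm (g t) \<le> norm (g (t + \<tau>)) + norm (g (t + \<tau>) - g t)"
      using norm_triangle_ineq4[of "g (t + \<tau>)" "g (t + \<tau>) - g t"] by simp
    moreover have "norm (g (t + \<tau>)) \<le> M" using \<tau>(1,2) by (intro M) auto
    moreover have "norm (g (t + \<tau>) - g t) \<le> 1" using \<tau>(3) by blast
    ultimately show ?thesis by linarith
  qed
  then show ?thesis by blast
qed

lemma continuous_uniform_approx:
  fixes f :: "real \<Rightarrow> 'a::real_normed_vector"
  assumes "\<And>e. e > 0 \<Longrightarrow> \<exists>g. continuous_on UNIV g \<and> (\<forall>t. norm (f t - g t) \<le> e)"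
  shows "continuous_on UNIV f"
  unfolding continuous_on_iff
proof (intro ballI allI impI)
  fix x e :: real assume "e > 0"
  then have e3: "e / 3 > 0" by simp
  obtain g where g: "continuous_on UNIV g" "\<And>t. norm (f t - g t) \<le> e / 3" using assms[OF e3] by blast
  obtain d where d: "d > 0" "\<And>y. dist y x < d \<Longrightarrow> dist (g y) (g x) < e / 3"
    using g(1) e3 unfolding continuous_on_iff by blast
  have "dist (f y) (f x) < e" if "dist y x < d" for y
  proof -
    have "dist (f y) (g y) \<le> e / 3" "dist (f x) (g x) \<le> e / 3" using g(2) by (auto simp: dist_norm)
    then show ?thesis
      using d(2)[OF that] dist_triangle[of "f y" "f x" "g y"] dist_triangle[of "g y" "f x" "g x"] dist_commute[of "f x" "g x"]
      by linarith
  qed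
  then show "\<exists>d>0. \<forall>y\<in>UNIV. dist y x < d \<longrightarrow> dist (f y) (f x) < e" using d(1) by blast
qed

lemma AP_uniform_approx:
  fixes f :: "real \<Rightarrow> 'a::real_normed_vector"
  assumes approx: "\<And>e. e > 0 \<Longrightarrow> \<exists>g\<in>AP. \<forall>t. norm (f t - g t) \<le> e"
  shows "f \<in> AP"
proof -
  have "relatively_dense (eps_periods e f)" if "e > 0" for e
  proof -
    have e3: "e / 3 > 0" using that by simp
    obtain g where g: "g \<in> AP" "\<And>t. norm (f t - g t) \<le> e / 3" using approx[OF e3] by blast
    have "eps_periods (e / 3) g \<subseteq> eps_periods e f"
    proof
      fix \<tau> assume "\<tau> \<in> eps_periods (e / 3) g"
      then have p: "norm (g (t + \<tau>) - g t) \<le> e / 3" for t by (simp add: eps_periods_def)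
      have "norm (f (t + \<tau>) - f t) \<le> e" for t
      proof -
        have "norm (f (t + \<tau>) - f t) \<le> norm (f (t + \<tau>) - g (t + \<tau>)) + norm (g (t + \<tau>) - g t) + norm (f t - g t)"
          using norm_triangle_ineq4[of "(f (t + \<tau>) - g (t + \<tau>)) + (g (t + \<tau>) - g t)" "f t - g t"]
            norm_triangle_ineq[of "f (t + \<tau>) - g (t + \<tau>)" "g (t + \<tau>) - g t"] by simp
        then show ?thesis using g(2)[of t] g(2)[of "t + \<tau>"] p[of t] by linarith
      qed
      then show "\<tau> \<in> eps_periods e f" by (simp add: eps_periods_def)
    qed
    moreover have "relatively_dense (eps_periods (e / 3) g)" using g(1) e3 by (simp add: AP_def)
    ultimately show ?thesis by (rule relatively_dense_mono[rotated])
  qed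
  moreover have "continuous_on UNIV f"
    using approx AP_continuous by (intro continuous_uniform_approx) blast
  ultimately show ?thesis by (simp add: AP_def)
qed

lemma uniform_Cauchy_limit:
  fixes g :: "nat \<Rightarrow> 'b \<Rightarrow> 'a::banach"
  assumes gg: "\<And>n m t. norm (g n t - g m t) \<le> r n + r m" and r: "r \<longlonglongrightarrow> 0"
  shows "\<exists>G. \<forall>n t. norm (g n t - G t) \<le> r n"
proof -
  have "Cauchy (\<lambda>n. g n t)" for t
  proof (rule metric_CauchyI)
    fix e :: real assume "e > 0"
    then have "eventually (\<lambda>n. r n < e / 2) sequentially" using r by (intro order_tendstoD(2)) auto
    then obtain N where N: "\<And>n. n \<ge> N \<Longrightarrow> r n < e / 2" unfolding eventually_sequentially by blast
    then have "dist (g m t) (g n t) < e" if "m \<ge> N" "n \<ge> N" for m n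
      using gg[of m t n] N[OF that(1)] N[OF that(2)] by (simp add: dist_norm)
    then show "\<exists>M. \<forall>m\<ge>M. \<forall>n\<ge>M. dist (g m t) (g n t) < e" by blast
  qed
  then have "\<forall>t. \<exists>l. (\<lambda>n. g n t) \<longlonglongrightarrow> l" using Cauchy_convergent convergent_def by blast
  from choice[OF this] obtain G where "\<forall>t. (\<lambda>n. g n t) \<longlonglongrightarrow> G t" ..
  then have G: "(\<lambda>n. g n t) \<longlonglongrightarrow> G t" for t by simp
  have "norm (g n t - G t) \<le> r n" for n t
  proof (rule tendsto_le[OF sequentially_bot])
    show "(\<lambda>m. norm (g n t - g m t)) \<longlonglongrightarrow> norm (g n t - G t)" by (intro tendsto_intros G)
    show "(\<lambda>m. r n + r m) \<longlonglongrightarrow> r n" using tendsto_add[OF tendsto_const r, of "r n"] by simp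
    show "\<forall>\<^sub>F m in sequentially. norm (g n t - g m t) \<le> r n + r m" by (simp add: gg)
  qed
  then show ?thesis by blast
qed

section \<open>Asymptotically almost periodic functions\<close>

text \<open>
  The vanishing part is \<open>f - g\<close>, which is automatically bounded on the half line. So only continuity and
  the behaviour of \<open>f\<close> at \<open>+\<infinity>\<close> matter.
\<close>

lemma AAP_iff:
  fixes f :: "real \<Rightarrow> 'a::real_normed_vector"
  shows "f \<in> AAP \<longleftrightarrow> continuous_on UNIV f \<and> (\<exists>g\<in>AP. ((\<lambda>t. f t - g t) \<longlongrightarrow> 0) at_top)" (is "_ \<longleftrightarrow> ?R")
proof
  assume "f \<in> AAP"
  then obtain g q where c: "continuous_on UNIV f" and g: "g \<in> AP" and q: "q \<in> C0_halfline" "\<And>t. t \<ge> 0 \<Longrightarrow> f t = g t + q t"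
    unfolding AAP_def by blast
  have "((\<lambda>t. f t - g t) \<longlongrightarrow> 0) at_top"
  proof (rule Lim_transform_eventually)
    show "(q \<longlongrightarrow> 0) at_top" using q(1) by (simp add: C0_halfline_def)
    show "eventually (\<lambda>t. q t = f t - g t) at_top"
      using eventually_ge_at_top[of 0] by eventually_elim (simp add: q(2))
  qed
  then show ?R using c g by blast
next
  assume ?R
  then obtain g where c: "continuous_on UNIV f" and g: "g \<in> AP" and lim: "((\<lambda>t. f t - g t) \<longlongrightarrow> 0) at_top" by blast
  let ?q = "\<lambda>t. f t - g t"
  have cq: "continuous_on S ?q" for S
    by (intro continuous_on_diff AP_continuous g continuous_on_subset[OF c]) simp
  have "eventually (\<lambda>t. dist (?q t) 0 < 1) at_top" using lim by (rule tendstoD) simp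
  then obtain N where N: "\<And>t. t \<ge> N \<Longrightarrow> norm (?q t) < 1" unfolding eventually_at_top_linorder by auto
  obtain M where M: "\<And>t. t \<in> {0..N} \<Longrightarrow> norm (?q t) \<le> M" using continuous_bound[OF cq] by blast
  have "norm (?q t) \<le> max M 1" if "t \<ge> 0" for t
    using N[of t] M[of t] that by (cases "t \<ge> N") auto
  then have "bounded (?q ` {0..})" unfolding bounded_iff by auto
  then have "?q \<in> C0_halfline" using cq lim by (simp add: C0_halfline_def)
  then show "f \<in> AAP"
    unfolding AAP_def mem_Collect_eq by (intro conjI c bexI[of _ ?q] bexI[of _ g] g) simp_all
qed

lemma AAPI:
  fixes f :: "real \<Rightarrow> 'a::real_normed_vector"
  assumes "continuous_on UNIV f" "g \<in> AP" "((\<lambda>t. f t - g t) \<longlongrightarrow> 0) at_top"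
  shows "f \<in> AAP"
  unfolding AAP_iff by (intro conjI bexI[of _ g] assms)

lemma AAP_continuous: "f \<in> AAP \<Longrightarrow> continuous_on S f"
  by (rule continuous_on_subset[of UNIV]) (simp_all add: AAP_iff)

lemma AAP_add:
  fixes f h :: "real \<Rightarrow> 'a::real_normed_vector"
  assumes "f \<in> AAP" "h \<in> AAP" shows "(\<lambda>t. f t + h t) \<in> AAP"
proof -
  obtain g where g: "g \<in> AP" "((\<lambda>t. f t - g t) \<longlongrightarrow> 0) at_top" using assms(1) unfolding AAP_iff by blast
  obtain k where k: "k \<in> AP" "((\<lambda>t. h t - k t) \<longlongrightarrow> 0) at_top" using assms(2) unfolding AAP_iff by blast
  have "((\<lambda>t. (f t + h t) - (g t + k t)) \<longlongrightarrow> 0) at_top"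
    using tendsto_add[OF g(2) k(2)] by (simp add: algebra_simps)
  with AP_add[OF g(1) k(1)] show ?thesis
    by (rule AAPI[rotated]) (intro continuous_on_add AAP_continuous assms)
qed

lemma AAP_sum:
  fixes f :: "nat \<Rightarrow> real \<Rightarrow> 'a::real_normed_vector"
  assumes "\<And>j. j \<le> k \<Longrightarrow> f j \<in> AAP"
  shows "(\<lambda>t. \<Sum>j\<le>k. f j t) \<in> AAP"
  using assms
proof (induction k)
  case (Suc k)
  have "(\<lambda>t. (\<Sum>j\<le>k. f j t) + f (Suc k) t) \<in> AAP" by (intro AAP_add Suc.IH Suc.prems) simp_all
  then show ?case by simp
qed simp

lemma AAP_eventually_eq:
  fixes f h :: "real \<Rightarrow> 'a::real_normed_vector"
  assumes "h \<in> AAP" "continuous_on UNIV f" "eventually (\<lambda>t. f t - h t = q t) at_top" "(q \<longlongrightarrow> 0) at_top"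
  shows "f \<in> AAP"
proof -
  obtain g where g: "g \<in> AP" "((\<lambda>t. h t - g t) \<longlongrightarrow> 0) at_top" using assms(1) unfolding AAP_iff by blast
  have "((\<lambda>t. (h t - g t) + q t) \<longlongrightarrow> 0) at_top" using tendsto_add[OF g(2) assms(4)] by simp
  then have "((\<lambda>t. f t - g t) \<longlongrightarrow> 0) at_top"
    by (rule Lim_transform_eventually) (use assms(3) in \<open>eventually_elim, simp add: algebra_simps\<close>)
  then show ?thesis by (rule AAPI[OF assms(2) g(1)])
qed

lemma AAP_shift:
  fixes f :: "real \<Rightarrow> 'a::real_normed_vector"
  assumes "f \<in> AAP" shows "(\<lambda>t. f (t + a)) \<in> AAP"
proof -
  obtain g where g: "g \<in> AP" "((\<lambda>t. f t - g t) \<longlongrightarrow> 0) at_top" using assms unfolding AAP_iff by blast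
  have "filterlim (\<lambda>t::real. t + a) at_top at_top"
    using filterlim_tendsto_add_at_top[OF tendsto_const[of a] filterlim_ident] by (simp add: add.commute)
  from filterlim_compose[OF g(2) this]
  have "((\<lambda>t. f (t + a) - g (t + a)) \<longlongrightarrow> 0) at_top" .
  moreover have "continuous_on UNIV (\<lambda>t. f (t + a))"
    by (intro continuous_on_compose2[OF AAP_continuous[OF assms, of UNIV]] continuous_intros) auto
  ultimately show ?thesis by (intro AAPI[OF _ AP_shift[OF g(1)]])
qed

text \<open>
  Because an almost periodic function is bounded by its values near infinity, the almost periodic
  parts of a uniformly convergent sequence are again uniformly Cauchy, so they converge as well.
\<close>

lemma AAP_uniform_approx:
  fixes f :: "real \<Rightarrow> 'a::banach"
  assumes approx: "\<And>e. e > 0 \<Longrightarrow> \<exists>h\<in>AAP. \<forall>t. norm (f t - h t) \<le> e"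
  shows "f \<in> AAP"
proof -
  define r where "r n = inverse (real (Suc n))" for n
  have r1: "r n > 0" for n by (simp add: r_def)
  have r2: "r \<longlonglongrightarrow> 0" unfolding r_def by (rule LIMSEQ_inverse_real_of_nat)
  have "\<forall>n. \<exists>h. h \<in> AAP \<and> (\<forall>t. norm (f t - h t) \<le> r n)"
    using approx[OF r1] by blast
  from choice[OF this] obtain h where h0: "\<forall>n. h n \<in> AAP \<and> (\<forall>t. norm (f t - h n t) \<le> r n)" ..
  then have h: "h n \<in> AAP" "norm (f t - h n t) \<le> r n" for n t by simp_all
  have "\<forall>n. \<exists>g. g \<in> AP \<and> ((\<lambda>t. h n t - g t) \<longlongrightarrow> 0) at_top"
    using h(1) unfolding AAP_iff by blast
  from choice[OF this] obtain g where "\<forall>n. g n \<in> AP \<and> ((\<lambda>t. h n t - g n t) \<longlongrightarrow> 0) at_top" ..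
  then have g: "g n \<in> AP" "((\<lambda>t. h n t - g n t) \<longlongrightarrow> 0) at_top" for n by simp_all
  have near: "eventually (\<lambda>t. norm (f t - g n t) \<le> r n + e) at_top" if "e > 0" for n e
    using tendstoD[OF g(2) that, of n]
  proof eventually_elim
    case (elim t)
    then have "norm (h n t - g n t) < e" by simp
    then show ?case
      using norm_triangle_ineq[of "f t - h n t" "h n t - g n t"] h(2)[of t n] by simp
  qed
  have gg: "norm (g n t - g m t) \<le> r n + r m" for n m t
  proof (rule field_le_epsilon)
    fix e :: real assume "e > 0"
    then have e2: "e / 2 > 0" by simp
    show "norm (g n t - g m t) \<le> r n + r m + e"
    proof (rule AP_bound_from_infinity[OF AP_diff[OF g(1) g(1)]])
      show "eventually (\<lambda>t. norm (g n t - g m t) \<le> r n + r m + e) at_top"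
        using near[OF e2, of n] near[OF e2, of m]
      proof eventually_elim
        case (elim t)
        then show ?case
          using norm_triangle_ineq4[of "f t - g m t" "f t - g n t"] by simp
      qed
    qed
  qed
  have "\<exists>G. \<forall>n t. norm (g n t - G t) \<le> r n" by (rule uniform_Cauchy_limit[OF gg r2])
  then obtain G where "\<forall>n t. norm (g n t - G t) \<le> r n" ..
  then have gG: "norm (g n t - G t) \<le> r n" for n t by simp
  have small: "\<exists>n. r n < e" if "e > 0" for e
    using order_tendstoD(2)[OF r2 that] eventually_happens'[OF sequentially_bot] by blast
  have "G \<in> AP"
  proof (rule AP_uniform_approx)
    fix e :: real assume "e > 0"
    then obtain n where "r n < e" using small by blast
    then have "norm (G t - g n t) \<le> e" for t using gG[of n t] by (simp add: norm_minus_commute)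
    then show "\<exists>g\<in>AP. \<forall>t. norm (G t - g t) \<le> e" using g(1) by blast
  qed
  moreover have "((\<lambda>t. f t - G t) \<longlongrightarrow> 0) at_top"
  proof (rule tendstoI)
    fix e :: real assume e: "e > 0"
    then obtain n where n: "r n < e / 3" using small[of "e / 3"] by auto
    have "e / 3 > 0" using e by simp
    from near[OF this, of n] show "eventually (\<lambda>t. dist (f t - G t) 0 < e) at_top"
    proof eventually_elim
      case (elim t)
      then show ?case
        using norm_triangle_ineq[of "f t - g n t" "g n t - G t"] gG[of n t] n by simp
    qed
  qed
  moreover have "continuous_on UNIV f"
    using approx AAP_continuous by (intro continuous_uniform_approx) blast
  ultimately show ?thesis by (intro AAPI[of f G])
qed

section \<open>Regular distributions\<close>

lemma scaleC_integrable_interval: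
  fixes f :: "real \<Rightarrow> 'x::complex_banach"
  assumes "continuous_on {a..b} f" "continuous_on {a..b} \<phi>"
  shows "(\<lambda>t. \<phi> t *\<^sub>C f t) integrable_on {a..b}"
  by (intro integrable_continuous_interval continuous_on_scaleC assms)

lemma
  fixes f :: "real \<Rightarrow> 'x::complex_banach"
  assumes f: "continuous_on UNIV f" "\<And>t. norm (f t) \<le> M"
    and \<phi>: "continuous_on UNIV \<phi>" "integrable lborel \<phi>"
  shows regular_integrable: "(\<lambda>t. \<phi> t *\<^sub>C f t) integrable_on UNIV"
    and regular_dist_bound: "norm (regular_dist f \<phi>) \<le> M * (LINT t|lborel. norm (\<phi> t))"
proof -
  have i: "integrable lborel (\<lambda>t. M * norm (\<phi> t))" using \<phi>(2) by simp
  have le: "norm (\<phi> t *\<^sub>C f t) \<le> M * norm (\<phi> t)" for t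
    unfolding norm_scaleC using mult_right_mono[OF f(2) norm_ge_zero, of t "\<phi> t"] by (simp add: mult.commute)
  show int: "(\<lambda>t. \<phi> t *\<^sub>C f t) integrable_on UNIV"
  proof (rule integrable_on_all_intervals_integrable_bound[OF _ le integrable_on_lborel[OF i]])
    fix a b :: real
    have "(\<lambda>t. \<phi> t *\<^sub>C f t) integrable_on {a..b}"
      by (intro scaleC_integrable_interval continuous_on_subset[OF f(1)] continuous_on_subset[OF \<phi>(1)]) simp_all
    then show "(\<lambda>t. if t \<in> UNIV then \<phi> t *\<^sub>C f t else 0) integrable_on cbox a b" by simp
  qed
  have "norm (regular_dist f \<phi>) \<le> integral UNIV (\<lambda>t. M * norm (\<phi> t))"
    unfolding regular_dist_def
    by (rule Henstock_Kurzweil_Integration.integral_norm_bound_integral[OF int integrable_on_lborel[OF i] le])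
  then show "norm (regular_dist f \<phi>) \<le> M * (LINT t|lborel. norm (\<phi> t))"
    unfolding integral_lborel[OF i] by simp
qed

lemma regular_dist_diff:
  fixes f g :: "real \<Rightarrow> 'x::complex_banach"
  assumes "continuous_on UNIV f" "\<And>t. norm (f t) \<le> M" "continuous_on UNIV g" "\<And>t. norm (g t) \<le> N"
    and "continuous_on UNIV \<phi>" "integrable lborel \<phi>"
  shows "regular_dist (\<lambda>t. f t - g t) \<phi> = regular_dist f \<phi> - regular_dist g \<phi>"
  unfolding regular_dist_def bounded_bilinear.diff_right[OF bounded_bilinear_scaleC]
  by (rule Henstock_Kurzweil_Integration.integral_diff[OF regular_integrable[OF assms(1,2,5,6)] regular_integrable[OF assms(3,4,5,6)]])

lemma scaleC_scaleR_left: "(r *\<^sub>R c) *\<^sub>C (x::'x::complex_banach) = r *\<^sub>R c *\<^sub>C x"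
  by (rule bounded_bilinear.scaleR_left[OF bounded_bilinear_scaleC])

lemma regular_dist_scaleR:
  "regular_dist f (\<lambda>t. r *\<^sub>R \<phi> t) = r *\<^sub>R regular_dist f \<phi>"
  by (simp add: regular_dist_def scaleC_scaleR_left)

lemma DL1_norm_dominates: "(LINT t|lborel. norm (nderiv j f t)) \<le> DL1_norm j f"
  unfolding DL1_norm_def by (rule member_le_sum[of j "{..j}" "\<lambda>j. LINT t|lborel. norm (nderiv j f t)"]) auto

lemma dist_deriv_regular_bd:
  fixes f :: "real \<Rightarrow> 'x::complex_banach"
  assumes f: "continuous_on UNIV f" "\<And>t. norm (f t) \<le> M"
  shows "dist_deriv j (regular_dist f) \<in> bounded_dists"
proof (rule bdI)
  have M: "M \<ge> 0" using order_trans[OF norm_ge_zero f(2)] .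
  note int = regular_integrable[OF f smooth_continuous_on[OF DL1_smooth] DL1_integrable]
  show "dist_deriv j (regular_dist f) (\<lambda>x. \<phi> x + \<psi> x) = dist_deriv j (regular_dist f) \<phi> + dist_deriv j (regular_dist f) \<psi>"
    if "\<phi> \<in> DL1" "\<psi> \<in> DL1" for \<phi> \<psi>
    using Henstock_Kurzweil_Integration.integral_add[OF int[OF that(1) that(1)] int[OF that(2) that(2)], of j j]
    unfolding dist_deriv_def regular_dist_def nderiv_add[OF DL1_smooth[OF that(1)] DL1_smooth[OF that(2)]]
    by (simp add: scaleC_add_left scaleR_add_right)
  show "dist_deriv j (regular_dist f) (\<lambda>x. c * \<phi> x) = c *\<^sub>C dist_deriv j (regular_dist f) \<phi>" if "\<phi> \<in> DL1" for \<phi> c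
  proof -
    have "integral UNIV (\<lambda>t. c *\<^sub>C (nderiv j \<phi> t *\<^sub>C f t)) = c *\<^sub>C integral UNIV (\<lambda>t. nderiv j \<phi> t *\<^sub>C f t)"
      using integral_linear[OF int[OF that that, of j] bounded_bilinear.bounded_linear_right[OF bounded_bilinear_scaleC, of c]]
      by (simp add: o_def)
    then show ?thesis
      unfolding dist_deriv_def regular_dist_def nderiv_cmult[OF DL1_smooth[OF that]]
      by (simp add: scaleC_scaleC bounded_bilinear.scaleR_right[OF bounded_bilinear_scaleC])
  qed
  show "norm (dist_deriv j (regular_dist f) \<phi>) \<le> M * DL1_norm j \<phi>" if "\<phi> \<in> DL1" for \<phi>
  proof -
    have "norm (dist_deriv j (regular_dist f) \<phi>) = norm (regular_dist f (nderiv j \<phi>))"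
      by (simp add: dist_deriv_def)
    also have "\<dots> \<le> M * (LINT t|lborel. norm (nderiv j \<phi> t))"
      by (rule regular_dist_bound[OF f smooth_continuous_on[OF DL1_smooth[OF that]] DL1_integrable[OF that]])
    also have "\<dots> \<le> M * DL1_norm j \<phi>" by (intro mult_left_mono DL1_norm_dominates M)
    finally show ?thesis .
  qed
qed

lemma bd_plus:
  fixes S T :: "'x::complex_banach dist"
  assumes S: "S \<in> bounded_dists" and T: "T \<in> bounded_dists"
  shows "(\<lambda>\<phi>. S \<phi> + T \<phi>) \<in> bounded_dists"
proof -
  obtain k C where C: "C \<ge> 0" "\<forall>f\<in>DL1. norm (S f) \<le> C * DL1_norm k f" using bd_bound[OF S] by blast
  obtain l D where D: "D \<ge> 0" "\<forall>f\<in>DL1. norm (T f) \<le> D * DL1_norm l f" using bd_bound[OF T] by blast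
  show ?thesis
  proof (rule bdI)
    show "norm (S f + T f) \<le> (C + D) * DL1_norm (max k l) f" if "f \<in> DL1" for f
    proof -
      have "norm (S f) \<le> C * DL1_norm (max k l) f"
        using bspec[OF C(2) that] mult_left_mono[OF DL1_norm_mono C(1), of k "max k l" f] by simp
      moreover have "norm (T f) \<le> D * DL1_norm (max k l) f"
        using bspec[OF D(2) that] mult_left_mono[OF DL1_norm_mono D(1), of l "max k l" f] by simp
      ultimately show ?thesis using norm_triangle_ineq[of "S f" "T f"] by (simp add: distrib_right)
    qed
  qed (simp_all add: bd_add[OF S] bd_add[OF T] bd_cmult[OF S] bd_cmult[OF T] scaleC_add_right)
qed

lemma bd_sum:
  fixes S :: "nat \<Rightarrow> 'x::complex_banach dist"
  assumes "\<And>j. j \<le> k \<Longrightarrow> S j \<in> bounded_dists"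
  shows "(\<lambda>\<phi>. \<Sum>j\<le>k. S j \<phi>) \<in> bounded_dists"
  using assms
proof (induction k)
  case (Suc k)
  have "(\<lambda>\<phi>. (\<Sum>j\<le>k. S j \<phi>) + S (Suc k) \<phi>) \<in> bounded_dists" by (intro bd_plus Suc.IH Suc.prems) simp_all
  then show ?case by simp
qed simp

lemma bd_minus:
  fixes T :: "'x::complex_banach dist"
  assumes T: "T \<in> bounded_dists" shows "(\<lambda>\<phi>. - T \<phi>) \<in> bounded_dists"
proof -
  obtain k C where C: "C \<ge> 0" "\<forall>f\<in>DL1. norm (T f) \<le> C * DL1_norm k f" using bd_bound[OF T] by blast
  show ?thesis
  proof (rule bdI)
    show "norm (- T f) \<le> C * DL1_norm k f" if "f \<in> DL1" for f using bspec[OF C(2) that] by simp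
  qed (simp_all add: bd_add[OF T] bd_cmult[OF T] bounded_bilinear.minus_right[OF bounded_bilinear_scaleC])
qed

section \<open>Convolution of a function with a test function\<close>

text \<open>
  The convolution \<open>\<phi> * f\<close>, provided that \<open>\<phi>\<close> vanishes outside \<open>[-R, R]\<close>. The fixed compact interval is what
  allows \<open>f\<close> to be unbounded towards \<open>-\<infinity>\<close>.
\<close>

definition local_conv :: "real \<Rightarrow> (real \<Rightarrow> complex) \<Rightarrow> (real \<Rightarrow> 'x::complex_banach) \<Rightarrow> real \<Rightarrow> 'x"
  where "local_conv R \<phi> f x = integral {-R..R} (\<lambda>s. \<phi> s *\<^sub>C f (x - s))"

lemma local_conv_integrable:
  fixes f :: "real \<Rightarrow> 'x::complex_banach"
  assumes "continuous_on UNIV f" "continuous_on UNIV \<phi>"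
  shows "(\<lambda>s. \<phi> s *\<^sub>C f (x - s)) integrable_on {-R..R}"
  by (intro scaleC_integrable_interval continuous_on_subset[OF assms(2)] continuous_on_compose2[OF assms(1)] continuous_intros) auto

lemma regular_dist_reflect_shift:
  fixes f :: "real \<Rightarrow> 'x::complex_banach"
  assumes f: "continuous_on UNIV f" and \<phi>: "continuous_on UNIV \<phi>" and supp: "\<And>s. \<bar>s\<bar> \<ge> R \<Longrightarrow> \<phi> s = 0"
  shows "regular_dist f (\<lambda>t. \<phi> (x - t)) = local_conv R \<phi> f x"
proof -
  have "((\<lambda>s. \<phi> s *\<^sub>C f (x - s)) has_integral local_conv R \<phi> f x) (cbox (-R) R)"
    using integrable_integral[OF local_conv_integrable[OF f \<phi>, of x R]] by (simp add: local_conv_def)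
  from has_integral_affinity[OF this, of "-1" x]
  have 1: "((\<lambda>t. \<phi> (x - t) *\<^sub>C f t) has_integral local_conv R \<phi> f x) ((\<lambda>t. x - t) ` {-R..R})"
    by simp
  have "((\<lambda>t. \<phi> (x - t) *\<^sub>C f t) has_integral local_conv R \<phi> f x) UNIV"
  proof (rule has_integral_on_superset[OF 1])
    fix t assume t: "t \<notin> (\<lambda>t. x - t) ` {-R..R}"
    have "\<bar>x - t\<bar> \<ge> R"
    proof (rule ccontr)
      assume "\<not> \<bar>x - t\<bar> \<ge> R"
      then have "x - t \<in> {-R..R}" by auto
      then have "x - (x - t) \<in> (\<lambda>t. x - t) ` {-R..R}" by (rule imageI)
      then show False using t by simp
    qed
    then show "\<phi> (x - t) *\<^sub>C f t = 0" by (simp add: supp bounded_bilinear.zero_left[OF bounded_bilinear_scaleC])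
  qed simp
  then show ?thesis unfolding regular_dist_def by (rule integral_unique)
qed

lemma local_conv_continuous:
  fixes f :: "real \<Rightarrow> 'x::complex_banach"
  assumes "continuous_on UNIV f" "continuous_on UNIV \<phi>"
  shows "continuous_on UNIV (local_conv R \<phi> f)"
proof -
  have "continuous_on UNIV (\<lambda>x. integral (cbox (-R) R) (\<lambda>s. \<phi> s *\<^sub>C f (x - s)))"
  proof (rule integral_continuous_on_param)
    show "continuous_on (UNIV \<times> cbox (-R) R) (\<lambda>(x, s). \<phi> s *\<^sub>C f (x - s))"
      unfolding case_prod_beta
      by (intro continuous_on_scaleC continuous_on_compose2[OF assms(1)] continuous_on_compose2[OF assms(2)] continuous_intros) auto
  qed
  then show ?thesis by (simp add: local_conv_def[abs_def])
qed

lemma local_conv_bound: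
  fixes f :: "real \<Rightarrow> 'x::complex_banach"
  assumes f: "continuous_on UNIV f" and \<phi>: "continuous_on UNIV \<phi>" and R: "R \<ge> 0"
    and W: "\<And>s. s \<in> {-R..R} \<Longrightarrow> norm (\<phi> s) \<le> W" and M: "\<And>s. s \<in> {-R..R} \<Longrightarrow> norm (f (x - s)) \<le> M"
  shows "norm (local_conv R \<phi> f x) \<le> W * M * (2 * R)"
proof -
  have "norm (local_conv R \<phi> f x) \<le> W * M * (R - (- R))"
    unfolding local_conv_def
  proof (rule integral_bound)
    show "continuous_on {-R..R} (\<lambda>s. \<phi> s *\<^sub>C f (x - s))"
      by (intro continuous_on_scaleC continuous_on_subset[OF \<phi>] continuous_on_compose2[OF f] continuous_intros) auto
    show "norm (\<phi> s *\<^sub>C f (x - s)) \<le> W * M" if "s \<in> {-R..R}" for s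
      unfolding norm_scaleC using W[OF that] M[OF that] order_trans[OF norm_ge_zero W[OF that]]
      by (intro mult_mono) simp_all
  qed (use R in simp)
  then show ?thesis by simp
qed

lemma local_conv_diff:
  fixes f g :: "real \<Rightarrow> 'x::complex_banach"
  assumes "continuous_on UNIV f" "continuous_on UNIV g" "continuous_on UNIV \<phi>"
  shows "local_conv R \<phi> (\<lambda>t. f t - g t) x = local_conv R \<phi> f x - local_conv R \<phi> g x"
  unfolding local_conv_def bounded_bilinear.diff_right[OF bounded_bilinear_scaleC]
  by (rule Henstock_Kurzweil_Integration.integral_diff[OF local_conv_integrable[OF assms(1,3)] local_conv_integrable[OF assms(2,3)]])

lemma local_conv_AP:
  fixes g :: "real \<Rightarrow> 'x::complex_banach"
  assumes g: "g \<in> AP" and \<phi>: "continuous_on UNIV \<phi>" and R: "R \<ge> 0"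
  shows "local_conv R \<phi> g \<in> AP"
proof -
  have gc: "continuous_on UNIV g" by (rule AP_continuous[OF g])
  obtain W where W: "W \<ge> 0" "\<And>s. s \<in> {-R..R} \<Longrightarrow> norm (\<phi> s) \<le> W"
    using continuous_bound[OF continuous_on_subset[OF \<phi>, of "{-R..R}"]] by auto
  have "relatively_dense (eps_periods e (local_conv R \<phi> g))" if e: "e > 0" for e
  proof (rule relatively_dense_mono)
    define d where "d = e / (W * (2 * R) + 1)"
    have D: "W * (2 * R) + 1 > 0" using W(1) R by (simp add: add_nonneg_pos)
    have d: "d > 0" using e D by (simp add: d_def)
    show "relatively_dense (eps_periods d g)" using g d by (simp add: AP_def)
    show "eps_periods d g \<subseteq> eps_periods e (local_conv R \<phi> g)"
    proof
      fix \<tau> assume "\<tau> \<in> eps_periods d g"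
      then have p: "norm (g (t + \<tau>) - g t) \<le> d" for t by (simp add: eps_periods_def)
      have gs: "continuous_on UNIV (\<lambda>t. g (t + \<tau>))"
        by (intro continuous_on_compose2[OF gc] continuous_intros) auto
      have "norm (local_conv R \<phi> g (x + \<tau>) - local_conv R \<phi> g x) \<le> e" for x
      proof -
        have "local_conv R \<phi> g (x + \<tau>) = local_conv R \<phi> (\<lambda>t. g (t + \<tau>)) x"
          by (simp add: local_conv_def algebra_simps)
        then have "norm (local_conv R \<phi> g (x + \<tau>) - local_conv R \<phi> g x) = norm (local_conv R \<phi> (\<lambda>t. g (t + \<tau>) - g t) x)"
          using local_conv_diff[OF gs gc \<phi>] by simp
        also have "\<dots> \<le> W * d * (2 * R)"
          by (rule local_conv_bound[OF continuous_on_diff[OF gs gc] \<phi> R W(2) p])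
        also have "\<dots> \<le> (W * (2 * R) + 1) * d" using d by (simp add: algebra_simps)
        also have "\<dots> = e" using D by (simp add: d_def)
        finally show ?thesis .
      qed
      then show "\<tau> \<in> eps_periods e (local_conv R \<phi> g)" by (simp add: eps_periods_def)
    qed
  qed
  then show ?thesis using local_conv_continuous[OF gc \<phi>] by (simp add: AP_def)
qed

lemma local_conv_vanishes:
  fixes p :: "real \<Rightarrow> 'x::complex_banach"
  assumes p: "continuous_on UNIV p" "(p \<longlongrightarrow> 0) at_top" and \<phi>: "continuous_on UNIV \<phi>" and R: "R \<ge> 0"
  shows "(local_conv R \<phi> p \<longlongrightarrow> 0) at_top"
proof (rule tendstoI)
  fix e :: real assume e: "e > 0"
  obtain W where W: "W \<ge> 0" "\<And>s. s \<in> {-R..R} \<Longrightarrow> norm (\<phi> s) \<le> W"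
    using continuous_bound[OF continuous_on_subset[OF \<phi>, of "{-R..R}"]] by auto
  define d where "d = e / (W * (2 * R) + 1)"
  have D: "W * (2 * R) + 1 > 0" using W(1) R by (simp add: add_nonneg_pos)
  have d: "d > 0" using e D by (simp add: d_def)
  from tendstoD[OF p(2) d] obtain N where N: "\<And>t. t \<ge> N \<Longrightarrow> norm (p t) \<le> d"
    unfolding eventually_at_top_linorder by (auto intro: less_imp_le)
  have "norm (local_conv R \<phi> p x) < e" if "x \<ge> N + R" for x
  proof -
    have near: "norm (p (x - s)) \<le> d" if "s \<in> {-R..R}" for s using \<open>x \<ge> N + R\<close> that by (intro N) auto
    have "norm (local_conv R \<phi> p x) \<le> W * d * (2 * R)" by (rule local_conv_bound[OF p(1) \<phi> R W(2) near])
    also have "\<dots> < (W * (2 * R) + 1) * d" using d by (simp add: algebra_simps)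
    also have "\<dots> = e" using D by (simp add: d_def)
    finally show ?thesis .
  qed
  then show "eventually (\<lambda>x. dist (local_conv R \<phi> p x) 0 < e) at_top"
    unfolding eventually_at_top_linorder by (intro exI[of _ "N + R"]) simp
qed

text \<open>
  The sign in the definition of the distributional derivative cancels against the sign that comes from
  differentiating a reflected function.
\<close>

lemma dist_conv_regular:
  fixes f :: "real \<Rightarrow> 'x::complex_banach"
  assumes f: "continuous_on UNIV f" and \<phi>: "\<phi> \<in> \<D>" and R: "\<forall>j x. \<bar>x\<bar> \<ge> R \<longrightarrow> nderiv j \<phi> x = 0"
  shows "dist_conv (dist_deriv j (regular_dist f)) \<phi> = local_conv R (nderiv j \<phi>) f"
proof
  fix x
  have "dist_conv (dist_deriv j (regular_dist f)) \<phi> x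
      = (-1) ^ j *\<^sub>R regular_dist f (\<lambda>t. (-1) ^ j *\<^sub>R nderiv j \<phi> (x - t))"
    by (simp only: dist_conv_def dist_deriv_def nderiv_reflect_shift[OF test_smooth[OF \<phi>]])
  also have "\<dots> = regular_dist f (\<lambda>t. nderiv j \<phi> (x - t))"
    by (simp add: regular_dist_scaleR power_mult_distrib[symmetric])
  also have "\<dots> = local_conv R (nderiv j \<phi>) f x"
    using R by (intro regular_dist_reflect_shift[OF f smooth_continuous_on[OF test_smooth[OF \<phi>]]]) simp
  finally show "dist_conv (dist_deriv j (regular_dist f)) \<phi> x = local_conv R (nderiv j \<phi>) f x" .
qed

lemma dist_conv_regular_continuous:
  fixes f :: "real \<Rightarrow> 'x::complex_banach"
  assumes f: "continuous_on UNIV f" and \<phi>: "\<phi> \<in> \<D>"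
  shows "continuous_on UNIV (dist_conv (dist_deriv j (regular_dist f)) \<phi>)"
proof -
  obtain R where R: "R > 0" "\<forall>j x. \<bar>x\<bar> \<ge> R \<longrightarrow> nderiv j \<phi> x = 0" using test_support[OF \<phi>] by metis
  show ?thesis
    unfolding dist_conv_regular[OF f \<phi> R(2)]
    by (rule local_conv_continuous[OF f smooth_continuous_on[OF test_smooth[OF \<phi>]]])
qed

lemma dist_conv_regular_AP:
  fixes f :: "real \<Rightarrow> 'x::complex_banach"
  assumes f: "f \<in> AP" and \<phi>: "\<phi> \<in> \<D>"
  shows "dist_conv (dist_deriv j (regular_dist f)) \<phi> \<in> AP"
proof -
  obtain R where R: "R > 0" "\<forall>j x. \<bar>x\<bar> \<ge> R \<longrightarrow> nderiv j \<phi> x = 0" using test_support[OF \<phi>] by metis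
  show ?thesis
    unfolding dist_conv_regular[OF AP_continuous[OF f] \<phi> R(2)]
    using R(1) by (intro local_conv_AP[OF f smooth_continuous_on[OF test_smooth[OF \<phi>]]]) simp
qed

lemma dist_conv_regular_near:
  fixes f g :: "real \<Rightarrow> 'x::complex_banach"
  assumes f: "continuous_on UNIV f" and g: "continuous_on UNIV g" and lim: "((\<lambda>t. f t - g t) \<longlongrightarrow> 0) at_top"
    and \<phi>: "\<phi> \<in> \<D>"
  shows "((\<lambda>x. dist_conv (dist_deriv j (regular_dist f)) \<phi> x - dist_conv (dist_deriv j (regular_dist g)) \<phi> x) \<longlongrightarrow> 0) at_top"
proof -
  obtain R where R: "R > 0" "\<forall>j x. \<bar>x\<bar> \<ge> R \<longrightarrow> nderiv j \<phi> x = 0" using test_support[OF \<phi>] by metis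
  note c = smooth_continuous_on[OF test_smooth[OF \<phi>]]
  show ?thesis
    unfolding dist_conv_regular[OF f \<phi> R(2)] dist_conv_regular[OF g \<phi> R(2)] local_conv_diff[OF f g c, symmetric]
    using R(1) by (intro local_conv_vanishes[OF continuous_on_diff[OF f g] lim c]) simp
qed

lemma dist_conv_regular_AAP:
  fixes f :: "real \<Rightarrow> 'x::complex_banach"
  assumes f: "f \<in> AAP" and \<phi>: "\<phi> \<in> \<D>"
  shows "dist_conv (dist_deriv j (regular_dist f)) \<phi> \<in> AAP"
proof -
  obtain g where g: "g \<in> AP" "((\<lambda>t. f t - g t) \<longlongrightarrow> 0) at_top" using f unfolding AAP_iff by blast
  have fc: "continuous_on UNIV f" by (rule AAP_continuous[OF f])
  show ?thesis
    by (rule AAPI[OF dist_conv_regular_continuous[OF fc \<phi>] dist_conv_regular_AP[OF g(1) \<phi>]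
          dist_conv_regular_near[OF fc AP_continuous[OF g(1)] g(2) \<phi>]])
qed

section \<open>A smooth step\<close>

text \<open>
  The functions \<open>p w^m exp (-w)\<close> with \<open>w = 1 / (x (1 - x))\<close> and \<open>p\<close> a polynomial, extended by 0. The family is
  closed under differentiation, and \<open>p = 1\<close>, \<open>m = 0\<close> is the classical bump function, so smoothness of the
  latter needs no separate treatment of higher derivatives.
\<close>

definition bump :: "real poly \<Rightarrow> nat \<Rightarrow> real \<Rightarrow> real" where
  "bump p m x = (if 0 < x \<and> x < 1
     then poly p x * (1 / (x * (1 - x))) ^ m * exp (- (1 / (x * (1 - x)))) else 0)"

lemma power_le_exp: "w ^ n \<le> real n ^ n * exp w" if "w \<ge> 0" for w :: real
proof (cases "n = 0")
  case True then show ?thesis using that by simp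
next
  case False
  have "(w / n) ^ n \<le> (1 + w / n) ^ n" using that by (intro power_mono) auto
  also have "\<dots> \<le> exp w" using False that by (intro exp_ge_one_plus_x_over_n_power_n) auto
  finally have "w ^ n / real n ^ n \<le> exp w" by (simp add: power_divide)
  then show ?thesis using False by (simp add: field_simps)
qed

text \<open>
  The exponential factor beats every power of \<open>1 / (x (1 - x))\<close>, so it can also supply the additional
  factor \<open>(x (1 - x))\<^sup>2\<close>. Quadratic decay at both ends makes the extension by 0 differentiable
  there, with derivative 0.
\<close>

lemma bump_bound: "\<exists>C\<ge>0. \<forall>x. \<bar>bump p m x\<bar> \<le> C * x\<^sup>2 \<and> \<bar>bump p m x\<bar> \<le> C * (x - 1)\<^sup>2"
proof -
  have "continuous_on {0..1} (poly p)" by (intro continuous_intros)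
  then obtain K where K: "K \<ge> 0" "\<And>x. x \<in> {0..1} \<Longrightarrow> norm (poly p x) \<le> K"
    using continuous_bound by blast
  define C where "C = K * real (m + 2) ^ (m + 2)"
  have C: "C \<ge> 0" using K(1) by (simp add: C_def)
  have b: "\<bar>bump p m x\<bar> \<le> C * (x * (1 - x))\<^sup>2" if x: "0 < x" "x < 1" for x
  proof -
    define v where "v = x * (1 - x)"
    have v: "v > 0" using x by (simp add: v_def)
    have "(1 / v) ^ m * exp (- (1 / v)) = v\<^sup>2 * ((1 / v) ^ (m + 2) * exp (- (1 / v)))"
      using v by (simp add: power_add power2_eq_square)
    also have "\<dots> \<le> v\<^sup>2 * real (m + 2) ^ (m + 2)"
    proof (intro mult_left_mono)
      have "(1 / v) ^ (m + 2) * exp (- (1 / v)) \<le> (real (m + 2) ^ (m + 2) * exp (1 / v)) * exp (- (1 / v))"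
        using v by (intro mult_right_mono power_le_exp) auto
      also have "\<dots> = real (m + 2) ^ (m + 2)" by (simp add: exp_minus mult.assoc)
      finally show "(1 / v) ^ (m + 2) * exp (- (1 / v)) \<le> real (m + 2) ^ (m + 2)" .
    qed simp
    finally have dec: "(1 / v) ^ m * exp (- (1 / v)) \<le> v\<^sup>2 * real (m + 2) ^ (m + 2)" .
    have "\<bar>poly p x\<bar> \<le> K" using K(2)[of x] x by simp
    from mult_mono[OF this dec K(1)]
    have "\<bar>poly p x\<bar> * ((1 / v) ^ m * exp (- (1 / v))) \<le> K * (v\<^sup>2 * real (m + 2) ^ (m + 2))"
      using v by simp
    moreover have "\<bar>bump p m x\<bar> = \<bar>poly p x\<bar> * ((1 / v) ^ m * exp (- (1 / v)))"
      using x v by (simp add: bump_def v_def[symmetric] abs_mult)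
    ultimately show ?thesis by (simp add: C_def v_def mult_ac)
  qed
  have "\<bar>bump p m x\<bar> \<le> C * x\<^sup>2 \<and> \<bar>bump p m x\<bar> \<le> C * (x - 1)\<^sup>2" for x
  proof (cases "0 < x \<and> x < 1")
    case True
    have "(x * (1 - x))\<^sup>2 \<le> x\<^sup>2" using True by (intro power_mono) (auto intro: mult_left_le)
    moreover have "(x * (1 - x))\<^sup>2 \<le> (1 - x)\<^sup>2" using True by (intro power_mono) (auto intro: mult_left_le_one_le)
    ultimately have "C * (x * (1 - x))\<^sup>2 \<le> C * x\<^sup>2" "C * (x * (1 - x))\<^sup>2 \<le> C * (x - 1)\<^sup>2"
      using C by (auto intro: mult_left_mono simp: power2_commute[of x 1])
    then show ?thesis using b[of x] True by linarith
  next
    case False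
    then have "bump p m x = 0" unfolding bump_def by (rule if_not_P)
    then show ?thesis using C by simp
  qed
  then show ?thesis using C by blast
qed

lemma flat_has_derivative_0:
  fixes f :: "real \<Rightarrow> real"
  assumes "f a = 0" "\<And>x. \<bar>f x\<bar> \<le> C * (x - a)\<^sup>2" "C \<ge> 0"
  shows "(f has_vector_derivative 0) (at a)"
  unfolding has_vector_derivative_def has_derivative_at_alt
proof (intro conjI allI impI)
  fix e :: real assume e: "e > 0"
  have "norm (f y - f a - (y - a) *\<^sub>R 0) \<le> e * norm (y - a)" if "norm (y - a) < e / (C + 1)" for y
  proof -
    have "\<bar>f y\<bar> \<le> C * \<bar>y - a\<bar> * \<bar>y - a\<bar>" using assms(2)[of y] by (simp add: power2_eq_square mult.assoc)
    also have "\<dots> \<le> e * \<bar>y - a\<bar>"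
    proof (rule mult_right_mono)
      have "C * \<bar>y - a\<bar> \<le> (C + 1) * \<bar>y - a\<bar>" by (simp add: algebra_simps)
      also have "\<dots> \<le> e" using that assms(3) by (simp add: field_simps)
      finally show "C * \<bar>y - a\<bar> \<le> e" .
    qed simp
    finally show ?thesis using assms(1) by simp
  qed
  then show "\<exists>d>0. \<forall>y. norm (y - a) < d \<longrightarrow> norm (f y - f a - (y - a) *\<^sub>R 0) \<le> e * norm (y - a)"
    using e assms(3) by (intro exI[of _ "e / (C + 1)"]) simp
qed simp

text \<open>
  Inside the interval this is the product rule with \<open>w' = -(1 - 2 x) w\<^sup>2\<close>; writing all three terms over the
  common power \<open>w^(m + 2)\<close> gives the new polynomial.
\<close>

lemma bump_derivative:
  "\<exists>q. \<forall>x. (bump p m has_vector_derivative bump q (m + 2) x) (at x)"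
proof -
  define V :: "real poly" where "V = [:0, 1, -1:]"
  define D :: "real poly" where "D = [:1, -2:]"
  define q where "q = pderiv p * V\<^sup>2 - of_nat m * D * p * V + D * p"
  have "(bump p m has_vector_derivative bump q (m + 2) x) (at x)" for x
  proof -
    obtain C where C: "C \<ge> 0" "\<And>x. \<bar>bump p m x\<bar> \<le> C * x\<^sup>2" "\<And>x. \<bar>bump p m x\<bar> \<le> C * (x - 1)\<^sup>2"
      using bump_bound[of p m] by blast
    consider "x < 0" | "x = 0" | "0 < x \<and> x < 1" | "x = 1" | "x > 1" by linarith
    then show ?thesis
    proof cases
      case 1
      show ?thesis
        by (rule has_vector_derivative_transform_within_open[of "\<lambda>_. 0" _ _ "{..<0}"])
          (use 1 in \<open>auto simp: bump_def\<close>)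
    next
      case 2
      have "(bump p m has_vector_derivative 0) (at 0)"
        by (rule flat_has_derivative_0[of _ _ C]) (use C in \<open>simp_all add: bump_def\<close>)
      then show ?thesis using 2 by (simp add: bump_def)
    next
      case 4
      have "(bump p m has_vector_derivative 0) (at 1)"
        by (rule flat_has_derivative_0[of _ _ C]) (use C in \<open>simp_all add: bump_def\<close>)
      then show ?thesis using 4 by (simp add: bump_def)
    next
      case 5
      show ?thesis
        by (rule has_vector_derivative_transform_within_open[of "\<lambda>_. 0" _ _ "{1<..}"])
          (use 5 in \<open>auto simp: bump_def\<close>)
    next
      case 3
      define v where "v = x * (1 - x)"
      have v: "v > 0" using 3 by (simp add: v_def)
      have w: "((\<lambda>x. 1 / (x * (1 - x))) has_real_derivative - ((1 - 2 * x) * (1 / v)\<^sup>2)) (at x)"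
      proof -
        have "((\<lambda>x. x * (1 - x)) has_real_derivative 1 - 2 * x) (at x)"
          by (auto intro!: derivative_eq_intros)
        from DERIV_inverse_fun[OF this] v show ?thesis
          by (simp add: v_def[symmetric] divide_inverse power2_eq_square power_inverse)
      qed
      have "((\<lambda>x. poly p x * (1 / (x * (1 - x))) ^ m * exp (- (1 / (x * (1 - x))))) has_real_derivative
          (poly (pderiv p) x * (1 / v) ^ m + poly p x * (of_nat m * (1 / v) ^ (m - 1) * - ((1 - 2 * x) * (1 / v)\<^sup>2)))
            * exp (- (1 / v))
          + poly p x * (1 / v) ^ m * (exp (- (1 / v)) * ((1 - 2 * x) * (1 / v)\<^sup>2))) (at x)"
        unfolding v_def
        by (rule derivative_eq_intros poly_DERIV w[unfolded v_def] refl | simp add: mult_ac)+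
      also have "(poly (pderiv p) x * (1 / v) ^ m + poly p x * (of_nat m * (1 / v) ^ (m - 1) * - ((1 - 2 * x) * (1 / v)\<^sup>2)))
            * exp (- (1 / v))
          + poly p x * (1 / v) ^ m * (exp (- (1 / v)) * ((1 - 2 * x) * (1 / v)\<^sup>2))
         = poly q x * (1 / v) ^ (m + 2) * exp (- (1 / v))"
      proof -
        have V: "poly V x = v" "poly D x = 1 - 2 * x" by (simp_all add: V_def D_def v_def algebra_simps)
        have 1: "(1 / v) ^ m = v\<^sup>2 * (1 / v) ^ (m + 2)" using v by (simp add: power_add power2_eq_square)
        have 2: "of_nat m * (1 / v) ^ (m - 1) * (1 / v)\<^sup>2 = of_nat m * v * (1 / v) ^ (m + 2)"
          using v by (cases m) (simp_all add: power_add power2_eq_square)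
        have "poly p x * (of_nat m * (1 / v) ^ (m - 1) * - ((1 - 2 * x) * (1 / v)\<^sup>2))
            = - (poly p x * (1 - 2 * x) * (of_nat m * (1 / v) ^ (m - 1) * (1 / v)\<^sup>2))" by (simp add: mult_ac)
        also have "\<dots> = - (poly p x * (1 - 2 * x) * (of_nat m * v * (1 / v) ^ (m + 2)))" unfolding 2 ..
        finally have 3: "poly p x * (of_nat m * (1 / v) ^ (m - 1) * - ((1 - 2 * x) * (1 / v)\<^sup>2))
            = - (poly p x * (1 - 2 * x) * (of_nat m * v * (1 / v) ^ (m + 2)))" .
        have 4: "poly p x * (1 / v) ^ m * (exp (- (1 / v)) * ((1 - 2 * x) * (1 / v)\<^sup>2))
           = poly p x * (1 - 2 * x) * (1 / v) ^ (m + 2) * exp (- (1 / v))"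
          unfolding power_add by (simp only: mult_ac)
        have q: "poly q x = poly (pderiv p) x * v\<^sup>2 - of_nat m * (1 - 2 * x) * poly p x * v + (1 - 2 * x) * poly p x"
          by (simp add: q_def V of_nat_poly)
        show ?thesis unfolding 3 4 q unfolding 1 by (simp add: algebra_simps)
      qed
      also have "\<dots> = bump q (m + 2) x" using 3 by (simp add: bump_def v_def)
      finally have "((\<lambda>x. poly p x * (1 / (x * (1 - x))) ^ m * exp (- (1 / (x * (1 - x)))))
          has_vector_derivative bump q (m + 2) x) (at x)"
        by (simp only: has_real_derivative_iff_has_vector_derivative)
      then show ?thesis
        by (rule has_vector_derivative_transform_within_open[of _ _ _ "{0<..<1}"])
          (use 3 in \<open>auto simp: bump_def\<close>)
    qed
  qed
  then show ?thesis by blast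
qed

lemma bump_smooth: "bump p m \<in> smooth_functions"
proof -
  define Q where "Q m p = (SOME q. \<forall>x. (bump p m has_vector_derivative bump q (m + 2) x) (at x))" for m p
  have Q: "(bump p m has_vector_derivative bump (Q m p) (m + 2) x) (at x)" for m p x
    unfolding Q_def using someI_ex[OF bump_derivative] by blast
  define P where "P = rec_nat p (\<lambda>j r. Q (m + 2 * j) r)"
  have "(bump (P j) (m + 2 * j) has_vector_derivative bump (P (Suc j)) (m + 2 * Suc j) x) (at x)" for j x
    using Q[where m="m + 2 * j" and p="P j"] by (simp add: P_def)
  from nderiv_chain_smooth[of "\<lambda>j. bump (P j) (m + 2 * j)", OF this] show ?thesis by (simp add: P_def)
qed

text \<open>
  The normalised primitive of the bump function.
\<close>

lemma smooth_step_exists: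
  "\<exists>\<sigma> :: real \<Rightarrow> complex. \<sigma> \<in> smooth_functions \<and> (\<forall>s\<le>0. \<sigma> s = 0) \<and> (\<forall>s\<ge>1. \<sigma> s = 1)
     \<and> (\<forall>s. norm (\<sigma> s) \<le> 1 \<and> norm (1 - \<sigma> s) \<le> 1)"
proof -
  define b where "b = bump 1 0"
  have bs: "b \<in> smooth_functions" unfolding b_def by (rule bump_smooth)
  have b0: "b x = 0" if "x \<le> 0 \<or> x \<ge> 1" for x using that by (auto simp: b_def bump_def)
  have bpos: "b x \<ge> 0" for x by (simp add: b_def bump_def)
  have bc: "continuous_on S b" for S by (rule smooth_continuous_on0[OF bs])
  have bi: "b integrable_on {x..y}" for x y by (rule integrable_continuous_interval[OF bc])
  define I where "I x = integral {-1..x} b" for x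
  have I0: "I x = 0" if "x \<le> 0" for x
    unfolding I_def by (rule integral_unique, rule has_integral_is_0) (use that in \<open>auto intro: b0\<close>)
  define c where "c = I 1"
  have I1: "I x = c" if "x \<ge> 1" for x
  proof -
    have "integral {1..x} b = 0" by (rule integral_unique, rule has_integral_is_0) (auto intro: b0)
    then show ?thesis
      using Henstock_Kurzweil_Integration.integral_combine[of "-1" 1 x b] bi that by (simp add: I_def c_def)
  qed
  have Inn: "I x \<ge> 0" for x unfolding I_def by (rule integral_nonneg[OF bi bpos])
  have Ile: "I x \<le> c" for x
  proof (cases "x \<le> 1")
    case True then show ?thesis unfolding c_def I_def by (intro integral_subset_le bi) (auto intro: bpos)
  qed (simp add: I1)
  have c: "c > 0"
  proof (rule ccontr)
    assume "\<not> c > 0"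
    then have "c = 0" using Inn[of 1] by (simp add: c_def)
    then have "(b has_integral 0) (cbox (-1) 1)" using integrable_integral[OF bi, of "-1" 1] by (simp add: c_def I_def)
    then have "b (1 / 2) = 0" by (intro has_integral_0_cbox_imp_0[of "-1" 1 b]) (auto intro: bc bpos)
    then show False by (simp add: b_def bump_def)
  qed
  have dI: "(I has_vector_derivative b x) (at x)" for x
  proof (cases "x < 0")
    case True
    have "(I has_vector_derivative 0) (at x)"
      by (rule has_vector_derivative_transform_within_open[of "\<lambda>_. 0" _ _ "{..<0}"]) (use True I0 in auto)
    then show ?thesis using True b0 by simp
  next
    case False
    have "(I has_vector_derivative b x) (at x within {-1..x + 1})"
      unfolding I_def by (rule integral_has_vector_derivative[OF bc]) (use False in simp)
    then show ?thesis using at_within_interior[of x "{-1..x + 1}"] False by simp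
  qed
  define F where "F = rec_nat I (\<lambda>j _. nderiv j b)"
  have "(F j has_vector_derivative F (Suc j) x) (at x)" for j x
    using dI smooth_has_vector_derivative[OF bs] by (cases j) (simp_all add: F_def)
  from nderiv_chain_smooth[of F, OF this] have "I \<in> smooth_functions" by (simp add: F_def)
  from smooth_linear[OF this bounded_linear_compose[OF bounded_linear_of_real bounded_linear_divide]]
  have "(\<lambda>x. complex_of_real (I x / c)) \<in> smooth_functions" .
  moreover have "norm (complex_of_real (I x / c)) \<le> 1 \<and> norm (1 - complex_of_real (I x / c)) \<le> 1" for x
  proof -
    have "0 \<le> I x / c" "I x / c \<le> 1" using Inn[of x] Ile[of x] c by simp_all
    moreover have "1 - complex_of_real (I x / c) = complex_of_real (1 - I x / c)" by simp
    ultimately show ?thesis by (simp only: norm_of_real) simp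
  qed
  ultimately show ?thesis
    using I0 I1 c by (intro exI[of _ "\<lambda>x. complex_of_real (I x / c)"]) simp
qed

section \<open>A parametrix for the derivative\<close>

definition step :: "real \<Rightarrow> complex" where
  "step = (SOME \<sigma>. \<sigma> \<in> smooth_functions \<and> (\<forall>s\<le>0. \<sigma> s = 0) \<and> (\<forall>s\<ge>1. \<sigma> s = 1)
     \<and> (\<forall>s. norm (\<sigma> s) \<le> 1 \<and> norm (1 - \<sigma> s) \<le> 1))"

abbreviation pulse :: "real \<Rightarrow> complex" where "pulse \<equiv> nderiv 1 step"

lemma
  shows step_smooth: "step \<in> smooth_functions"
    and step_0: "s \<le> 0 \<Longrightarrow> step s = 0"
    and step_1: "s \<ge> 1 \<Longrightarrow> step s = 1"
    and step_norm: "norm (step s) \<le> 1" "norm (1 - step s) \<le> 1"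
  using someI_ex[OF smooth_step_exists, folded step_def] by simp_all

lemma pulse_outside:
  assumes "s < 0 \<or> s > 1" shows "pulse s = 0"
  using assms
proof
  assume s: "s < 0"
  show ?thesis by (rule nderiv_eq_0[of "{..<0}"]) (use s in \<open>simp_all add: step_0\<close>)
next
  assume s: "s > 1"
  have "(step has_vector_derivative 0) (at s)"
    by (rule has_vector_derivative_transform_within_open[of "\<lambda>_. 1" _ _ "{1<..}"])
      (use s in \<open>simp_all add: step_1\<close>)
  then show ?thesis by (simp add: nderiv_Suc vector_derivative_at)
qed

lemma pulse_test: "pulse \<in> \<D>"
proof (rule testI[of _ 1])
  show "pulse \<in> smooth_functions" by (rule smooth_nderiv[OF step_smooth])
  show "pulse x = 0" if "1 < \<bar>x\<bar>" for x using that by (intro pulse_outside) auto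
qed

lemma continuous_on_step: "continuous_on S step"
  by (rule smooth_continuous_on0[OF step_smooth])

lemma continuous_on_step_tail: "continuous_on S (\<lambda>s. 1 - step s)"
  by (intro continuous_on_diff continuous_on_const continuous_on_step)

lemma continuous_on_pulse: "continuous_on S pulse"
  by (rule smooth_continuous_on[OF step_smooth])

text \<open>
  Integration by parts against \<open>1 - step\<close>, which falls from 1 to 0. For \<open>c = 1\<close> it says that \<open>1 - step\<close>, cut
  off at 0, is a fundamental solution of the derivative up to the smooth kernel \<open>pulse\<close>; for small \<open>c\<close> it
  says that the mollification of \<open>f\<close> at scale \<open>c\<close> differs from \<open>f\<close> by \<open>c\<close> times an average of translates of the
  derivative.
\<close>

lemma parametrix:
  assumes f: "f \<in> smooth_functions"
  shows "f t = smear 0 1 pulse c f t - of_real c * smear 0 1 (\<lambda>s. 1 - step s) c (nderiv 1 f) t"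
proof -
  let ?h = "\<lambda>s. (1 - step s) * f (t + c * s)"
  have "((\<lambda>s. of_real c * ((1 - step s) * nderiv 1 f (t + c * s)) - pulse s * f (t + c * s)) has_integral (?h 1 - ?h 0)) {0..1}"
  proof (rule fundamental_theorem_of_calculus)
    fix s
    have "((\<lambda>s. 1 - step s) has_vector_derivative 0 - pulse s) (at s within {0..1})"
      by (intro has_vector_derivative_diff has_vector_derivative_const smooth_has_vector_derivative1 step_smooth)
    from has_vector_derivative_mult[OF this has_vector_derivative_compose_affine[OF f, of t c s]]
    show "(?h has_vector_derivative of_real c * ((1 - step s) * nderiv 1 f (t + c * s)) - pulse s * f (t + c * s)) (at s within {0..1})"
      by (simp add: scaleR_conv_of_real mult_ac)
  qed simp
  moreover have "((\<lambda>s. of_real c * ((1 - step s) * nderiv 1 f (t + c * s)) - pulse s * f (t + c * s))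
      has_integral (of_real c * smear 0 1 (\<lambda>s. 1 - step s) c (nderiv 1 f) t - smear 0 1 pulse c f t)) {0..1}"
    unfolding smear_def
    by (intro has_integral_diff has_integral_mult_right integrable_integral smear_integrable smooth_nderiv f
        continuous_on_pulse continuous_on_step_tail)
  ultimately have eq: "?h 1 - ?h 0
      = of_real c * smear 0 1 (\<lambda>s. 1 - step s) c (nderiv 1 f) t - smear 0 1 pulse c f t"
    by (rule has_integral_unique)
  have "?h 1 - ?h 0 = - f t" by (simp add: step_0 step_1)
  with eq show ?thesis by (metis minus_diff_eq minus_minus)
qed

text \<open>
  Reading the average of translates of \<open>\<phi>\<close> with weight \<open>k\<close> as an average of translates of the reflected
  kernel with weight \<open>\<phi>\<close> exchanges the two roles; then \<open>T\<close> moves inside the integral.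
\<close>

lemma bd_smear_regular:
  fixes T :: "'x::complex_banach dist"
  assumes T: "T \<in> bounded_dists" and K: "K \<in> \<D>" and \<phi>: "\<phi> \<in> \<D>" and c: "c > 0"
    and Kk: "\<And>s. K s = of_real (1 / c) * k (s / c)" and k: "continuous_on {0..1} k" "\<And>s. s < 0 \<or> s > 1 \<Longrightarrow> k s = 0"
  shows "T (smear 0 1 k c \<phi>) = regular_dist (dist_conv T K) \<phi>"
proof -
  obtain R where R: "R > 0" "\<forall>j x. \<bar>x\<bar> \<ge> R \<longrightarrow> nderiv j \<phi> x = 0" using test_support[OF \<phi>] by metis
  have \<phi>0: "\<phi> s = 0" if "s \<notin> {-R..R}" for s
  proof -
    have "\<bar>s\<bar> \<ge> R" using that by auto
    then have "nderiv 0 \<phi> s = 0" using R(2) by blast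
    then show ?thesis by simp
  qed
  have \<phi>c: "continuous_on S \<phi>" for S by (rule smooth_continuous_on0[OF test_smooth[OF \<phi>]])
  let ?r = "\<lambda>t. K (- t)"
  have r: "?r \<in> DL1" using test_DL1[OF test_reflect_shift[OF K, of 0]] by simp
  have same: "smear (-R) R \<phi> (-1) ?r t = smear 0 1 k c \<phi> t" for t
  proof -
    have "((\<lambda>u. \<phi> u * ?r (t + (-1) * u)) has_integral smear (-R) R \<phi> (-1) ?r t) {-R..R}"
      unfolding smear_def by (intro integrable_integral smear_integrable \<phi>c DL1_smooth[OF r])
    then have 1: "((\<lambda>u. \<phi> u * ?r (t + (-1) * u)) has_integral smear (-R) R \<phi> (-1) ?r t) UNIV"
      by (rule has_integral_on_superset) (simp_all add: \<phi>0)
    have "((\<lambda>s. k s * \<phi> (t + c * s)) has_integral smear 0 1 k c \<phi> t) (cbox 0 1)"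
      unfolding smear_def box_real by (intro integrable_integral smear_integrable k(1) test_smooth[OF \<phi>])
    from has_integral_affinity[OF this, of "1 / c" "- (t / c)"] c
    have 2: "((\<lambda>u. k (u / c - t / c) * \<phi> (t + c * (u / c - t / c))) has_integral of_real c * smear 0 1 k c \<phi> t)
        ((\<lambda>s. c * s + t) ` {0..1})"
      by (simp add: scaleR_conv_of_real)
    have img: "(\<lambda>s. c * s + t) ` {0..1} = {t..t + c}"
      using image_affinity_atLeastAtMost[of c t 0 1] c by (simp add: add.commute)
    have "((\<lambda>u. of_real (1 / c) * (k (u / c - t / c) * \<phi> (t + c * (u / c - t / c)))) has_integral
        of_real (1 / c) * (of_real c * smear 0 1 k c \<phi> t)) {t..t + c}"
      using has_integral_mult_right[OF 2[unfolded img]] .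
    moreover have "of_real (1 / c) * (k (u / c - t / c) * \<phi> (t + c * (u / c - t / c))) = \<phi> u * ?r (t + (-1) * u)" for u
      using c by (simp add: Kk right_diff_distrib diff_divide_distrib)
    moreover have "of_real (1 / c) * (of_real c * smear 0 1 k c \<phi> t) = smear 0 1 k c \<phi> t" using c by simp
    ultimately have "((\<lambda>u. \<phi> u * ?r (t + (-1) * u)) has_integral smear 0 1 k c \<phi> t) {t..t + c}" by simp
    then have "((\<lambda>u. \<phi> u * ?r (t + (-1) * u)) has_integral smear 0 1 k c \<phi> t) UNIV"
    proof (rule has_integral_on_superset)
      fix u assume "u \<notin> {t..t + c}"
      then have "(u - t) / c < 0 \<or> (u - t) / c > 1" using c by (auto simp: field_simps)
      then have "K (u - t) = 0" by (simp add: Kk k(2))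
      then show "\<phi> u * ?r (t + (-1) * u) = 0" by simp
    qed simp
    then show ?thesis by (rule has_integral_unique[OF 1])
  qed
  have "T (smear 0 1 k c \<phi>) = T (smear (-R) R \<phi> (-1) ?r)" using same by presburger
  also have "\<dots> = integral {-R..R} (\<lambda>s. \<phi> s *\<^sub>C T (\<lambda>t. ?r (t + (-1) * s)))"
    using R(1) by (intro bd_smear[OF T r \<phi>c]) simp
  also have "\<dots> = integral {-R..R} (\<lambda>s. \<phi> s *\<^sub>C dist_conv T K s)" by (simp add: dist_conv_def)
  also have "\<dots> = regular_dist (dist_conv T K) \<phi>"
  proof -
    have "((\<lambda>s. \<phi> s *\<^sub>C dist_conv T K s) has_integral integral {-R..R} (\<lambda>s. \<phi> s *\<^sub>C dist_conv T K s)) {-R..R}"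
      by (intro integrable_integral scaleC_integrable_interval \<phi>c dist_conv_continuous[OF T test_DL1[OF K]])
    then have "((\<lambda>s. \<phi> s *\<^sub>C dist_conv T K s) has_integral integral {-R..R} (\<lambda>s. \<phi> s *\<^sub>C dist_conv T K s)) UNIV"
      by (rule has_integral_on_superset)
        (simp_all add: \<phi>0 bounded_bilinear.zero_left[OF bounded_bilinear_scaleC])
    then show ?thesis unfolding regular_dist_def by (metis integral_unique)
  qed
  finally show ?thesis .
qed

section \<open>The structure theorem\<close>

text \<open>
  The test functions that approximate \<open>1 - step\<close>, cut off at 0, in \<open>L\<^sup>1\<close>: the jump at 0 is replaced by the
  steep step \<open>step ((n + 1) s)\<close>, and for \<open>s \<ge> 1 / (n + 1)\<close> nothing changes.
\<close>

definition cut_step :: "nat \<Rightarrow> real \<Rightarrow> complex" where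
  "cut_step n s = step (real (Suc n) * s) - step s"

lemma cut_step_outside:
  assumes "s < 0 \<or> s > 1" shows "cut_step n s = 0"
proof (cases "s < 0")
  case True
  then show ?thesis by (simp add: cut_step_def step_0 mult_nonneg_nonpos)
next
  case False
  then have s: "s > 1" using assms by simp
  then have "1 * 1 \<le> real (Suc n) * s" by (intro mult_mono) auto
  then show ?thesis using s by (simp add: cut_step_def step_1)
qed

lemma cut_step_test: "cut_step n \<in> \<D>"
proof (rule testI[of _ 1])
  show "cut_step n \<in> smooth_functions"
    using smooth_diff[OF smooth_affine[OF step_smooth, of 0 "real (Suc n)"] step_smooth]
    by (simp add: cut_step_def[abs_def])
  show "cut_step n x = 0" if "1 < \<bar>x\<bar>" for x using that by (intro cut_step_outside) auto
qed

lemma cut_step_Cauchy: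
  "DL1_norm 0 (\<lambda>t. cut_step n t - cut_step m t) \<le> 2 * (inverse (real (Suc n)) + inverse (real (Suc m)))"
proof -
  define a where "a = inverse (real (Suc n)) + inverse (real (Suc m))"
  have a: "a \<ge> 0" by (simp add: a_def)
  have le: "norm (cut_step n t - cut_step m t) \<le> 2 * indicat_real {0..a} t" for t
  proof (cases "t \<in> {0..a}")
    case True
    have "norm (step (real (Suc n) * t) - step (real (Suc m) * t)) \<le> 2"
      using norm_triangle_ineq4[of "step (real (Suc n) * t)" "step (real (Suc m) * t)"]
        step_norm(1)[of "real (Suc n) * t"] step_norm(1)[of "real (Suc m) * t"] by linarith
    then show ?thesis using True by (simp add: cut_step_def)
  next
    case False
    have "cut_step n t = cut_step m t"
    proof (cases "t < 0")
      case True then show ?thesis by (simp add: cut_step_outside)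
    next
      case f: False
      then have "t > a" using False by auto
      then have t: "t \<ge> inverse (real (Suc k))" if "k = n \<or> k = m" for k
        using that by (auto simp: a_def intro: order_trans[rotated] less_imp_le)
      have "real (Suc k) * t \<ge> 1" if "k = n \<or> k = m" for k
        using mult_left_mono[OF t[OF that], of "real (Suc k)"] by simp
      then show ?thesis by (simp add: cut_step_def step_1)
    qed
    then show ?thesis by simp
  qed
  have "(LINT t|lborel. norm (cut_step n t - cut_step m t)) \<le> (LINT t|lborel. 2 * indicat_real {0..a} t)"
  proof (rule integral_mono[OF _ _ le])
    show "integrable lborel (\<lambda>t. norm (cut_step n t - cut_step m t))"
      by (intro integrable_norm DL1_integrable0 DL1_diff test_DL1 cut_step_test)
    show "integrable lborel (\<lambda>t. 2 * indicat_real {0..a} t)"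
      using a by (intro integrable_mult_right integrable_real_indicator) simp_all
  qed
  also have "\<dots> = 2 * a" using a by simp
  finally show ?thesis by (simp add: DL1_norm_0 a_def)
qed

text \<open>
  The two weights differ only on \<open>[0, 1 / (n + 1)]\<close>, and by at most 1 there.
\<close>

lemma smear_cut_step:
  assumes f: "f \<in> DL1"
  shows "DL1_norm 0 (\<lambda>t. smear 0 1 (cut_step n) 1 f t - smear 0 1 (\<lambda>s. 1 - step s) 1 f t)
     \<le> inverse (real (Suc n)) * DL1_norm 0 f"
proof -
  define a where "a = inverse (real (Suc n))"
  have a: "0 \<le> a" "a \<le> 1" by (simp_all add: a_def inverse_le_1_iff)
  let ?w = "\<lambda>s. cut_step n s - (1 - step s)"
  have w: "?w s = step (real (Suc n) * s) - 1" for s by (simp add: cut_step_def)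
  have cc: "continuous_on S (cut_step n)" for S by (rule smooth_continuous_on0[OF test_smooth[OF cut_step_test]])
  have wc: "continuous_on S ?w" for S by (intro continuous_on_diff cc continuous_on_step_tail)
  have "smear 0 1 (cut_step n) 1 f t - smear 0 1 (\<lambda>s. 1 - step s) 1 f t = smear 0 a ?w 1 f t" for t
  proof -
    have "smear a 1 ?w 1 f t = 0"
      unfolding smear_def
    proof (rule integral_unique, rule has_integral_is_0)
      fix s assume "s \<in> {a..1}"
      then have "real (Suc n) * a \<le> real (Suc n) * s" by (intro mult_left_mono) auto
      then have "1 \<le> real (Suc n) * s" by (simp add: a_def)
      then show "?w s * f (t + 1 * s) = 0" unfolding w by (simp add: step_1)
    qed
    then show ?thesis
      using smear_diff_weight[OF cc continuous_on_step_tail DL1_smooth[OF f]]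
        smear_split[OF a wc DL1_smooth[OF f], of 1 t] by simp
  qed
  then have "(\<lambda>t. smear 0 1 (cut_step n) 1 f t - smear 0 1 (\<lambda>s. 1 - step s) 1 f t) = smear 0 a ?w 1 f" by blast
  moreover have "DL1_norm 0 (smear 0 a ?w 1 f) \<le> 1 * (a - 0) * DL1_norm 0 f"
  proof (intro smear_DL1_bound f wc a(1))
    show "norm (?w s) \<le> 1" for s unfolding w using step_norm(2)[of "real (Suc n) * s"] by (simp add: norm_minus_commute)
  qed
  ultimately show ?thesis by (simp add: a_def)
qed

lemma norm_le_null_sequence:
  fixes x :: "'a::real_normed_vector"
  assumes "\<And>n. norm x \<le> K * inverse (real (Suc n))" shows "x = 0"
proof -
  have "(\<lambda>n. K * inverse (real (Suc n))) \<longlonglongrightarrow> K * 0"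
    by (intro tendsto_mult tendsto_const LIMSEQ_inverse_real_of_nat)
  then have "norm x \<le> K * 0" by (rule LIMSEQ_le_const) (use assms in blast)
  then show ?thesis by simp
qed

text \<open>
  For a distribution of order zero the regularisations by \<open>cut_step n\<close> are uniformly Cauchy, since these
  kernels converge in \<open>L\<^sup>1\<close>. Their limit \<open>u\<close> represents the localised primitive of \<open>T\<close>.
\<close>

lemma order_zero_primitive:
  fixes T :: "'x::complex_banach dist"
  assumes T: "T \<in> bounded_dists" and C: "C \<ge> 0" "\<forall>f\<in>DL1. norm (T f) \<le> C * DL1_norm 0 f"
    and conv: "\<And>\<phi>. \<phi> \<in> \<D> \<Longrightarrow> dist_conv T \<phi> \<in> AAP"
  shows "\<exists>u\<in>AAP. bounded (range u) \<and> (\<forall>\<phi>\<in>\<D>. T (smear 0 1 (\<lambda>s. 1 - step s) 1 \<phi>) = regular_dist u \<phi>)"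
proof -
  define r where "r n = (2 * C) * inverse (real (Suc n))" for n
  have r: "r \<longlonglongrightarrow> 0"
    unfolding r_def using tendsto_mult[OF tendsto_const[of "2 * C"] LIMSEQ_inverse_real_of_nat] by simp
  have D: "cut_step n \<in> DL1" for n by (rule test_DL1[OF cut_step_test])
  define v where "v n = dist_conv T (cut_step n)" for n
  have vv: "norm (v n x - v m x) \<le> r n + r m" for n m x
  proof -
    have "norm (v n x - v m x) \<le> C * DL1_norm 0 (\<lambda>t. cut_step n t - cut_step m t)"
      unfolding v_def dist_conv_diff[OF T D D, symmetric] by (rule dist_conv_bound[OF C(2) DL1_diff[OF D D]])
    also have "\<dots> \<le> C * (2 * (inverse (real (Suc n)) + inverse (real (Suc m))))"
      by (rule mult_left_mono[OF cut_step_Cauchy C(1)])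
    also have "\<dots> = r n + r m" by (simp add: r_def algebra_simps)
    finally show ?thesis .
  qed
  have "\<exists>u. \<forall>n x. norm (v n x - u x) \<le> r n" by (rule uniform_Cauchy_limit[OF vv r])
  then obtain u where "\<forall>n x. norm (v n x - u x) \<le> r n" ..
  then have u: "norm (v n x - u x) \<le> r n" for n x by simp
  have uA: "u \<in> AAP"
  proof (rule AAP_uniform_approx)
    fix e :: real assume "e > 0"
    then obtain n where n: "r n < e"
      using order_tendstoD(2)[OF r] eventually_happens'[OF sequentially_bot] by blast
    have "norm (u t - v n t) \<le> e" for t using u[of n t] n by (simp add: norm_minus_commute)
    moreover have "v n \<in> AAP" unfolding v_def by (rule conv[OF cut_step_test])
    ultimately show "\<exists>h\<in>AAP. \<forall>t. norm (u t - h t) \<le> e" by blast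
  qed
  have vb: "\<exists>M. \<forall>x. norm (v n x) \<le> M" for n
    using dist_conv_bound[OF C(2) D, of n] unfolding v_def by blast
  obtain M0 where M0: "\<And>x. norm (v 0 x) \<le> M0" using vb[of 0] by blast
  have ub: "norm (u x) \<le> M0 + r 0" for x
    using norm_triangle_ineq4[of "v 0 x" "v 0 x - u x"] M0[of x] u[of 0 x] by simp
  have uc: "continuous_on UNIV u" by (rule AAP_continuous[OF uA])
  have "T (smear 0 1 (\<lambda>s. 1 - step s) 1 \<phi>) = regular_dist u \<phi>" if \<phi>: "\<phi> \<in> \<D>" for \<phi>
  proof -
    note \<phi>1 = test_DL1[OF \<phi>]
    define L where "L = (LINT t|lborel. norm (\<phi> t))"
    have "norm (T (smear 0 1 (\<lambda>s. 1 - step s) 1 \<phi>) - regular_dist u \<phi>) \<le> (3 * C * L) * inverse (real (Suc n))" for n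
    proof -
      have cc: "continuous_on {0..1} (cut_step n)" by (rule smooth_continuous_on0[OF test_smooth[OF cut_step_test]])
      have reg: "T (smear 0 1 (cut_step n) 1 \<phi>) = regular_dist (v n) \<phi>"
        unfolding v_def
        by (rule bd_smear_regular[OF T cut_step_test \<phi> zero_less_one _ cc cut_step_outside]) simp_all
      obtain M where M: "\<And>x. norm (v n x) \<le> M" using vb by blast
      have vc: "continuous_on UNIV (v n)" unfolding v_def by (rule dist_conv_continuous[OF T D])
      have s1: "smear 0 1 (cut_step n) 1 \<phi> \<in> DL1" by (rule smear_DL1[OF \<phi>1 cc]) simp
      have s2: "smear 0 1 (\<lambda>s. 1 - step s) 1 \<phi> \<in> DL1" by (rule smear_DL1[OF \<phi>1 continuous_on_step_tail]) simp
      have "norm (T (smear 0 1 (cut_step n) 1 \<phi>) - T (smear 0 1 (\<lambda>s. 1 - step s) 1 \<phi>)) \<le> C * (inverse (real (Suc n)) * L)"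
        unfolding bd_diff[OF T s1 s2, symmetric]
        using bspec[OF C(2) DL1_diff[OF s1 s2]] mult_left_mono[OF smear_cut_step[OF \<phi>1, of n] C(1)]
        by (simp add: L_def DL1_norm_0)
      moreover have "norm (regular_dist (v n) \<phi> - regular_dist u \<phi>) \<le> r n * L"
        unfolding regular_dist_diff[OF vc M uc ub smooth_continuous_on0[OF DL1_smooth[OF \<phi>1]] DL1_integrable0[OF \<phi>1], symmetric] L_def
        by (rule regular_dist_bound[OF continuous_on_diff[OF vc uc] u smooth_continuous_on0[OF DL1_smooth[OF \<phi>1]] DL1_integrable0[OF \<phi>1]])
      ultimately show ?thesis
        using norm_triangle_ineq4[of "regular_dist (v n) \<phi> - regular_dist u \<phi>" "regular_dist (v n) \<phi> - T (smear 0 1 (\<lambda>s. 1 - step s) 1 \<phi>)"]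
        unfolding reg by (simp add: r_def algebra_simps)
    qed
    from norm_le_null_sequence[OF this] show ?thesis by simp
  qed
  moreover have "bounded (range u)" using ub unfolding bounded_iff by blast
  ultimately show ?thesis using uA by blast
qed

lemma bd_comp_smear:
  fixes T :: "'x::complex_banach dist"
  assumes T: "T \<in> bounded_dists" and w: "continuous_on {0..1} w"
  shows "(\<lambda>\<phi>. T (smear 0 1 w c \<phi>)) \<in> bounded_dists"
proof -
  obtain k C where C: "C \<ge> 0" "\<forall>f\<in>DL1. norm (T f) \<le> C * DL1_norm k f" using bd_bound[OF T] by blast
  obtain W where W: "\<And>s. s \<in> {0..1} \<Longrightarrow> norm (w s) \<le> W" using continuous_bound[OF w] by blast
  have s: "smear 0 1 w c f \<in> DL1" if "f \<in> DL1" for f by (rule smear_DL1[OF that w]) simp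
  show ?thesis
  proof (rule bdI)
    show "norm (T (smear 0 1 w c f)) \<le> (C * W) * DL1_norm k f" if "f \<in> DL1" for f
    proof -
      have "norm (T (smear 0 1 w c f)) \<le> C * DL1_norm k (smear 0 1 w c f)" using bspec[OF C(2) s[OF that]] .
      also have "\<dots> \<le> C * (W * (1 - 0) * DL1_norm k f)"
        by (intro mult_left_mono C(1) smear_DL1_bound that w W) simp_all
      finally show ?thesis by simp
    qed
    show "T (smear 0 1 w c (\<lambda>x. f x + g x)) = T (smear 0 1 w c f) + T (smear 0 1 w c g)" if "f \<in> DL1" "g \<in> DL1" for f g
      unfolding smear_add[OF w DL1_smooth[OF that(1)] DL1_smooth[OF that(2)]] by (rule bd_add[OF T s[OF that(1)] s[OF that(2)]])
    show "T (smear 0 1 w c (\<lambda>x. d * f x)) = d *\<^sub>C T (smear 0 1 w c f)" if "f \<in> DL1" for f d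
      unfolding smear_cmult by (rule bd_cmult[OF T s[OF that]])
  qed
qed

lemma dist_conv_comp_smear: "dist_conv (\<lambda>\<phi>. T (smear 0 1 w 1 \<phi>)) \<phi> = dist_conv T (smear 0 1 w (-1) \<phi>)"
proof -
  have "smear 0 1 w 1 (\<lambda>t. \<phi> (x - t)) t = smear 0 1 w (-1) \<phi> (x - t)" for x t
    by (simp add: smear_def algebra_simps)
  then show ?thesis unfolding dist_conv_def by presburger
qed

text \<open>
  By the parametrix, the derivative of the average is a combination of \<open>f\<close> itself and of a smooth
  average of \<open>f\<close>, so averaging with weight \<open>1 - step\<close> gains one derivative. Composing \<open>T\<close> with it therefore
  lowers the order by one.
\<close>

lemma primitive_bound:
  assumes f: "f \<in> DL1" and P: "\<And>s. s \<in> {0..1} \<Longrightarrow> norm (pulse s) \<le> P"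
  shows "DL1_norm (Suc k) (smear 0 1 (\<lambda>s. 1 - step s) 1 f) \<le> (P + 2) * DL1_norm k f"
proof -
  let ?S = "smear 0 1 (\<lambda>s. 1 - step s) 1"
  note sf = DL1_smooth[OF f]
  have "nderiv 1 (?S f) = (\<lambda>t. smear 0 1 pulse 1 f t - f t)"
  proof
    fix t show "nderiv 1 (?S f) t = smear 0 1 pulse 1 f t - f t"
      using parametrix[OF sf, of t 1] unfolding nderiv_smear[OF continuous_on_step_tail sf] by simp
  qed
  moreover have "DL1_norm k (\<lambda>t. smear 0 1 pulse 1 f t - f t) \<le> P * (1 - 0) * DL1_norm k f + DL1_norm k f"
  proof -
    have "smear 0 1 pulse 1 f \<in> DL1" by (rule smear_DL1[OF f continuous_on_pulse]) simp
    from DL1_norm_diff_triangle[OF this f]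
    have "DL1_norm k (\<lambda>t. smear 0 1 pulse 1 f t - f t) \<le> DL1_norm k (smear 0 1 pulse 1 f) + DL1_norm k f" .
    also have "DL1_norm k (smear 0 1 pulse 1 f) \<le> P * (1 - 0) * DL1_norm k f"
      by (rule smear_DL1_bound[OF f continuous_on_pulse P]) simp_all
    finally show ?thesis by simp
  qed
  moreover have "DL1_norm 0 (?S f) \<le> 1 * (1 - 0) * DL1_norm 0 f"
    by (rule smear_DL1_bound[OF f continuous_on_step_tail]) (simp_all add: step_norm)
  moreover have "DL1_norm 0 f \<le> DL1_norm k f" by (rule DL1_norm_mono) simp
  ultimately show ?thesis unfolding DL1_norm_Suc by (simp add: algebra_simps)
qed

lemma bd_parametrix:
  fixes T :: "'x::complex_banach dist"
  assumes T: "T \<in> bounded_dists" and \<phi>: "\<phi> \<in> \<D>"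
  shows "T \<phi> = regular_dist (dist_conv T pulse) \<phi> - T (smear 0 1 (\<lambda>s. 1 - step s) 1 (nderiv 1 \<phi>))"
proof -
  note \<phi>1 = test_DL1[OF \<phi>]
  have "\<phi> = (\<lambda>t. smear 0 1 pulse 1 \<phi> t - smear 0 1 (\<lambda>s. 1 - step s) 1 (nderiv 1 \<phi>) t)"
    using parametrix[OF DL1_smooth[OF \<phi>1], of _ 1] by (simp add: fun_eq_iff)
  then have "T \<phi> = T (\<lambda>t. smear 0 1 pulse 1 \<phi> t - smear 0 1 (\<lambda>s. 1 - step s) 1 (nderiv 1 \<phi>) t)"
    by (rule arg_cong)
  also have "\<dots> = T (smear 0 1 pulse 1 \<phi>) - T (smear 0 1 (\<lambda>s. 1 - step s) 1 (nderiv 1 \<phi>))"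
  proof (rule bd_diff[OF T])
    show "smear 0 1 pulse 1 \<phi> \<in> DL1" by (rule smear_DL1[OF \<phi>1 continuous_on_pulse]) simp
    show "smear 0 1 (\<lambda>s. 1 - step s) 1 (nderiv 1 \<phi>) \<in> DL1"
      by (rule smear_DL1[OF DL1_nderiv[OF \<phi>1] continuous_on_step_tail]) simp
  qed
  also have "T (smear 0 1 pulse 1 \<phi>) = regular_dist (dist_conv T pulse) \<phi>"
    by (rule bd_smear_regular[OF T pulse_test \<phi> zero_less_one _ continuous_on_pulse pulse_outside]) simp_all
  finally show ?thesis .
qed

text \<open>
  Induction on the order \<open>k\<close>. The localised primitive has lower order, and its regularisations are again
  regularisations of \<open>T\<close>, so it satisfies the hypotheses. Its representation, differentiated once,
  together with the function \<open>T * pulse\<close> represents \<open>T\<close>.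
\<close>

theorem AAP_structure:
  fixes T :: "'x::complex_banach dist"
  assumes "T \<in> bounded_dists" "C \<ge> 0" "\<forall>f\<in>DL1. norm (T f) \<le> C * DL1_norm k f"
    and "\<And>\<phi>. \<phi> \<in> \<D> \<Longrightarrow> dist_conv T \<phi> \<in> AAP"
  shows "\<exists>f. (\<forall>j\<le>Suc k. f j \<in> AAP \<and> bounded (range (f j))) \<and>
    (\<forall>\<phi>\<in>\<D>. T \<phi> = (\<Sum>j\<le>Suc k. dist_deriv j (regular_dist (f j)) \<phi>))"
  using assms
proof (induction k arbitrary: T C)
  case (0 T C)
  obtain u where u: "u \<in> AAP" "bounded (range u)"
    "\<forall>\<phi>\<in>\<D>. T (smear 0 1 (\<lambda>s. 1 - step s) 1 \<phi>) = regular_dist u \<phi>"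
    using order_zero_primitive[OF 0] by blast
  let ?f = "\<lambda>j::nat. if j = 0 then dist_conv T pulse else u"
  have "T \<phi> = (\<Sum>j\<le>Suc 0. dist_deriv j (regular_dist (?f j)) \<phi>)" if "\<phi> \<in> \<D>" for \<phi>
    using bd_parametrix[OF 0(1) that] bspec[OF u(3) test_nderiv[OF that, of 1]]
    by (simp add: dist_deriv_def)
  moreover have "?f j \<in> AAP \<and> bounded (range (?f j))" for j
    using u(1,2) 0(4)[OF pulse_test] dist_conv_bounded[OF 0(1) test_DL1[OF pulse_test]] by simp
  ultimately show ?case by (intro exI[of _ ?f]) blast
next
  case (Suc k T C)
  let ?U = "\<lambda>\<phi>. T (smear 0 1 (\<lambda>s. 1 - step s) 1 \<phi>)"
  obtain P where P: "P \<ge> 0" "\<And>s. s \<in> {0..1} \<Longrightarrow> norm (pulse s) \<le> P"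
    using continuous_bound[OF continuous_on_pulse, of 0 1] by blast
  have "?U \<in> bounded_dists" by (rule bd_comp_smear[OF Suc.prems(1) continuous_on_step_tail])
  moreover have "C * (P + 2) \<ge> 0" using Suc.prems(2) P(1) by simp
  moreover have "\<forall>f\<in>DL1. norm (?U f) \<le> (C * (P + 2)) * DL1_norm k f"
  proof
    fix f assume f: "f \<in> DL1"
    have "smear 0 1 (\<lambda>s. 1 - step s) 1 f \<in> DL1" by (rule smear_DL1[OF f continuous_on_step_tail]) simp
    from bspec[OF Suc.prems(3) this]
    have "norm (?U f) \<le> C * DL1_norm (Suc k) (smear 0 1 (\<lambda>s. 1 - step s) 1 f)" .
    also have "\<dots> \<le> C * ((P + 2) * DL1_norm k f)"
      by (intro mult_left_mono Suc.prems(2) primitive_bound f P(2))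
    finally show "norm (?U f) \<le> (C * (P + 2)) * DL1_norm k f" by (simp add: mult.assoc)
  qed
  moreover have "dist_conv ?U \<phi> \<in> AAP" if "\<phi> \<in> \<D>" for \<phi>
    unfolding dist_conv_comp_smear by (rule Suc.prems(4)[OF smear_test[OF that continuous_on_step_tail]])
  ultimately obtain f where f: "\<forall>j\<le>Suc k. f j \<in> AAP \<and> bounded (range (f j))"
    "\<forall>\<phi>\<in>\<D>. ?U \<phi> = (\<Sum>j\<le>Suc k. dist_deriv j (regular_dist (f j)) \<phi>)"
    using Suc.IH[of ?U "C * (P + 2)"] by blast
  let ?f = "\<lambda>j. case j of 0 \<Rightarrow> dist_conv T pulse | Suc i \<Rightarrow> f i"
  have "T \<phi> = (\<Sum>j\<le>Suc (Suc k). dist_deriv j (regular_dist (?f j)) \<phi>)" if \<phi>: "\<phi> \<in> \<D>" for \<phi>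
  proof -
    have shift: "dist_deriv j (regular_dist (f j)) (nderiv 1 \<phi>) = - dist_deriv (Suc j) (regular_dist (f j)) \<phi>" for j
      by (simp add: dist_deriv_def nderiv_nderiv)
    have "T \<phi> = regular_dist (dist_conv T pulse) \<phi> - (\<Sum>j\<le>Suc k. dist_deriv j (regular_dist (f j)) (nderiv 1 \<phi>))"
      using bd_parametrix[OF Suc.prems(1) \<phi>] bspec[OF f(2) test_nderiv[OF \<phi>, of 1]] by simp
    also have "\<dots> = dist_deriv 0 (regular_dist (?f 0)) \<phi> + (\<Sum>j\<le>Suc k. dist_deriv (Suc j) (regular_dist (?f (Suc j))) \<phi>)"
      unfolding shift by (simp only: sum_negf) (simp add: dist_deriv_def)
    also have "\<dots> = (\<Sum>j\<le>Suc (Suc k). dist_deriv j (regular_dist (?f j)) \<phi>)"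
      by (rule sum.atMost_Suc_shift[symmetric])
    finally show ?thesis .
  qed
  moreover have "?f j \<in> AAP \<and> bounded (range (?f j))" if "j \<le> Suc (Suc k)" for j
    using f(1) that Suc.prems(4)[OF pulse_test] dist_conv_bounded[OF Suc.prems(1) test_DL1[OF pulse_test]]
    by (cases j) simp_all
  ultimately show ?case by (intro exI[of _ ?f]) blast
qed

section \<open>Asymptotically almost periodic distributions\<close>

lemma eventually_reflect_shift_test0:
  assumes \<phi>: "\<phi> \<in> \<D>" shows "eventually (\<lambda>x. (\<lambda>t. \<phi> (x - t)) \<in> \<D>\<^sub>0) at_top"
proof -
  obtain R where R: "R > 0" "\<forall>j x. \<bar>x\<bar> \<ge> R \<longrightarrow> nderiv j \<phi> x = 0" using test_support[OF \<phi>] by metis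
  have "(\<lambda>t. \<phi> (x - t)) \<in> \<D>\<^sub>0" if x: "x \<ge> R" for x
  proof -
    have "\<phi> (x - t) = 0" if "t < 0" for t
    proof -
      have "\<bar>x - t\<bar> \<ge> R" using x that by auto
      then have "nderiv 0 \<phi> (x - t) = 0" using R(2) by blast
      then show ?thesis by simp
    qed
    then show ?thesis using test_reflect_shift[OF \<phi>] by (simp add: test0_iff)
  qed
  then show ?thesis unfolding eventually_at_top_linorder by (intro exI[of _ R]) simp
qed

text \<open>
  The value at \<open>x\<close> of a regularisation only tests the distribution on \<open>[0, \<infinity>)\<close> once \<open>x\<close> is large.
\<close>

lemma AAP_transfer:
  fixes T :: "'x::complex_banach dist"
  assumes T: "T \<in> bounded_dists" and eq: "dist_eq_on \<D>\<^sub>0 T S" and \<phi>: "\<phi> \<in> \<D>" and S: "dist_conv S \<phi> \<in> AAP"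
  shows "dist_conv T \<phi> \<in> AAP"
proof (rule AAP_eventually_eq[OF S dist_conv_continuous[OF T test_DL1[OF \<phi>]] _ tendsto_const])
  show "eventually (\<lambda>x. dist_conv T \<phi> x - dist_conv S \<phi> x = 0) at_top"
    using eventually_reflect_shift_test0[OF \<phi>]
    by eventually_elim (use eq in \<open>simp add: dist_conv_def dist_eq_on_def\<close>)
qed

text \<open>
  Translation in the definition of \<open>B_plus0\<close> is regularisation by the reflected test function.
\<close>

lemma B_plus0_iff:
  "Q \<in> B_plus0 \<longleftrightarrow> Q \<in> bounded_dists \<and> (\<forall>\<phi>\<in>\<D>. (dist_conv Q \<phi> \<longlongrightarrow> 0) at_top)"
proof -
  have r: "(\<lambda>t. \<phi> (- t)) \<in> \<D>" if "\<phi> \<in> \<D>" for \<phi> using test_reflect_shift[OF that, of 0] by simp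
  have 1: "(\<lambda>h. dist_translate h Q \<phi>) = dist_conv Q (\<lambda>t. \<phi> (- t))" for \<phi>
    by (simp add: dist_translate_def dist_conv_def fun_eq_iff)
  have 2: "dist_conv Q \<phi> = (\<lambda>h. dist_translate h Q (\<lambda>t. \<phi> (- t)))" for \<phi>
    by (simp add: dist_translate_def dist_conv_def fun_eq_iff)
  have "(\<forall>\<phi>\<in>\<D>. ((\<lambda>h. dist_translate h Q \<phi>) \<longlongrightarrow> 0) at_top) \<longleftrightarrow> (\<forall>\<phi>\<in>\<D>. (dist_conv Q \<phi> \<longlongrightarrow> 0) at_top)"
  proof (intro iffI ballI)
    fix \<phi> assume "\<forall>\<phi>\<in>\<D>. ((\<lambda>h. dist_translate h Q \<phi>) \<longlongrightarrow> 0) at_top" "\<phi> \<in> \<D>"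
    then show "(dist_conv Q \<phi> \<longlongrightarrow> 0) at_top" unfolding 2 using r by blast
  next
    fix \<phi> assume "\<forall>\<phi>\<in>\<D>. (dist_conv Q \<phi> \<longlongrightarrow> 0) at_top" "\<phi> \<in> \<D>"
    then show "((\<lambda>h. dist_translate h Q \<phi>) \<longlongrightarrow> 0) at_top" unfolding 1 using r by blast
  qed
  then show ?thesis by (simp add: B_plus0_def)
qed

lemma B_AAP_imp_conv:
  fixes T :: "'x::complex_banach dist"
  assumes T: "T \<in> B_AAP" and \<phi>: "\<phi> \<in> \<D>"
  shows "dist_conv T \<phi> \<in> AAP"
proof -
  obtain Tap Q where *: "Tap \<in> B_AP" "Q \<in> B_plus0" "dist_eq_on \<D>\<^sub>0 T (\<lambda>\<phi>. Tap \<phi> + Q \<phi>)"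
    and Tb: "T \<in> bounded_dists" using T unfolding B_AAP_def by blast
  have b: "Tap \<in> bounded_dists" "Q \<in> bounded_dists" and Ta: "dist_conv Tap \<phi> \<in> AP"
    and Q: "(dist_conv Q \<phi> \<longlongrightarrow> 0) at_top"
    using *(1,2) \<phi> by (simp_all add: B_AP_def B_plus0_iff)
  have "dist_conv (\<lambda>\<phi>. Tap \<phi> + Q \<phi>) \<phi> \<in> AAP"
  proof (rule AAPI[OF _ Ta])
    show "continuous_on UNIV (dist_conv (\<lambda>\<phi>. Tap \<phi> + Q \<phi>) \<phi>)"
      by (rule dist_conv_continuous[OF bd_plus[OF b] test_DL1[OF \<phi>]])
    have "dist_conv (\<lambda>\<phi>. Tap \<phi> + Q \<phi>) \<phi> x - dist_conv Tap \<phi> x = dist_conv Q \<phi> x" for x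
      by (simp add: dist_conv_def)
    then show "((\<lambda>x. dist_conv (\<lambda>\<phi>. Tap \<phi> + Q \<phi>) \<phi> x - dist_conv Tap \<phi> x) \<longlongrightarrow> 0) at_top" using Q by simp
  qed
  then show ?thesis by (rule AAP_transfer[OF Tb *(3) \<phi>])
qed

lemma sum_regular_conv_AAP:
  fixes f :: "nat \<Rightarrow> real \<Rightarrow> 'x::complex_banach"
  assumes "\<And>j. j \<le> k \<Longrightarrow> f j \<in> AAP" "\<phi> \<in> \<D>"
  shows "dist_conv (\<lambda>\<phi>. \<Sum>j\<le>k. dist_deriv j (regular_dist (f j)) \<phi>) \<phi> \<in> AAP"
proof -
  have "(\<lambda>x. \<Sum>j\<le>k. dist_conv (dist_deriv j (regular_dist (f j))) \<phi> x) \<in> AAP"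
    by (intro AAP_sum dist_conv_regular_AAP assms)
  then show ?thesis by (simp add: dist_conv_def[abs_def])
qed

text \<open>
  Only the distribution built from the almost periodic parts needs to be constructed; the remainder
  is then a bounded distribution for free.
\<close>

lemma conv_imp_B_AAP:
  fixes T :: "'x::complex_banach dist"
  assumes T: "T \<in> bounded_dists" and f: "\<And>j. j \<le> k \<Longrightarrow> f j \<in> AAP"
    and eq: "\<forall>\<phi>\<in>\<D>. T \<phi> = (\<Sum>j\<le>k. dist_deriv j (regular_dist (f j)) \<phi>)"
  shows "T \<in> B_AAP"
proof -
  have "\<forall>j. \<exists>g. j \<le> k \<longrightarrow> g \<in> AP \<and> ((\<lambda>t. f j t - g t) \<longlongrightarrow> 0) at_top"
    using f unfolding AAP_iff by blast
  from choice[OF this] obtain g where "\<forall>j. j \<le> k \<longrightarrow> g j \<in> AP \<and> ((\<lambda>t. f j t - g j t) \<longlongrightarrow> 0) at_top" ..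
  then have g: "g j \<in> AP" "((\<lambda>t. f j t - g j t) \<longlongrightarrow> 0) at_top" if "j \<le> k" for j using that by simp_all
  define Tap where "Tap \<phi> = (\<Sum>j\<le>k. dist_deriv j (regular_dist (g j)) \<phi>)" for \<phi>
  have Tb: "Tap \<in> bounded_dists"
    unfolding Tap_def[abs_def]
  proof (rule bd_sum)
    fix j assume j: "j \<le> k"
    obtain M where "\<And>t. norm (g j t) \<le> M" using AP_bounded[OF g(1)[OF j]] by blast
    then show "dist_deriv j (regular_dist (g j)) \<in> bounded_dists"
      by (rule dist_deriv_regular_bd[OF AP_continuous[OF g(1)[OF j]]])
  qed
  have "Tap \<in> B_AP"
    unfolding B_AP_def
  proof (intro CollectI conjI ballI Tb)
    fix \<phi> assume "\<phi> \<in> \<D>"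
    then have "(\<lambda>x. \<Sum>j\<le>k. dist_conv (dist_deriv j (regular_dist (g j))) \<phi> x) \<in> AP"
      by (intro AP_sum dist_conv_regular_AP g(1))
    then show "dist_conv Tap \<phi> \<in> AP" by (simp add: dist_conv_def[abs_def] Tap_def)
  qed
  moreover have "(\<lambda>\<phi>. T \<phi> + - Tap \<phi>) \<in> B_plus0"
    unfolding B_plus0_iff
  proof (intro conjI ballI bd_plus bd_minus T Tb)
    fix \<phi> assume \<phi>: "\<phi> \<in> \<D>"
    have "dist_conv (\<lambda>\<phi>. T \<phi> + - Tap \<phi>) \<phi> = (\<lambda>x. \<Sum>j\<le>k. dist_conv (dist_deriv j (regular_dist (f j))) \<phi> x
        - dist_conv (dist_deriv j (regular_dist (g j))) \<phi> x)"
      using bspec[OF eq test_reflect_shift[OF \<phi>]]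
      by (simp add: dist_conv_def fun_eq_iff Tap_def sum_subtractf)
    moreover have "((\<lambda>x. \<Sum>j\<le>k. dist_conv (dist_deriv j (regular_dist (f j))) \<phi> x
        - dist_conv (dist_deriv j (regular_dist (g j))) \<phi> x) \<longlongrightarrow> 0) at_top"
    proof (rule tendsto_null_sum)
      fix j assume "j \<in> {..k}"
      then have j: "j \<le> k" by simp
      show "((\<lambda>x. dist_conv (dist_deriv j (regular_dist (f j))) \<phi> x
        - dist_conv (dist_deriv j (regular_dist (g j))) \<phi> x) \<longlongrightarrow> 0) at_top"
        by (rule dist_conv_regular_near[OF AAP_continuous[OF f[OF j]] AP_continuous[OF g(1)[OF j]] g(2)[OF j] \<phi>])
    qed
    ultimately show "(dist_conv (\<lambda>\<phi>. T \<phi> + - Tap \<phi>) \<phi> \<longlongrightarrow> 0) at_top" by simp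
  qed
  moreover have "dist_eq_on \<D>\<^sub>0 T (\<lambda>\<phi>. Tap \<phi> + (T \<phi> + - Tap \<phi>))" by (simp add: dist_eq_on_def)
  ultimately show ?thesis
    unfolding B_AAP_def mem_Collect_eq by (intro conjI T bexI[of _ Tap] bexI[of _ "\<lambda>\<phi>. T \<phi> + - Tap \<phi>"])
qed

text \<open>
  Shifting \<open>\<phi>\<close> into the half line shifts the regularisation, and \<open>AAP\<close> is invariant under shifts.
\<close>

lemma test0_conv_imp_conv:
  fixes T :: "'x::complex_banach dist"
  assumes T: "\<forall>\<phi>\<in>\<D>\<^sub>0. dist_conv T \<phi> \<in> AAP" and \<phi>: "\<phi> \<in> \<D>"
  shows "dist_conv T \<phi> \<in> AAP"
proof -
  obtain R where R: "R > 0" "\<forall>j x. \<bar>x\<bar> \<ge> R \<longrightarrow> nderiv j \<phi> x = 0" using test_support[OF \<phi>] by metis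
  let ?\<psi> = "\<lambda>t. \<phi> (t - R)"
  have "?\<psi> \<in> \<D>" using test_affine[OF \<phi>, of 1 "- R"] by simp
  moreover have "?\<psi> t = 0" if "t < 0" for t
  proof -
    have "\<bar>t - R\<bar> \<ge> R" using that by simp
    then have "nderiv 0 \<phi> (t - R) = 0" using R(2) by blast
    then show ?thesis by simp
  qed
  ultimately have "?\<psi> \<in> \<D>\<^sub>0" by (simp add: test0_iff)
  then have "(\<lambda>x. dist_conv T ?\<psi> (x + R)) \<in> AAP" using T by (intro AAP_shift) blast
  moreover have "dist_conv T \<phi> = (\<lambda>x. dist_conv T ?\<psi> (x + R))"
    by (simp add: dist_conv_def fun_eq_iff)
  ultimately show ?thesis by simp
qed

section \<open>Mollification\<close>

lemma test_reflections_bounded: assumes "\<phi> \<in> \<D>" shows "DL1_bounded (range (\<lambda>x t. \<phi> (x - t)))"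
  unfolding DL1_bounded_def
proof (intro conjI allI)
  show "range (\<lambda>x t. \<phi> (x - t)) \<subseteq> DL1" using test_DL1[OF test_reflect_shift[OF assms]] by blast
  show "bdd_above (DL1_norm k ` range (\<lambda>x t. \<phi> (x - t)))" for k
    by (rule bdd_aboveI2[of _ _ "DL1_norm k \<phi>", unfolded image_image])
      (auto simp: DL1_norm_reflect_shift[OF test_DL1[OF assms]])
qed

text \<open>
  Uniform convergence on the bounded set of all \<open>\<phi> (x - \<cdot>)\<close> is uniform convergence of the regularisations.
\<close>

lemma strong_limit_conv_AAP:
  fixes T :: "'x::complex_banach dist"
  assumes f: "\<And>n. f n \<in> AAP" and R: "\<And>n. dist_eq_on \<D> (R n) (regular_dist (f n))"
    and lim: "strong_limit R T" and \<phi>: "\<phi> \<in> \<D>"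
  shows "dist_conv T \<phi> \<in> AAP"
proof (rule AAP_uniform_approx)
  fix e :: real assume e: "e > 0"
  have "uniform_limit (range (\<lambda>x t. \<phi> (x - t))) R T sequentially"
    using lim test_reflections_bounded[OF \<phi>] unfolding strong_limit_def by blast
  then obtain n where n: "\<And>x. dist (R n (\<lambda>t. \<phi> (x - t))) (T (\<lambda>t. \<phi> (x - t))) < e"
    using eventually_happens'[OF sequentially_bot uniform_limitD[OF _ e]] by blast
  have R': "dist_conv (R n) \<phi> = dist_conv (dist_deriv 0 (regular_dist (f n))) \<phi>"
    using R[of n] test_reflect_shift[OF \<phi>] by (simp add: dist_conv_def dist_deriv_def dist_eq_on_def fun_eq_iff)
  have "dist_conv (R n) \<phi> \<in> AAP" unfolding R' by (rule dist_conv_regular_AAP[OF f \<phi>])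
  moreover have "norm (dist_conv T \<phi> x - dist_conv (R n) \<phi> x) \<le> e" for x
    using n[of x] by (simp add: dist_conv_def dist_norm norm_minus_commute)
  ultimately show "\<exists>h\<in>AAP. \<forall>x. norm (dist_conv T \<phi> x - h x) \<le> e" by blast
qed

text \<open>
  By the parametrix the error at scale \<open>c\<close> is at most \<open>c\<close> times the next norm, uniformly on bounded sets.
\<close>

lemma mollification_strong_limit:
  fixes T :: "'x::complex_banach dist"
  assumes T: "T \<in> bounded_dists"
  shows "strong_limit (\<lambda>n \<phi>. T (smear 0 1 pulse (inverse (real (Suc n))) \<phi>)) T"
  unfolding strong_limit_def
proof (intro allI impI uniform_limitI)
  fix B and e :: real assume B: "DL1_bounded B" and e: "e > 0"
  obtain k C where C: "C \<ge> 0" "\<forall>f\<in>DL1. norm (T f) \<le> C * DL1_norm k f" using bd_bound[OF T] by blast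
  obtain M where M: "\<And>f. f \<in> B \<Longrightarrow> DL1_norm (Suc k) f \<le> M"
    using B unfolding DL1_bounded_def bdd_above_def by blast
  have near: "norm (T (smear 0 1 pulse c \<phi>) - T \<phi>) \<le> C * M * c" if \<phi>: "\<phi> \<in> B" and c: "c > 0" for \<phi> c
  proof -
    have \<phi>1: "\<phi> \<in> DL1" using \<phi> B unfolding DL1_bounded_def by blast
    let ?S = "smear 0 1 (\<lambda>s. 1 - step s) c (nderiv 1 \<phi>)"
    have S: "?S \<in> DL1" by (rule smear_DL1[OF DL1_nderiv[OF \<phi>1] continuous_on_step_tail]) simp
    have P: "smear 0 1 pulse c \<phi> \<in> DL1" by (rule smear_DL1[OF \<phi>1 continuous_on_pulse]) simp
    have "(\<lambda>t. smear 0 1 pulse c \<phi> t - \<phi> t) = (\<lambda>t. of_real c * ?S t)"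
      using parametrix[OF DL1_smooth[OF \<phi>1], of _ c] by (simp add: fun_eq_iff algebra_simps)
    then have "T (smear 0 1 pulse c \<phi>) - T \<phi> = T (\<lambda>t. of_real c * ?S t)"
      using bd_diff[OF T P \<phi>1] by simp
    then have "norm (T (smear 0 1 pulse c \<phi>) - T \<phi>) \<le> C * DL1_norm k (\<lambda>t. of_real c * ?S t)"
      using bspec[OF C(2) DL1_cmult[OF S]] by simp
    also have "\<dots> = C * (c * DL1_norm k ?S)" using DL1_norm_cmult[OF S] c by simp
    also have "\<dots> \<le> C * (c * M)"
    proof (intro mult_left_mono C(1))
      have "DL1_norm k ?S \<le> 1 * (1 - 0) * DL1_norm k (nderiv 1 \<phi>)"
        by (rule smear_DL1_bound[OF DL1_nderiv[OF \<phi>1] continuous_on_step_tail]) (simp_all add: step_norm)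
      also have "\<dots> \<le> M" using DL1_norm_nderiv_le[of k \<phi>] M[OF \<phi>] by simp
      finally show "DL1_norm k ?S \<le> M" .
    qed (use c in simp)
    finally show ?thesis by (simp add: mult_ac)
  qed
  have "(\<lambda>n. C * M * inverse (real (Suc n))) \<longlonglongrightarrow> C * M * 0"
    by (intro tendsto_mult tendsto_const LIMSEQ_inverse_real_of_nat)
  then have "eventually (\<lambda>n. C * M * inverse (real (Suc n)) < e) sequentially"
    by (rule order_tendstoD(2)) (use e in simp)
  then show "eventually (\<lambda>n. \<forall>\<phi>\<in>B. dist (T (smear 0 1 pulse (inverse (real (Suc n))) \<phi>)) (T \<phi>) < e) sequentially"
  proof eventually_elim
    case (elim n)
    show ?case
    proof
      fix \<phi> assume "\<phi> \<in> B"
      from near[OF this, of "inverse (real (Suc n))"] elim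
      show "dist (T (smear 0 1 pulse (inverse (real (Suc n))) \<phi>)) (T \<phi>) < e" by (simp add: dist_norm)
    qed
  qed
qed

definition mollifier :: "nat \<Rightarrow> real \<Rightarrow> complex" where
  "mollifier n s = of_real (real (Suc n)) * pulse (real (Suc n) * s)"

lemma mollifier_test: "mollifier n \<in> \<D>"
  using test_scale[OF test_affine[OF pulse_test, of "real (Suc n)" 0], of "of_real (real (Suc n))"]
  by (simp add: mollifier_def[abs_def])

lemma bd_mollify:
  fixes T :: "'x::complex_banach dist"
  assumes "T \<in> bounded_dists" "\<phi> \<in> \<D>"
  shows "T (smear 0 1 pulse (inverse (real (Suc n))) \<phi>) = regular_dist (dist_conv T (mollifier n)) \<phi>"
proof (rule bd_smear_regular[OF assms(1) mollifier_test assms(2) _ _ continuous_on_pulse pulse_outside])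
  show "mollifier n s = of_real (1 / inverse (real (Suc n))) * pulse (s / inverse (real (Suc n)))" for s
    unfolding mollifier_def by (simp only: divide_inverse inverse_inverse_eq mult_1_left mult.commute[of s])
qed simp_all

section \<open>The equivalence\<close>

theorem theorem2p2:
  fixes T :: "'x::complex_banach dist"
  assumes nontrivial: "\<exists>x::'x. x \<noteq> 0"
    and T: "T \<in> bounded_dists"
  shows
    "(T \<in> B_AAP \<longleftrightarrow>
        (\<forall>\<phi>\<in>\<D>\<^sub>0. dist_conv T \<phi> \<in> AAP)) \<and>
     (T \<in> B_AAP \<longleftrightarrow>
        (\<exists>(k::nat) (f :: nat \<Rightarrow> real \<Rightarrow> 'x). k \<ge> 1 \<and>
           (\<forall>j\<le>k. f j \<in> AAP) \<and>
           dist_eq_on \<D>\<^sub>0 T (\<lambda>\<phi>. \<Sum>j\<le>k. dist_deriv j (regular_dist (f j)) \<phi>))) \<and>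
     (T \<in> B_AAP \<longleftrightarrow>
        (\<exists>(k::nat) (f :: nat \<Rightarrow> real \<Rightarrow> 'x). k \<ge> 1 \<and>
           (\<forall>j\<le>k. f j \<in> AAP \<and> bounded (range (f j))) \<and>
           dist_eq_on \<D>\<^sub>0 T (\<lambda>\<phi>. \<Sum>j\<le>k. dist_deriv j (regular_dist (f j)) \<phi>))) \<and>
     (T \<in> B_AAP \<longleftrightarrow>
        (\<exists>S\<in>bounded_dists. \<exists>(k::nat) (f :: nat \<Rightarrow> real \<Rightarrow> 'x). k \<ge> 1 \<and>
           (\<forall>j\<le>k. f j \<in> AAP \<and> bounded (range (f j))) \<and>
           dist_eq_on \<D> S (\<lambda>\<phi>. \<Sum>j\<le>k. dist_deriv j (regular_dist (f j)) \<phi>) \<and>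
           dist_eq_on \<D>\<^sub>0 S T)) \<and>
     (T \<in> B_AAP \<longleftrightarrow>
        (\<exists>S\<in>bounded_dists. dist_eq_on \<D>\<^sub>0 S T \<and> (\<forall>\<phi>\<in>\<D>. dist_conv S \<phi> \<in> AAP))) \<and>
     (T \<in> B_AAP \<longleftrightarrow>
        (\<exists>(f :: nat \<Rightarrow> real \<Rightarrow> 'x) (R :: nat \<Rightarrow> 'x dist).
           (\<forall>n. f n \<in> smooth_functions \<inter> AAP \<and>
                R n \<in> bounded_dists \<and> dist_eq_on \<D> (R n) (regular_dist (f n))) \<and>
           strong_limit R T)) \<and>
     (T \<in> B_AAP \<longleftrightarrow>
        (\<forall>\<phi>\<in>\<D>. dist_conv T \<phi> \<in> AAP))"
proof -
  let ?viii = "\<forall>\<phi>\<in>\<D>. dist_conv T \<phi> \<in> AAP"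
  let ?sum = "\<lambda>k (f :: nat \<Rightarrow> real \<Rightarrow> 'x) \<phi>. \<Sum>j\<le>k. dist_deriv j (regular_dist (f j)) \<phi>"
  let ?ii = "\<forall>\<phi>\<in>\<D>\<^sub>0. dist_conv T \<phi> \<in> AAP"
  let ?iii = "\<exists>(k::nat) (f :: nat \<Rightarrow> real \<Rightarrow> 'x). k \<ge> 1 \<and> (\<forall>j\<le>k. f j \<in> AAP) \<and> dist_eq_on \<D>\<^sub>0 T (?sum k f)"
  let ?iv = "\<exists>(k::nat) (f :: nat \<Rightarrow> real \<Rightarrow> 'x). k \<ge> 1 \<and>
    (\<forall>j\<le>k. f j \<in> AAP \<and> bounded (range (f j))) \<and> dist_eq_on \<D>\<^sub>0 T (?sum k f)"
  let ?v = "\<exists>S\<in>bounded_dists. \<exists>(k::nat) (f :: nat \<Rightarrow> real \<Rightarrow> 'x). k \<ge> 1 \<and>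
    (\<forall>j\<le>k. f j \<in> AAP \<and> bounded (range (f j))) \<and> dist_eq_on \<D> S (?sum k f) \<and> dist_eq_on \<D>\<^sub>0 S T"
  let ?vi = "\<exists>S\<in>bounded_dists. dist_eq_on \<D>\<^sub>0 S T \<and> (\<forall>\<phi>\<in>\<D>. dist_conv S \<phi> \<in> AAP)"
  let ?vii = "\<exists>(f :: nat \<Rightarrow> real \<Rightarrow> 'x) (R :: nat \<Rightarrow> 'x dist).
    (\<forall>n. f n \<in> smooth_functions \<inter> AAP \<and> R n \<in> bounded_dists \<and> dist_eq_on \<D> (R n) (regular_dist (f n))) \<and>
    strong_limit R T"
  have T_self: "dist_eq_on \<D>\<^sub>0 T T" by (simp add: dist_eq_on_def)
  have struct: "\<exists>k f. k \<ge> 1 \<and> (\<forall>j\<le>k. f j \<in> AAP \<and> bounded (range (f j))) \<and> (\<forall>\<phi>\<in>\<D>. T \<phi> = ?sum k f \<phi>)"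
    if conv: ?viii
  proof -
    obtain k C where "C \<ge> 0" "\<forall>f\<in>DL1. norm (T f) \<le> C * DL1_norm k f" using bd_bound[OF T] by blast
    from AAP_structure[OF T this] conv obtain f where
      "(\<forall>j\<le>Suc k. f j \<in> AAP \<and> bounded (range (f j))) \<and> (\<forall>\<phi>\<in>\<D>. T \<phi> = ?sum (Suc k) f \<phi>)" by blast
    then show ?thesis by (intro exI[of _ "Suc k"] exI[of _ f]) simp
  qed
  have i: "T \<in> B_AAP \<longleftrightarrow> ?viii"
  proof
    show "T \<in> B_AAP \<Longrightarrow> ?viii" using B_AAP_imp_conv by blast
    assume ?viii
    from struct[OF this] obtain k f where
      "\<And>j. j \<le> k \<Longrightarrow> f j \<in> AAP" "\<forall>\<phi>\<in>\<D>. T \<phi> = ?sum k f \<phi>" by blast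
    then show "T \<in> B_AAP" by (rule conv_imp_B_AAP[OF T])
  qed
  have ii: "?ii \<longleftrightarrow> ?viii"
  proof
    show "?ii \<Longrightarrow> ?viii" using test0_conv_imp_conv by blast
    show "?viii \<Longrightarrow> ?ii" using test0_subset by blast
  qed
  have viii_v: "?viii \<Longrightarrow> ?v"
  proof -
    assume ?viii
    from struct[OF this] obtain k f where
      "k \<ge> 1" "\<forall>j\<le>k. f j \<in> AAP \<and> bounded (range (f j))" "\<forall>\<phi>\<in>\<D>. T \<phi> = ?sum k f \<phi>" by blast
    then show ?v
      using T T_self by (intro bexI[of _ T] exI[of _ k] exI[of _ f] conjI) (simp_all add: dist_eq_on_def)
  qed
  have v_iv: "?v \<Longrightarrow> ?iv"
  proof -
    assume ?v
    then obtain S k and f :: "nat \<Rightarrow> real \<Rightarrow> 'x" where *: "k \<ge> 1" "\<forall>j\<le>k. f j \<in> AAP \<and> bounded (range (f j))"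
      "dist_eq_on \<D> S (?sum k f)" "dist_eq_on \<D>\<^sub>0 S T" by blast
    have "dist_eq_on \<D>\<^sub>0 T (?sum k f)"
      unfolding dist_eq_on_def
    proof
      fix \<phi> assume \<phi>: "\<phi> \<in> \<D>\<^sub>0"
      have "S \<phi> = ?sum k f \<phi>" using *(3) test0_subset[OF \<phi>] unfolding dist_eq_on_def by (rule bspec)
      moreover have "S \<phi> = T \<phi>" using *(4) \<phi> unfolding dist_eq_on_def by (rule bspec)
      ultimately show "T \<phi> = ?sum k f \<phi>" by simp
    qed
    then show ?iv using *(1,2) by blast
  qed
  have iv_iii: "?iv \<Longrightarrow> ?iii" by blast
  have iii_viii: "?iii \<Longrightarrow> ?viii"
  proof
    fix \<phi> assume ?iii and \<phi>: "\<phi> \<in> \<D>"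
    then obtain k and f :: "nat \<Rightarrow> real \<Rightarrow> 'x" where f: "\<forall>j\<le>k. f j \<in> AAP" and eq: "dist_eq_on \<D>\<^sub>0 T (?sum k f)" by blast
    have "dist_conv (?sum k f) \<phi> \<in> AAP" by (rule sum_regular_conv_AAP[OF _ \<phi>]) (use f in blast)
    then show "dist_conv T \<phi> \<in> AAP" by (rule AAP_transfer[OF T eq \<phi>])
  qed
  have vi: "?vi \<longleftrightarrow> ?viii"
  proof
    show "?viii \<Longrightarrow> ?vi" using T T_self by blast
    assume ?vi
    then obtain S where "dist_eq_on \<D>\<^sub>0 S T" and S: "\<forall>\<phi>\<in>\<D>. dist_conv S \<phi> \<in> AAP" by blast
    then have "dist_eq_on \<D>\<^sub>0 T S" by (simp add: dist_eq_on_def)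
    then show ?viii using AAP_transfer[OF T] S by blast
  qed
  have vii: "?vii \<longleftrightarrow> ?viii"
  proof
    assume ?vii
    then obtain f R where *: "\<forall>n. f n \<in> smooth_functions \<inter> AAP \<and> R n \<in> bounded_dists \<and> dist_eq_on \<D> (R n) (regular_dist (f n))"
      and lim: "strong_limit R T" by blast
    show ?viii
    proof
      fix \<phi> assume \<phi>: "\<phi> \<in> \<D>"
      show "dist_conv T \<phi> \<in> AAP"
        by (rule strong_limit_conv_AAP[OF _ _ lim \<phi>, of f]) (use * in simp_all)
    qed
  next
    assume conv: ?viii
    let ?f = "\<lambda>n. dist_conv T (mollifier n)"
    let ?R = "\<lambda>n \<phi>. T (smear 0 1 pulse (inverse (real (Suc n))) \<phi>)"
    have "?f n \<in> smooth_functions \<inter> AAP" for n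
      using conv mollifier_test dist_conv_smooth[OF T test_DL1[OF mollifier_test]] by blast
    moreover have "?R n \<in> bounded_dists" for n by (rule bd_comp_smear[OF T continuous_on_pulse])
    moreover have "dist_eq_on \<D> (?R n) (regular_dist (?f n))" for n
      unfolding dist_eq_on_def by (intro ballI bd_mollify T)
    ultimately show ?vii using mollification_strong_limit[OF T]
      by (intro exI[of _ ?f] exI[of _ ?R] conjI allI)
  qed
  have iii: "?iii \<longleftrightarrow> ?viii" and iv: "?iv \<longleftrightarrow> ?viii" and v: "?v \<longleftrightarrow> ?viii"
    using viii_v v_iv iv_iii iii_viii by argo+
  show ?thesis
    unfolding i by (intro conjI ii[symmetric] iii[symmetric] iv[symmetric] v[symmetric] vi[symmetric] vii[symmetric] refl)
qed

end
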